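(* Let $k\ge2$. If $G$ and $G'$ are non-isomorphic $k$-graphs both of order $n$, then $$\mathrm{D}_1(G,G')\le\Bigl(1-\frac1k\Bigr)n+2k-1.$$
   Context: A $k$-uniform hypergraph ($k$-graph) $G$ on a finite vertex set $V(G)$ is a family $E(G)$ of $k$-element subsets of $V(G)$; its order is $|V(G)|$. It is regarded as a structure with a single $k$-ary relation $E$, where $E(x_1,\ldots,x_k)$ holds iff $x_1,\dots,x_k$ are pairwise distinct and $\{x_1,\ldots,x_k\}\in E(G)$. First order formulas use $E$, $=$ and the connectives $\neg,\wedge,\vee$. A closed formula $\Phi$ distinguishes $G$ from $G'$ if it is true on $G$ and false on $G'$. The set $\mathrm{Nest}(\Phi)$ of sequences of nested quantifiers is defined inductively: $\mathrm{Nest}(\Phi)=\{\epsilon\}$ (the empty word) for atomic $\Phi$; $\mathrm{Nest}(\neg\Phi)$ is obtained from $\mathrm{Nest}(\Phi)$ by exchanging $\exists$ and $\forall$ in all words; $\mathrm{Nest}(\Phi\wedge\Psi)=\mathrm{Nest}(\Phi\vee\Psi)=\mathrm{Nest}(\Phi)\cup\mathrm{Nest}(\Psi)$; $\mathrm{Nest}(\exists x\Phi)$ and $\mathrm{Nest}(\forall x\Phi)$ are obtained by prepending $\exists$, respectively $\forall$, to every word of $\mathrm{Nest}(\Phi)$. The quantifier rank of $\Phi$ is the maximum length of a word in $\mathrm{Nest}(\Phi)$; the alternation number of $\Phi$ is the maximum, over words in $\mathrm{Nest}(\Phi)$, of the number of occurrences of $\exists\forall$ and $\forall\exists$ as consecutive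 letters. $\mathrm{D}_1(G,G')$ is the minimum quantifier rank of a formula with alternation number at most $1$ distinguishing $G$ from $G'$. *)

theory Defs
  imports Complex_Main "HOL-Library.Extended_Real"
begin

section \<open>Uniform hypergraphs\<close>

record 'a hypergraph =
  verts :: "'a set"
  edges :: "'a set set"

definition k_graph :: "nat \<Rightarrow> 'a hypergraph \<Rightarrow> bool" where
  "k_graph k G \<longleftrightarrow> finite (verts G) \<and> (\<forall>e \<in> edges G. e \<subseteq> verts G \<and> card e = k)"

definition isomorphic :: "'a hypergraph \<Rightarrow> 'b hypergraph \<Rightarrow> bool" where
  "isomorphic G H \<longleftrightarrow> 
     (\<exists>f. bij_betw f (verts G) (verts H) \<and> 
          (\<forall>e. e \<subseteq> verts G \<longrightarrow> (f ` e \<in> edges H \<longleftrightarrow> e \<in> edges G)))"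


section \<open>First order formulas\<close>

text \<open>Variables are natural numbers. The constructor \<open>Edge\<close> carries the list of arguments of the
  relation symbol; its arity is imposed separately by \<open>k_formula\<close>.\<close>

datatype formula =
    Edge "nat list"
  | Equal nat nat
  | Neg formula
  | Conj formula formula
  | Disj formula formula
  | Exi nat formula
  | Uni nat formula

primrec k_formula :: "nat \<Rightarrow> formula \<Rightarrow> bool" where
  "k_formula k (Edge xs) \<longleftrightarrow> length xs = k"
| "k_formula k (Equal x y) \<longleftrightarrow> True"
| "k_formula k (Neg \<Phi>) \<longleftrightarrow> k_formula k \<Phi>"
| "k_formula k (Conj \<Phi> \<Psi>) \<longleftrightarrow> k_formula k \<Phi> \<and> k_formula k \<Psi>"
| "k_formula k (Disj \<Phi> \<Psi>) \<longleftrightarrow> k_formula k \<Phi> \<and> k_formula k \<Psi>"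
| "k_formula k (Exi x \<Phi>) \<longleftrightarrow> k_formula k \<Phi>"
| "k_formula k (Uni x \<Phi>) \<longleftrightarrow> k_formula k \<Phi>"

primrec free_vars :: "formula \<Rightarrow> nat set" where
  "free_vars (Edge xs) = set xs"
| "free_vars (Equal x y) = {x, y}"
| "free_vars (Neg \<Phi>) = free_vars \<Phi>"
| "free_vars (Conj \<Phi> \<Psi>) = free_vars \<Phi> \<union> free_vars \<Psi>"
| "free_vars (Disj \<Phi> \<Psi>) = free_vars \<Phi> \<union> free_vars \<Psi>"
| "free_vars (Exi x \<Phi>) = free_vars \<Phi> - {x}"
| "free_vars (Uni x \<Phi>) = free_vars \<Phi> - {x}"

definition closed_formula :: "formula \<Rightarrow> bool" where
  "closed_formula \<Phi> \<longleftrightarrow> free_vars \<Phi> = {}"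

primrec sat :: "'a hypergraph \<Rightarrow> (nat \<Rightarrow> 'a) \<Rightarrow> formula \<Rightarrow> bool" where
  "sat G \<sigma> (Edge xs) \<longleftrightarrow> distinct (map \<sigma> xs) \<and> set (map \<sigma> xs) \<in> edges G"
| "sat G \<sigma> (Equal x y) \<longleftrightarrow> \<sigma> x = \<sigma> y"
| "sat G \<sigma> (Neg \<Phi>) \<longleftrightarrow> \<not> sat G \<sigma> \<Phi>"
| "sat G \<sigma> (Conj \<Phi> \<Psi>) \<longleftrightarrow> sat G \<sigma> \<Phi> \<and> sat G \<sigma> \<Psi>"
| "sat G \<sigma> (Disj \<Phi> \<Psi>) \<longleftrightarrow> sat G \<sigma> \<Phi> \<or> sat G \<sigma> \<Psi>"
| "sat G \<sigma> (Exi x \<Phi>) \<longleftrightarrow> (\<exists>v \<in> verts G. sat G (\<sigma>(x := v)) \<Phi>)"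
| "sat G \<sigma> (Uni x \<Phi>) \<longleftrightarrow> (\<forall>v \<in> verts G. sat G (\<sigma>(x := v)) \<Phi>)"

lemma sat_cong:
  assumes "\<And>x. x \<in> free_vars \<Phi> \<Longrightarrow> \<sigma> x = \<tau> x"
  shows "sat G \<sigma> \<Phi> \<longleftrightarrow> sat G \<tau> \<Phi>"
  using assms
proof (induction \<Phi> arbitrary: \<sigma> \<tau>)
  case (Edge xs)
  then have "map \<sigma> xs = map \<tau> xs" by simp
  then show ?case by (simp only: sat.simps)
next
  case (Neg \<Phi>)
  then show ?case by (metis free_vars.simps(3) sat.simps(3))
next
  case (Conj \<Phi> \<Psi>)
  then show ?case by (metis UnCI free_vars.simps(4) sat.simps(4))
next
  case (Disj \<Phi> \<Psi>)
  then show ?case by (metis UnCI free_vars.simps(5) sat.simps(5))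
next
  case (Exi x \<Phi>)
  have "sat G (\<sigma>(x := v)) \<Phi> \<longleftrightarrow> sat G (\<tau>(x := v)) \<Phi>" for v
    by (rule Exi.IH) (use Exi.prems in auto)
  then show ?case by simp
next
  case (Uni x \<Phi>)
  have "sat G (\<sigma>(x := v)) \<Phi> \<longleftrightarrow> sat G (\<tau>(x := v)) \<Phi>" for v
    by (rule Uni.IH) (use Uni.prems in auto)
  then show ?case by simp
qed simp

text \<open>The assignment is irrelevant for a closed formula. It ranges over the whole type rather than
  over the vertices, so that truth on the hypergraph without vertices is not vacuous.\<close>

definition true_on :: "'a hypergraph \<Rightarrow> formula \<Rightarrow> bool" where
  "true_on G \<Phi> \<longleftrightarrow> (\<forall>\<sigma>. sat G \<sigma> \<Phi>)"

lemma true_on_iff_sat: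
  assumes "closed_formula \<Phi>"
  shows "true_on G \<Phi> \<longleftrightarrow> sat G \<sigma> \<Phi>"
proof -
  have "sat G \<sigma> \<Phi> \<longleftrightarrow> sat G \<tau> \<Phi>" for \<tau>
    by (rule sat_cong) (use assms in \<open>simp add: closed_formula_def\<close>)
  then show ?thesis by (auto simp: true_on_def)
qed

definition distinguishes :: "formula \<Rightarrow> 'a hypergraph \<Rightarrow> 'b hypergraph \<Rightarrow> bool" where
  "distinguishes \<Phi> G H \<longleftrightarrow> closed_formula \<Phi> \<and> true_on G \<Phi> \<and> \<not> true_on H \<Phi>"


section \<open>Quantifier rank and alternation number\<close>

datatype quantifier = Q_ex | Q_all

primrec dual :: "quantifier \<Rightarrow> quantifier" where
  "dual Q_ex = Q_all"
| "dual Q_all = Q_ex"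

primrec Nest :: "formula \<Rightarrow> quantifier list set" where
  "Nest (Edge xs) = {[]}"
| "Nest (Equal x y) = {[]}"
| "Nest (Neg \<Phi>) = map dual ` Nest \<Phi>"
| "Nest (Conj \<Phi> \<Psi>) = Nest \<Phi> \<union> Nest \<Psi>"
| "Nest (Disj \<Phi> \<Psi>) = Nest \<Phi> \<union> Nest \<Psi>"
| "Nest (Exi x \<Phi>) = (#) Q_ex ` Nest \<Phi>"
| "Nest (Uni x \<Phi>) = (#) Q_all ` Nest \<Phi>"

lemma finite_Nest [simp]: "finite (Nest \<Phi>)"
  by (induction \<Phi>) auto

lemma Nest_nonempty [simp]: "Nest \<Phi> \<noteq> {}"
  by (induction \<Phi>) auto

definition quantifier_rank :: "formula \<Rightarrow> nat" where
  "quantifier_rank \<Phi> = Max (length ` Nest \<Phi>)"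

definition alternations :: "quantifier list \<Rightarrow> nat" where
  "alternations w = card {i. Suc i < length w \<and> w ! i \<noteq> w ! Suc i}"

definition alternation_number :: "formula \<Rightarrow> nat" where
  "alternation_number \<Phi> = Max (alternations ` Nest \<Phi>)"

text \<open>The minimum is taken in the extended naturals: it is attained whenever a suitable formula
  exists, and is infinite otherwise. The uniformity \<open>k\<close> is a parameter because it fixes the arity of
  the relation symbol.\<close>

definition D_alt :: "nat \<Rightarrow> nat \<Rightarrow> 'a hypergraph \<Rightarrow> 'b hypergraph \<Rightarrow> enat" where
  "D_alt a k G H =
     (INF \<Phi> \<in> {\<Phi>. k_formula k \<Phi> \<and> distinguishes \<Phi> G H \<and> alternation_number \<Phi> \<le> a}.
        enat (quantifier_rank \<Phi>))"

end

theory Submission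
  imports Defs
begin

text \<open>
  The bound is obtained from the Ehrenfeucht game in which Spoiler first pebbles a set of vertices
  of one graph and then plays \<open>r\<close> further rounds, staying in one graph throughout.

  Partially color the vertices of \<open>G\<close> by \<open>1, \<dots>, k\<close> so that any two vertices of the same color \<open>i\<close> are
  separated by a \<open>(k - 1)\<close>-set of vertices of other colors, with as many colored vertices as
  possible (over both graphs). Since a \<open>(k - 1)\<close>-set misses some color, maximality makes every
  uncolored vertex behave, against any \<open>(k - 1)\<close>-set avoiding color \<open>j\<close> among its colored vertices,
  like one fixed vertex of color \<open>j\<close>. Hence the graph is determined by its colored part and by the
  types of the uncolored vertices over it.

  Spoiler pebbles all colors but the largest class \<open>A\<close>. The remaining vertices fall into blocks, one
  for each \<open>a \<in> A\<close>. Blocks of size \<open>1\<close> need no pebble and blocks of size at least \<open>3\<close> can afford one on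
  \<open>a\<close>. Blocks of size \<open>2\<close> are colored by \<open>1, \<dots>, k\<close> in turn, such that a block of color \<open>i\<close> is resolved
  by blocks of other colors, and again as many as possible; all of them but those of the most
  frequent color are pebbled, and swapping the two vertices of an uncolored block is harmless. If
  Duplicator survives, the colored parts of the two graphs are isomorphic and the types of uncolored
  vertices occur equally often, so the graphs are isomorphic.
\<close>

section \<open>Games and formulas\<close>

text \<open>With one alternation Spoiler stays in one graph after the common prefix, so Duplicator
  answers two unrelated plays and no single bijection can be read off: an unpebbled block of size 2
  may be turned differently in different plays. Its color makes up for the missing pebble: a (k -
  1)-set tells its two vertices apart whatever Duplicator does with the other unresolved pairs, so k
  - 1 further moves expose a wrong turn. This is the origin of \<open>2 * k - 1\<close>: k moves
  exhibit a possible edge and k - 1 check an orientation. The factor 1 - 1/k is gained by leaving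
  out the largest of k classes. A block of q vertices adds q - 1 vertices to the one in
  \<open>A\<close>, which allows (1 - 1/k)(q - 1) pebbles: at least one if q is 3 or more, less than
  one if q = 2. Hence pairs need a coloring of their own. What large blocks leave over pays for
  counting vertices in them. The graph with the larger coloring is pebbled because the coloring is
  carried to the other graph and has to be maximal there as well.\<close>

definition partial_iso :: "'a set set \<Rightarrow> 'b set set \<Rightarrow> ('a \<times> 'b) set \<Rightarrow> bool" where
  "partial_iso E E' R \<longleftrightarrow> (\<forall>p \<in> R. \<forall>q \<in> R. fst p = fst q \<longleftrightarrow> snd p = snd q) \<and>
     (\<forall>S \<subseteq> R. fst ` S \<in> E \<longleftrightarrow> snd ` S \<in> E')"

text \<open>\<open>R\<close> collects the pebbled pairs. Spoiler moves in \<open>G\<close>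
  throughout, so that the remaining rounds become a single block of existential quantifiers
  evaluated in \<open>G'\<close>; only the final position is tested.\<close>

primrec ex_game :: "'a hypergraph \<Rightarrow> 'b hypergraph \<Rightarrow> nat \<Rightarrow> ('a \<times> 'b) set \<Rightarrow> bool" where
  "ex_game G G' 0 R \<longleftrightarrow> partial_iso (edges G) (edges G') R"
| "ex_game G G' (Suc r) R \<longleftrightarrow> (\<forall>v \<in> verts G. \<exists>v' \<in> verts G'. ex_game G G' r (insert (v, v') R))"

primrec all_game :: "'a hypergraph \<Rightarrow> 'b hypergraph \<Rightarrow> nat \<Rightarrow> ('a \<times> 'b) set \<Rightarrow> bool" where
  "all_game G G' 0 R \<longleftrightarrow> partial_iso (edges G) (edges G') R"
| "all_game G G' (Suc r) R \<longleftrightarrow> (\<forall>v' \<in> verts G'. \<exists>v \<in> verts G. all_game G G' r (insert (v, v') R))"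

lemma partial_iso_subset: "partial_iso E E' R \<Longrightarrow> S \<subseteq> R \<Longrightarrow> partial_iso E E' S"
  unfolding partial_iso_def by (meson subset_iff subset_trans)

lemma partial_iso_converse: "partial_iso E E' R \<Longrightarrow> partial_iso E' E (prod.swap ` R)"
  unfolding partial_iso_def
proof (intro conjI ballI allI impI)
  assume R: "(\<forall>p \<in> R. \<forall>q \<in> R. fst p = fst q \<longleftrightarrow> snd p = snd q) \<and>
    (\<forall>S \<subseteq> R. fst ` S \<in> E \<longleftrightarrow> snd ` S \<in> E')"
  show "fst p = fst q \<longleftrightarrow> snd p = snd q" if "p \<in> prod.swap ` R" "q \<in> prod.swap ` R" for p q
    using R that by force
  show "fst ` S \<in> E' \<longleftrightarrow> snd ` S \<in> E" if "S \<subseteq> prod.swap ` R" for S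
  proof -
    obtain T where "T \<subseteq> R" "S = prod.swap ` T" using \<open>S \<subseteq> prod.swap ` R\<close> by (meson subset_imageE)
    then show ?thesis using R by (auto simp: image_image)
  qed
qed

text \<open>Partial isomorphisms are closed under subsets, so surviving the last position means
  having survived all earlier ones. Without vertices in \<open>G\<close> Spoiler could not move and
  the game would hold vacuously.\<close>

lemma ex_game_partial_iso: "ex_game G G' r R \<Longrightarrow> verts G \<noteq> {} \<Longrightarrow> partial_iso (edges G) (edges G') R"
proof (induction r arbitrary: R)
  case (Suc r)
  then obtain v v' where "ex_game G G' r (insert (v, v') R)" by (metis ex_in_conv ex_game.simps(2))
  then have "partial_iso (edges G) (edges G') (insert (v, v') R)" using Suc by blast
  then show ?case by (rule partial_iso_subset) blast
qed simp

lemma all_game_iff: "all_game G G' r R \<longleftrightarrow> ex_game G' G r (prod.swap ` R)"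
proof (induction r arbitrary: R)
  case 0
  have "prod.swap ` prod.swap ` R = R" by (simp add: image_image)
  then show ?case using partial_iso_converse[of _ _ R] partial_iso_converse[of _ _ "prod.swap ` R"] by auto
next
  case (Suc r)
  then show ?case by simp
qed

lemma ex_game_refl: "ex_game G G r (Id_on A)"
proof (induction r arbitrary: A)
  case 0
  have "fst ` S = snd ` S" if "S \<subseteq> Id_on A" for S
    using that by (intro image_cong) auto
  then show ?case by (auto simp: partial_iso_def)
next
  case (Suc r)
  have "insert (v, v) (Id_on A) = Id_on (insert v A)" for v by auto
  then show ?case using Suc by (metis ex_game.simps(2))
qed

lemma ex_game_mono:
  assumes "ex_game G G' r R" "verts G \<noteq> {}" "s \<le> r"
  shows "ex_game G G' s R"
  using assms
proof (induction r arbitrary: R s)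
  case (Suc r)
  show ?case
  proof (cases s)
    case 0
    then show ?thesis using ex_game_partial_iso[OF Suc.prems(1,2)] by simp
  next
    case (Suc s')
    then show ?thesis using Suc.prems Suc.IH[of _ s'] by fastforce
  qed
qed simp

text \<open>Spoiler pebbles the vertices of \<open>D\<close> one by one and keeps \<open>s\<close>
  rounds in reserve; all later arguments use the game in this form.\<close>

lemma ex_game_extend:
  assumes "ex_game G G' r R" "verts G \<noteq> {}" "finite D" "D \<subseteq> verts G" "card D + s \<le> r"
  shows "\<exists>R'. R \<subseteq> R' \<and> R' \<subseteq> R \<union> verts G \<times> verts G' \<and> D \<subseteq> fst ` R' \<and> ex_game G G' s R'"
  using assms(3,1,2,4,5)
proof (induction D arbitrary: R r rule: finite_induct)
  case empty
  then show ?case using ex_game_mono[of G G' r R s] by auto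
next
  case (insert x D)
  then obtain r' where r: "r = Suc r'" "card D + s \<le> r'" by (cases r) auto
  then obtain x' where x': "x' \<in> verts G'" "ex_game G G' r' (insert (x, x') R)"
    using insert.prems by auto
  obtain R' where "insert (x, x') R \<subseteq> R'" "R' \<subseteq> insert (x, x') R \<union> verts G \<times> verts G'"
    "D \<subseteq> fst ` R'" "ex_game G G' s R'"
    using insert.IH[OF x'(2)] insert.prems r by auto
  moreover from this have "x \<in> fst ` R'" by (metis fst_conv image_eqI insert_subset)
  ultimately show ?case using x' insert.prems by (intro exI[of _ R']) auto
qed

lemma all_game_extend:
  assumes "all_game G G' r R" "verts G' \<noteq> {}" "finite D" "D \<subseteq> verts G'" "card D + s \<le> r"
  shows "\<exists>R'. R \<subseteq> R' \<and> R' \<subseteq> R \<union> verts G \<times> verts G' \<and> D \<subseteq> snd ` R' \<and> all_game G G' s R'"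
proof -
  obtain R' where R': "prod.swap ` R \<subseteq> R'" "R' \<subseteq> prod.swap ` R \<union> verts G' \<times> verts G"
    "D \<subseteq> fst ` R'" "ex_game G' G s R'"
    using ex_game_extend[of G' G r "prod.swap ` R" D s] assms by (auto simp: all_game_iff)
  have sw: "prod.swap ` prod.swap ` A = A" for A :: "('c \<times> 'd) set" by (simp add: image_image)
  have "R \<subseteq> prod.swap ` R'" using R'(1) sw by (metis image_mono)
  moreover have "prod.swap ` R' \<subseteq> R \<union> verts G \<times> verts G'" using R'(2) by auto
  moreover have "snd ` prod.swap ` R' = fst ` R'" by (simp add: image_image)
  ultimately show ?thesis using R' sw by (metis all_game_iff)
qed

section \<open>Formulas that describe the two games\<close>

fun big_conj :: "formula list \<Rightarrow> formula" where
  "big_conj [] = Equal 0 0"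
| "big_conj [A] = A"
| "big_conj (A # As) = Conj A (big_conj As)"

fun big_disj :: "formula list \<Rightarrow> formula" where
  "big_disj [] = Neg (Equal 0 0)"
| "big_disj [A] = A"
| "big_disj (A # As) = Disj A (big_disj As)"

lemma sat_big_conj [simp]: "sat G \<sigma> (big_conj As) \<longleftrightarrow> (\<forall>A \<in> set As. sat G \<sigma> A)"
  by (induction As rule: big_conj.induct) auto

lemma sat_big_disj [simp]: "sat G \<sigma> (big_disj As) \<longleftrightarrow> (\<exists>A \<in> set As. sat G \<sigma> A)"
  by (induction As rule: big_disj.induct) auto

text \<open>One-element lists are treated apart in \<open>big_conj\<close> and
  \<open>big_disj\<close> for this purpose: a filler atom closing every list would bring in the free
  variable 0.\<close>

lemma free_vars_big [simp]:
  "As \<noteq> [] \<Longrightarrow> free_vars (big_conj As) = (\<Union>A \<in> set As. free_vars A)"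
  "As \<noteq> [] \<Longrightarrow> free_vars (big_disj As) = (\<Union>A \<in> set As. free_vars A)"
  by (induction As rule: big_conj.induct) auto

lemma Nest_big [simp]:
  "As \<noteq> [] \<Longrightarrow> Nest (big_conj As) = (\<Union>A \<in> set As. Nest A)"
  "As \<noteq> [] \<Longrightarrow> Nest (big_disj As) = (\<Union>A \<in> set As. Nest A)"
  by (induction As rule: big_conj.induct) auto

lemma k_formula_big [simp]:
  "k_formula k (big_conj As) \<longleftrightarrow> (\<forall>A \<in> set As. k_formula k A)"
  "k_formula k (big_disj As) \<longleftrightarrow> (\<forall>A \<in> set As. k_formula k A)"
  by (induction As rule: big_conj.induct) auto

definition atoms :: "nat \<Rightarrow> nat \<Rightarrow> formula list" where
  "atoms k l = concat (map (\<lambda>i. map (Equal i) [0..<l]) [0..<l]) @ map Edge (List.n_lists k [0..<l])"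

text \<open>The atomic diagram of the pebbled vertices, where variable \<open>i\<close> denotes the
  pebble at index \<open>i\<close> of \<open>p\<close>; hence \<open>(!) p\<close> serves as the
  assignment.\<close>

definition diagram :: "'a hypergraph \<Rightarrow> nat \<Rightarrow> 'a list \<Rightarrow> formula" where
  "diagram G k p =
     big_conj (map (\<lambda>A. if sat G ((!) p) A then A else Neg A) (atoms k (length p)))"

lemma set_atoms:
  "set (atoms k l) = {Equal i j |i j. i < l \<and> j < l} \<union> {Edge xs |xs. length xs = k \<and> set xs \<subseteq> {..<l}}"
  by (auto simp: atoms_def set_n_lists lessThan_atLeast0)

lemma ball_atoms: "(\<forall>A \<in> set (atoms k l). P A) \<longleftrightarrow> (\<forall>i < l. \<forall>j < l. P (Equal i j)) \<and>
    (\<forall>xs. length xs = k \<and> set xs \<subseteq> {..<l} \<longrightarrow> P (Edge xs))"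
  unfolding set_atoms by blast

lemma atoms_nonempty: "0 < l \<Longrightarrow> atoms k l \<noteq> []"
  using set_atoms[of k l] by fastforce

text \<open>Choose one index for every pair in \<open>S\<close>. The first components form an edge
  of size k and equalities agree on both sides, so these indices can be listed as a repetition-free
  tuple of length k, and the atom of this tuple belongs to the diagram.\<close>

lemma diagram_edge_transfer:
  assumes uniform: "\<And>e. e \<in> E \<Longrightarrow> card e = k" and l: "length p' = length p"
    and eq: "\<And>i j. i < length p \<Longrightarrow> j < length p \<Longrightarrow> p ! i = p ! j \<longleftrightarrow> p' ! i = p' ! j"
    and edge: "\<And>xs. length xs = k \<Longrightarrow> set xs \<subseteq> {..<length p} \<Longrightarrow>
      distinct (map ((!) p) xs) \<and> set (map ((!) p) xs) \<in> E \<Longrightarrow> set (map ((!) p') xs) \<in> E'"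
    and S: "S \<subseteq> set (zip p p')" "fst ` S \<in> E"
  shows "snd ` S \<in> E'"
proof -
  have "\<exists>i < length p. s = (p ! i, p' ! i)" if "s \<in> S" for s
    using that S(1) l by (auto simp: set_zip)
  then obtain f where f: "\<And>s. s \<in> S \<Longrightarrow> f s < length p \<and> s = (p ! f s, p' ! f s)" by metis
  define xs where "xs = sorted_list_of_set (f ` S)"
  have "finite S" using S(1) finite_subset by blast
  then have set_xs: "set xs = f ` S" "distinct xs" by (auto simp: xs_def)
  have img: "(!) p ` set xs = fst ` S" "(!) p' ` set xs = snd ` S"
    unfolding set_xs image_image using f by (metis (no_types, lifting) fst_conv image_cong,
        metis (no_types, lifting) snd_conv image_cong)
  have inj: "inj_on ((!) p) (set xs)"
    unfolding set_xs(1)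
  proof (rule inj_onI)
    fix i j assume "i \<in> f ` S" "j \<in> f ` S" "p ! i = p ! j"
    then obtain s s' where s: "s \<in> S" "s' \<in> S" "i = f s" "j = f s'" by blast
    then have "p' ! i = p' ! j" using eq f \<open>p ! i = p ! j\<close> by blast
    then have "s = s'" using f s \<open>p ! i = p ! j\<close> by metis
    then show "i = j" using s by simp
  qed
  have "length xs = card (set xs)" using set_xs distinct_card by metis
  also have "\<dots> = k" using uniform[OF S(2)] img card_image[OF inj] by simp
  finally have "length xs = k" .
  moreover have "set xs \<subseteq> {..<length p}" using f set_xs by auto
  moreover have "distinct (map ((!) p) xs)" using inj set_xs by (simp add: distinct_map)
  ultimately show ?thesis using edge[of xs] img S(2) by simp
qed

lemma sat_diagram:
  assumes k: "\<And>e. e \<in> edges G \<Longrightarrow> card e = k" "\<And>e. e \<in> edges G' \<Longrightarrow> card e = k"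
    and l: "length p' = length p" and \<sigma>: "\<And>i. i < length p \<Longrightarrow> \<sigma> i = p' ! i"
  shows "sat G' \<sigma> (diagram G k p) \<longleftrightarrow> partial_iso (edges G) (edges G') (set (zip p p'))"
proof -
  have "sat G' \<sigma> A \<longleftrightarrow> sat G' ((!) p') A" if "A \<in> set (atoms k (length p))" for A
    by (rule sat_cong) (use that \<sigma> in \<open>auto simp: set_atoms\<close>)
  then have "sat G' \<sigma> (diagram G k p) \<longleftrightarrow>
      (\<forall>A \<in> set (atoms k (length p)). sat G ((!) p) A \<longleftrightarrow> sat G' ((!) p') A)"
    unfolding diagram_def sat_big_conj set_map ball_simps(9) by (intro ball_cong) auto
  also have "\<dots> \<longleftrightarrow> (\<forall>i < length p. \<forall>j < length p. p ! i = p ! j \<longleftrightarrow> p' ! i = p' ! j) \<and>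
      (\<forall>xs. length xs = k \<and> set xs \<subseteq> {..<length p} \<longrightarrow>
         (distinct (map ((!) p) xs) \<and> set (map ((!) p) xs) \<in> edges G \<longleftrightarrow>
          distinct (map ((!) p') xs) \<and> set (map ((!) p') xs) \<in> edges G'))"
    (is "_ \<longleftrightarrow> ?eq \<and> ?edge")
    by (simp add: ball_atoms)
  also have "\<dots> \<longleftrightarrow> partial_iso (edges G) (edges G') (set (zip p p'))"
  proof
    assume A: "?eq \<and> ?edge"
    show "partial_iso (edges G) (edges G') (set (zip p p'))"
      unfolding partial_iso_def
    proof (intro conjI ballI allI impI)
      fix s s' assume "s \<in> set (zip p p')" "s' \<in> set (zip p p')"
      then show "fst s = fst s' \<longleftrightarrow> snd s = snd s'" using A l by (auto simp: set_zip)
    next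
      fix S assume S: "S \<subseteq> set (zip p p')"
      show "fst ` S \<in> edges G \<longleftrightarrow> snd ` S \<in> edges G'"
      proof
        assume "fst ` S \<in> edges G"
        then show "snd ` S \<in> edges G'"
          using diagram_edge_transfer[of "edges G" k p' p "edges G'" S] k l A S by blast
      next
        assume e: "snd ` S \<in> edges G'"
        have "prod.swap ` S \<subseteq> set (zip p' p)" using S l by (auto simp: set_zip)
        moreover have "fst ` prod.swap ` S \<in> edges G'" using e by (simp add: image_image)
        ultimately have "snd ` prod.swap ` S \<in> edges G"
          using diagram_edge_transfer[of "edges G'" k p p' "edges G" "prod.swap ` S"] k l A by metis
        then show "fst ` S \<in> edges G" by (simp add: image_image)
      qed
    qed
  next
    assume P: "partial_iso (edges G) (edges G') (set (zip p p'))"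
    have in_zip: "(p ! i, p' ! i) \<in> set (zip p p')" if "i < length p" for i
      using that l by (auto simp: set_zip)
    have eq: ?eq using P in_zip unfolding partial_iso_def by (metis fst_conv snd_conv)
    moreover have ?edge
    proof (intro allI impI)
      fix xs assume xs: "length xs = k \<and> set xs \<subseteq> {..<length p}"
      let ?S = "(\<lambda>i. (p ! i, p' ! i)) ` set xs"
      have "?S \<subseteq> set (zip p p')" using in_zip xs by auto
      then have "fst ` ?S \<in> edges G \<longleftrightarrow> snd ` ?S \<in> edges G'" using P by (simp add: partial_iso_def)
      moreover have "inj_on ((!) p) (set xs) \<longleftrightarrow> inj_on ((!) p') (set xs)"
        using eq xs by (auto simp: inj_on_def subset_iff)
      ultimately show "distinct (map ((!) p) xs) \<and> set (map ((!) p) xs) \<in> edges G \<longleftrightarrow>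
          distinct (map ((!) p') xs) \<and> set (map ((!) p') xs) \<in> edges G'"
        by (auto simp: image_image distinct_map)
    qed
    ultimately show "?eq \<and> ?edge" by blast
  qed
  finally show ?thesis .
qed

definition vert_list :: "'a hypergraph \<Rightarrow> 'a list" where
  "vert_list G = (SOME vs. set vs = verts G)"

lemma set_vert_list: "finite (verts G) \<Longrightarrow> set (vert_list G) = verts G"
  unfolding vert_list_def by (rule someI_ex) (rule finite_list)

text \<open>Hintikka formulas for a Spoiler who never changes the graph. Conjunctions and
  disjunctions over the vertices of \<open>G\<close> add no letters to \<open>Nest\<close>, so every
  word is a constant block of length \<open>r\<close>.\<close>

primrec ex_form :: "'a hypergraph \<Rightarrow> nat \<Rightarrow> nat \<Rightarrow> 'a list \<Rightarrow> formula" where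
  "ex_form G k 0 p = diagram G k p"
| "ex_form G k (Suc r) p = big_conj (map (\<lambda>v. Exi (length p) (ex_form G k r (p @ [v]))) (vert_list G))"

primrec all_form :: "'a hypergraph \<Rightarrow> nat \<Rightarrow> nat \<Rightarrow> 'a list \<Rightarrow> formula" where
  "all_form G k 0 p = diagram G k p"
| "all_form G k (Suc r) p = Uni (length p) (big_disj (map (\<lambda>v. all_form G k r (p @ [v])) (vert_list G)))"

lemma sat_ex_form:
  assumes k: "k_graph k G" "k_graph k G'"
    and l: "length p' = length p" and \<sigma>: "\<And>i. i < length p \<Longrightarrow> \<sigma> i = p' ! i"
  shows "sat G' \<sigma> (ex_form G k r p) \<longleftrightarrow> ex_game G G' r (set (zip p p'))"
  using l \<sigma>
proof (induction r arbitrary: p p' \<sigma>)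
  case 0
  then show ?case using sat_diagram[of G k G' p' p \<sigma>] k by (auto simp: k_graph_def)
next
  case (Suc r)
  have step: "sat G' (\<sigma>(length p := v')) (ex_form G k r (p @ [v])) \<longleftrightarrow>
      ex_game G G' r (insert (v, v') (set (zip p p')))" for v v'
  proof -
    have "sat G' (\<sigma>(length p := v')) (ex_form G k r (p @ [v])) \<longleftrightarrow>
      ex_game G G' r (set (zip (p @ [v]) (p' @ [v'])))"
      by (rule Suc.IH) (use Suc.prems in \<open>auto simp: nth_append\<close>)
    then show ?thesis using Suc.prems by simp
  qed
  show ?case using k step by (simp add: set_vert_list k_graph_def)
qed

lemma sat_all_form:
  assumes k: "k_graph k G" "k_graph k G'"
    and l: "length p' = length p" and \<sigma>: "\<And>i. i < length p \<Longrightarrow> \<sigma> i = p' ! i"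
  shows "sat G' \<sigma> (all_form G k r p) \<longleftrightarrow> all_game G G' r (set (zip p p'))"
  using l \<sigma>
proof (induction r arbitrary: p p' \<sigma>)
  case 0
  then show ?case using sat_diagram[of G k G' p' p \<sigma>] k by (auto simp: k_graph_def)
next
  case (Suc r)
  have step: "sat G' (\<sigma>(length p := v')) (all_form G k r (p @ [v])) \<longleftrightarrow>
      all_game G G' r (insert (v, v') (set (zip p p')))" for v v'
  proof -
    have "sat G' (\<sigma>(length p := v')) (all_form G k r (p @ [v])) \<longleftrightarrow>
      all_game G G' r (set (zip (p @ [v]) (p' @ [v'])))"
      by (rule Suc.IH) (use Suc.prems in \<open>auto simp: nth_append\<close>)
    then show ?thesis using Suc.prems by simp
  qed
  show ?case using k step by (simp add: set_vert_list k_graph_def)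
qed

lemma diagram_props:
  assumes "p \<noteq> []"
  shows "free_vars (diagram G k p) \<subseteq> {..<length p}" "Nest (diagram G k p) = {[]}"
    "k_formula k (diagram G k p)"
proof -
  have ne: "map (\<lambda>A. if sat G ((!) p) A then A else Neg A) (atoms k (length p)) \<noteq> []"
    using atoms_nonempty assms by simp
  show "free_vars (diagram G k p) \<subseteq> {..<length p}"
    unfolding diagram_def using ne by (auto simp: set_atoms split: if_splits)
  have "Nest (diagram G k p) \<noteq> {}" by simp
  moreover have "Nest (diagram G k p) \<subseteq> {[]}"
    unfolding diagram_def using ne by (auto simp: set_atoms split: if_splits)
  ultimately show "Nest (diagram G k p) = {[]}" by blast
  show "k_formula k (diagram G k p)"
    unfolding diagram_def by (auto simp: set_atoms)
qed

lemma ex_form_props: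
  assumes "vert_list G \<noteq> []" "0 < length p + r"
  shows "free_vars (ex_form G k r p) \<subseteq> {..<length p} \<and> Nest (ex_form G k r p) \<subseteq> {replicate r Q_ex} \<and>
    k_formula k (ex_form G k r p)"
  using assms
proof (induction r arbitrary: p)
  case 0
  then show ?case using diagram_props[of p] by simp
next
  case (Suc r)
  have IH: "free_vars (ex_form G k r (p @ [v])) \<subseteq> {..<Suc (length p)}"
      "Nest (ex_form G k r (p @ [v])) \<subseteq> {replicate r Q_ex}" "k_formula k (ex_form G k r (p @ [v]))" for v
    using Suc.IH[of "p @ [v]"] Suc.prems by auto
  have "free_vars (ex_form G k (Suc r) p) \<subseteq> {..<length p}"
    using Suc.prems IH(1) by (fastforce simp: less_Suc_eq)
  moreover have "Nest (ex_form G k (Suc r) p) \<subseteq> {replicate (Suc r) Q_ex}"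
    using Suc.prems IH(2) by fastforce
  ultimately show ?case using IH(3) by simp
qed

lemma all_form_props:
  assumes "vert_list G \<noteq> []" "0 < length p + r"
  shows "free_vars (all_form G k r p) \<subseteq> {..<length p} \<and> Nest (all_form G k r p) \<subseteq> {replicate r Q_all} \<and>
    k_formula k (all_form G k r p)"
  using assms
proof (induction r arbitrary: p)
  case 0
  then show ?case using diagram_props[of p] by simp
next
  case (Suc r)
  have IH: "free_vars (all_form G k r (p @ [v])) \<subseteq> {..<Suc (length p)}"
      "Nest (all_form G k r (p @ [v])) \<subseteq> {replicate r Q_all}" "k_formula k (all_form G k r (p @ [v]))" for v
    using Suc.IH[of "p @ [v]"] Suc.prems by auto
  have "free_vars (all_form G k (Suc r) p) \<subseteq> {..<length p}"
    using Suc.prems IH(1) by (fastforce simp: less_Suc_eq)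
  moreover have "Nest (all_form G k (Suc r) p) \<subseteq> {replicate (Suc r) Q_all}"
    using Suc.prems IH(2) by fastforce
  ultimately show ?case using IH(3) by simp
qed

text \<open>The quantifiers bind 0, ..., l - 1 from the outside in, so that variables agree with
  indices in the list of pebbles.\<close>

primrec ex_prefix :: "nat \<Rightarrow> formula \<Rightarrow> formula" where
  "ex_prefix 0 A = A"
| "ex_prefix (Suc l) A = ex_prefix l (Exi l A)"

lemma ex_prefix_props:
  "free_vars (ex_prefix l A) = free_vars A - {..<l}"
  "Nest (ex_prefix l A) = (\<lambda>w. replicate l Q_ex @ w) ` Nest A"
  "k_formula k (ex_prefix l A) = k_formula k A"
proof (induction l arbitrary: A)
  case (Suc l)
  { case 1 then show ?case using Suc by auto }
  { case 2
    show ?case using Suc by (simp add: image_image replicate_app_Cons_same) }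
  { case 3 then show ?case using Suc by simp }
qed auto

lemma sat_ex_prefix:
  assumes "\<And>p. length p = l \<Longrightarrow> set p \<subseteq> verts G \<Longrightarrow>
      (\<And>\<tau>. (\<And>i. i < l \<Longrightarrow> \<tau> i = p ! i) \<Longrightarrow> sat G \<tau> A \<longleftrightarrow> P p)"
  shows "sat G \<sigma> (ex_prefix l A) \<longleftrightarrow> (\<exists>p. length p = l \<and> set p \<subseteq> verts G \<and> P p)"
  using assms
proof (induction l arbitrary: A P \<sigma>)
  case 0
  then show ?case by simp
next
  case (Suc l)
  have "sat G \<sigma> (ex_prefix l (Exi l A)) \<longleftrightarrow>
      (\<exists>p. length p = l \<and> set p \<subseteq> verts G \<and> (\<exists>v \<in> verts G. P (p @ [v])))"
  proof (rule Suc.IH)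
    fix p \<tau> assume p: "length p = l" "set p \<subseteq> verts G" and \<tau>: "\<And>i. i < l \<Longrightarrow> \<tau> i = p ! i"
    have "sat G (\<tau>(l := v)) A \<longleftrightarrow> P (p @ [v])" if "v \<in> verts G" for v
      by (rule Suc.prems) (use p \<tau> that in \<open>auto simp: nth_append less_Suc_eq\<close>)
    then show "sat G \<tau> (Exi l A) \<longleftrightarrow> (\<exists>v \<in> verts G. P (p @ [v]))" by simp
  qed
  also have "\<dots> \<longleftrightarrow> (\<exists>p. length p = Suc l \<and> set p \<subseteq> verts G \<and> P p)"
  proof
    assume "\<exists>p. length p = Suc l \<and> set p \<subseteq> verts G \<and> P p"
    then obtain p where p: "length p = Suc l" "set p \<subseteq> verts G" "P p" by blast
    then have "p = butlast p @ [last p]" by (metis append_butlast_last_id length_0_conv nat.distinct(1))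
    moreover have "length (butlast p) = l" using p by simp
    moreover have "last p \<in> verts G" using p by (metis last_in_set length_0_conv nat.distinct(1) subsetD)
    moreover have "set (butlast p) \<subseteq> verts G" using p by (meson in_set_butlastD subset_iff)
    ultimately show "\<exists>p. length p = l \<and> set p \<subseteq> verts G \<and> (\<exists>v \<in> verts G. P (p @ [v]))"
      using p(3) by metis
  next
    assume "\<exists>p. length p = l \<and> set p \<subseteq> verts G \<and> (\<exists>v \<in> verts G. P (p @ [v]))"
    then obtain p v where "length p = l" "set p \<subseteq> verts G" "v \<in> verts G" "P (p @ [v])" by blast
    then show "\<exists>p. length p = Suc l \<and> set p \<subseteq> verts G \<and> P p" by (intro exI[of _ "p @ [v]"]) simp
  qed
  finally show ?case by simp
qed

text \<open>The word can change only after index \<open>a - 1\<close>. For \<open>a = 0\<close>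
  truncated subtraction names index 0, which does no harm to an upper bound.\<close>

lemma alternations_replicate: "alternations (replicate a x @ replicate b y) \<le> 1"
proof -
  have "{i. Suc i < length (replicate a x @ replicate b y) \<and>
      (replicate a x @ replicate b y) ! i \<noteq> (replicate a x @ replicate b y) ! Suc i} \<subseteq> {a - 1}"
    by (auto simp: nth_append split: if_splits)
  from card_mono[OF _ this] show ?thesis by (simp add: alternations_def)
qed

text \<open>Both plays share the existential prefix. Every word is thus a block of existential
  quantifiers followed by a constant block, which gives at most one alternation.\<close>

definition game_formula :: "'a hypergraph \<Rightarrow> nat \<Rightarrow> nat \<Rightarrow> 'a list \<Rightarrow> formula" where
  "game_formula G k r p = ex_prefix (length p) (Conj (ex_form G k r p) (all_form G k r p))"

lemma sat_game_formula:
  assumes "k_graph k G" "k_graph k G'"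
  shows "sat G' \<sigma> (game_formula G k r p) \<longleftrightarrow> (\<exists>p'. length p' = length p \<and> set p' \<subseteq> verts G' \<and>
    ex_game G G' r (set (zip p p')) \<and> all_game G G' r (set (zip p p')))"
  unfolding game_formula_def
  by (rule sat_ex_prefix) (simp add: sat_ex_form[OF assms] sat_all_form[OF assms])

lemma game_formula_props:
  assumes "finite (verts G)" "verts G \<noteq> {}" "0 < length p + r"
  shows "closed_formula (game_formula G k r p)" "k_formula k (game_formula G k r p)"
    "quantifier_rank (game_formula G k r p) \<le> length p + r"
    "alternation_number (game_formula G k r p) \<le> 1"
    "quantifier_rank (Neg (game_formula G k r p)) \<le> length p + r"
    "alternation_number (Neg (game_formula G k r p)) \<le> 1"
proof -
  have "vert_list G \<noteq> []" using set_vert_list[OF assms(1)] assms(2) by auto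
  note props = ex_form_props[OF this assms(3), of k] all_form_props[OF this assms(3), of k]
  show "closed_formula (game_formula G k r p)"
    using props by (auto simp: closed_formula_def game_formula_def ex_prefix_props)
  show "k_formula k (game_formula G k r p)"
    using props by (simp add: game_formula_def ex_prefix_props)
  have N: "Nest (game_formula G k r p) \<subseteq> {replicate (length p) Q_ex @ replicate r Q_ex,
      replicate (length p) Q_ex @ replicate r Q_all}"
    using props by (auto simp: game_formula_def ex_prefix_props)
  then have N': "Nest (Neg (game_formula G k r p)) \<subseteq> {replicate (length p) Q_all @ replicate r Q_all,
      replicate (length p) Q_all @ replicate r Q_ex}" by auto
  have rank: "quantifier_rank A \<le> length p + r" "alternation_number A \<le> 1"
    if "Nest A \<subseteq> {replicate (length p) x @ replicate r y, replicate (length p) x @ replicate r z}" for A x y z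
  proof -
    show "quantifier_rank A \<le> length p + r"
      unfolding quantifier_rank_def using that by (subst Max_le_iff) auto
    show "alternation_number A \<le> 1"
      unfolding alternation_number_def using that alternations_replicate
      by (subst Max_le_iff) (auto dest!: subsetD)
  qed
  show "quantifier_rank (game_formula G k r p) \<le> length p + r"
    "alternation_number (game_formula G k r p) \<le> 1" using rank[OF N] by simp_all
  show "quantifier_rank (Neg (game_formula G k r p)) \<le> length p + r"
    "alternation_number (Neg (game_formula G k r p)) \<le> 1" using rank[OF N'] by simp_all
qed

lemma D_alt_le:
  assumes "k_formula k \<Phi>" "distinguishes \<Phi> G H" "alternation_number \<Phi> \<le> a" "quantifier_rank \<Phi> \<le> m"
  shows "D_alt a k G H \<le> enat m"
proof -
  have "D_alt a k G H \<le> enat (quantifier_rank \<Phi>)"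
    unfolding D_alt_def by (rule INF_lower) (use assms in simp)
  then show ?thesis using assms(4) by (meson enat_ord_simps(1) order_trans)
qed

text \<open>\<open>G\<close> satisfies its own formula with \<open>p\<close> as pebbles, since
  Duplicator can copy every move. The negation distinguishes the pair in the reverse order at the
  same cost.\<close>

lemma D_alt_le_game:
  assumes k: "k_graph k G" "k_graph k G'" and ne: "verts G \<noteq> {}" "0 < length p + r"
    and p: "set p \<subseteq> verts G"
    and no: "\<And>p'. length p' = length p \<Longrightarrow> set p' \<subseteq> verts G' \<Longrightarrow>
      ex_game G G' r (set (zip p p')) \<Longrightarrow> all_game G G' r (set (zip p p')) \<Longrightarrow> False"
  shows "D_alt 1 k G G' \<le> enat (length p + r)" "D_alt 1 k G' G \<le> enat (length p + r)"
proof -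
  have fin: "finite (verts G)" using k by (simp add: k_graph_def)
  note props = game_formula_props[OF fin ne, of k]
  have z: "set (zip p p) = Id_on (set p)" by (auto simp: set_zip in_set_conv_nth)
  have sw: "prod.swap ` Id_on (set p) = Id_on (set p)" by force
  have "sat G \<sigma> (game_formula G k r p)" for \<sigma>
    using sat_game_formula[OF k(1) k(1)] p ex_game_refl[of G r "set p"]
    by (metis all_game_iff sw z)
  then have 1: "true_on G (game_formula G k r p)" by (simp add: true_on_def)
  have 2: "\<not> sat G' \<sigma> (game_formula G k r p)" for \<sigma>
    using sat_game_formula[OF k] no by blast
  have "distinguishes (game_formula G k r p) G G'"
    using 1 2 props by (auto simp: distinguishes_def true_on_def)
  then show "D_alt 1 k G G' \<le> enat (length p + r)" using D_alt_le props by blast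
  have "distinguishes (Neg (game_formula G k r p)) G' G"
    using 1 2 props by (auto simp: distinguishes_def true_on_def closed_formula_def)
  then show "D_alt 1 k G' G \<le> enat (length p + r)" using D_alt_le props by (metis k_formula.simps(3))
qed

section \<open>Separating colorings\<close>

definition similar :: "nat \<Rightarrow> 'a set set \<Rightarrow> 'a set \<Rightarrow> 'a \<Rightarrow> 'a \<Rightarrow> bool" where
  "similar k E S x y \<longleftrightarrow> (\<forall>W \<subseteq> S. Suc (card W) = k \<longrightarrow> (insert x W \<in> E \<longleftrightarrow> insert y W \<in> E))"

text \<open>Color \<open>0\<close> stands for uncolored vertices.\<close>

definition separating_coloring :: "nat \<Rightarrow> 'a set \<Rightarrow> 'a set set \<Rightarrow> ('a \<Rightarrow> nat) \<Rightarrow> bool" where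
  "separating_coloring k V E c \<longleftrightarrow> (\<forall>v \<in> V. c v \<le> k) \<and>
     (\<forall>x \<in> V. \<forall>y \<in> V. x \<noteq> y \<and> c x = c y \<and> c x \<noteq> 0 \<longrightarrow>
        \<not> similar k E {v \<in> V. c v \<noteq> 0 \<and> c v \<noteq> c x} x y)"

definition colored :: "'a set \<Rightarrow> ('a \<Rightarrow> nat) \<Rightarrow> 'a set" where
  "colored V c = {v \<in> V. c v \<noteq> 0}"

definition max_coloring :: "nat \<Rightarrow> 'a set \<Rightarrow> 'a set set \<Rightarrow> ('a \<Rightarrow> nat) \<Rightarrow> bool" where
  "max_coloring k V E c \<longleftrightarrow> separating_coloring k V E c \<and>
     (\<forall>c'. separating_coloring k V E c' \<longrightarrow> card (colored V c') \<le> card (colored V c))"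

definition attached :: "nat \<Rightarrow> 'a set \<Rightarrow> 'a set set \<Rightarrow> ('a \<Rightarrow> nat) \<Rightarrow> nat \<Rightarrow> 'a \<Rightarrow> 'a \<Rightarrow> bool" where
  "attached k V E c j b a \<longleftrightarrow> a \<in> V \<and> c a = j \<and> similar k E {v \<in> V. c v \<noteq> 0 \<and> c v \<noteq> j} b a"

lemma similarD: "similar k E S x y \<Longrightarrow> W \<subseteq> S \<Longrightarrow> Suc (card W) = k \<Longrightarrow> insert x W \<in> E \<longleftrightarrow> insert y W \<in> E"
  by (auto simp: similar_def)

lemma similar_refl [simp]: "similar k E S x x"
  by (simp add: similar_def)

lemma similar_sym: "similar k E S x y \<Longrightarrow> similar k E S y x"
  by (simp add: similar_def)

lemma similar_trans: "similar k E S x y \<Longrightarrow> similar k E S y z \<Longrightarrow> similar k E S x z"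
  by (simp add: similar_def)

lemma similar_mono: "similar k E S x y \<Longrightarrow> T \<subseteq> S \<Longrightarrow> similar k E T x y"
  by (auto simp: similar_def)

lemma not_similar_mono: "\<not> similar k E T x y \<Longrightarrow> T \<subseteq> S \<Longrightarrow> \<not> similar k E S x y"
  by (auto simp: similar_def)

lemma separating_coloringD:
  assumes "separating_coloring k V E c" "x \<in> V" "y \<in> V" "c x = c y" "c x \<noteq> 0"
    "similar k E {v \<in> V. c v \<noteq> 0 \<and> c v \<noteq> c x} x y"
  shows "x = y"
  using assms unfolding separating_coloring_def by blast

text \<open>Giving \<open>b\<close> the color \<open>i\<close> would color one more vertex and so
  cannot be separating. The other classes only gain separating sets and class \<open>i\<close> keeps
  those it had; the failure must come from a vertex of color \<open>i\<close> similar to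
  \<open>b\<close>.\<close>

lemma max_coloring_attached:
  assumes max: "max_coloring k V E c" and fin: "finite V"
    and b: "b \<in> V" "c b = 0" and i: "1 \<le> i" "i \<le> k"
  shows "\<exists>a. attached k V E c i b a"
proof (rule ccontr)
  assume no: "\<not> ?thesis"
  define c' where "c' = c(b := i)"
  have sep: "separating_coloring k V E c" using max by (simp add: max_coloring_def)
  have key: "\<not> similar k E {v \<in> V. c' v \<noteq> 0 \<and> c' v \<noteq> i} b a" if "a \<in> V" "c a = i" for a
  proof -
    have "{v \<in> V. c' v \<noteq> 0 \<and> c' v \<noteq> i} = {v \<in> V. c v \<noteq> 0 \<and> c v \<noteq> i}"
      using b i by (auto simp: c'_def)
    then show ?thesis using no that by (auto simp: attached_def)
  qed
  have "separating_coloring k V E c'"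
    unfolding separating_coloring_def
  proof (intro conjI ballI impI)
    fix v assume "v \<in> V"
    then show "c' v \<le> k" using sep i by (auto simp: c'_def separating_coloring_def)
  next
    fix x y assume xy: "x \<in> V" "y \<in> V" "x \<noteq> y \<and> c' x = c' y \<and> c' x \<noteq> 0"
    show "\<not> similar k E {v \<in> V. c' v \<noteq> 0 \<and> c' v \<noteq> c' x} x y"
    proof (cases "x = b \<or> y = b")
      case True
      then have "c' x = i" using xy by (auto simp: c'_def)
      then consider "x = b" "c y = i" "y \<in> V" | "y = b" "c x = i" "x \<in> V"
        using True xy by (auto simp: c'_def split: if_splits)
      then show ?thesis
        using key \<open>c' x = i\<close> by cases (auto dest: similar_sym)
    next
      case False
      then have eq: "c' x = c x" "c' y = c y" by (auto simp: c'_def)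
      have "\<not> similar k E {v \<in> V. c v \<noteq> 0 \<and> c v \<noteq> c x} x y"
        using sep xy eq by (auto simp: separating_coloring_def)
      moreover have "{v \<in> V. c v \<noteq> 0 \<and> c v \<noteq> c x} \<subseteq> {v \<in> V. c' v \<noteq> 0 \<and> c' v \<noteq> c' x}"
        using b eq by (auto simp: c'_def)
      ultimately show ?thesis by (rule not_similar_mono)
    qed
  qed
  then have "card (colored V c') \<le> card (colored V c)" using max by (simp add: max_coloring_def)
  moreover have "colored V c' = insert b (colored V c)" "b \<notin> colored V c" "finite (colored V c)"
    using b i fin by (auto simp: colored_def c'_def)
  ultimately show False by simp
qed

text \<open>If the two truth values differed, minimality of \<open>B\<close> would make \<open>S \<union> B - {b}\<close> separate
  every \<open>b \<in> B\<close> from \<open>h b\<close>, so that all of \<open>B\<close> could be colored by \<open>\<rho>\<close>.\<close>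

lemma max_coloring_replace_all:
  assumes max: "max_coloring k V E c" and fin: "finite V"
  assumes "S \<subseteq> colored V c" "B \<subseteq> V - colored V c" "card S + card B = k"
    "inj_on \<rho> B" "\<rho> ` B \<subseteq> {1..k}" "\<And>b s. b \<in> B \<Longrightarrow> s \<in> S \<Longrightarrow> c s \<noteq> \<rho> b"
    "\<And>b. b \<in> B \<Longrightarrow> attached k V E c (\<rho> b) b (h b)"
  shows "S \<union> B \<in> E \<longleftrightarrow> S \<union> h ` B \<in> E"
  using assms(3-)
proof (induction "card B" arbitrary: S B rule: less_induct)
  case less
  have finB: "finite B" using less.prems(2) fin finite_subset by blast
  have finS: "finite S" using less.prems(1) fin by (auto simp: colored_def intro: finite_subset)
  have sep: "separating_coloring k V E c" using max by (simp add: max_coloring_def)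
  have hb: "h b \<in> colored V c" "c (h b) = \<rho> b" "1 \<le> \<rho> b" "h b \<in> V" if "b \<in> B" for b
    using less.prems(5) less.prems(7)[OF that] that by (auto simp: attached_def colored_def)
  show ?case
  proof (rule ccontr)
    assume neq: "\<not> ?case"
    \<comment> \<open>\<open>h b\<close> is colored and can be moved into \<open>S\<close>. The
      induction hypothesis for \<open>B - {b}\<close> then shows that exchanging \<open>b\<close>
      alone has the same effect as replacing all of \<open>B\<close>.\<close>
    have separated: "insert b (S \<union> (B - {b})) \<in> E \<longleftrightarrow> insert (h b) (S \<union> (B - {b})) \<notin> E" if b: "b \<in> B" for b
    proof -
      have "h b \<notin> S" using less.prems(6)[OF b] hb[OF b] by blast
      then have cS: "card (insert (h b) S) = Suc (card S)" using finS by simp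
      have cB: "card B = Suc (card (B - {b}))" using finB b by (metis card_Suc_Diff1)
      have "insert (h b) S \<union> (B - {b}) \<in> E \<longleftrightarrow> insert (h b) S \<union> h ` (B - {b}) \<in> E"
      proof (rule less.hyps)
        show "card (B - {b}) < card B" using cB by simp
        show "insert (h b) S \<subseteq> colored V c" using less.prems(1) hb[OF b] by simp
        show "B - {b} \<subseteq> V - colored V c" using less.prems(2) by blast
        show "card (insert (h b) S) + card (B - {b}) = k" using cS cB less.prems(3) by simp
        show "inj_on \<rho> (B - {b})" using less.prems(4) by (simp add: inj_on_diff)
        show "\<rho> ` (B - {b}) \<subseteq> {1..k}" using less.prems(5) by blast
        show "c s \<noteq> \<rho> b'" if "b' \<in> B - {b}" "s \<in> insert (h b) S" for b' s
          using that less.prems(4,6) hb[OF b] b by (auto dest: inj_onD)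
        show "attached k V E c (\<rho> b') b' (h b')" if "b' \<in> B - {b}" for b'
          using that less.prems(7) by blast
      qed
      moreover have "insert (h b) S \<union> h ` (B - {b}) = S \<union> h ` B" using b by blast
      moreover have "insert b (S \<union> (B - {b})) = S \<union> B" using b by blast
      ultimately show ?thesis using neq by auto
    qed
    define c' where "c' v = (if v \<in> B then \<rho> v else c v)" for v
    have c'col: "c' v = c v" if "v \<in> colored V c" for v using that less.prems(2) by (auto simp: c'_def)
    have sub: "{v \<in> V. c v \<noteq> 0 \<and> c v \<noteq> i} \<subseteq> {v \<in> V. c' v \<noteq> 0 \<and> c' v \<noteq> i}" for i
      using c'col by (auto simp: colored_def)
    \<comment> \<open>\<open>h b\<close> is separated from \<open>b\<close> by the set just found.
      Any other vertex of this color was already separated from \<open>h b\<close>, to which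
      \<open>b\<close> is similar over the old colored vertices.\<close>
    have mixed: "\<not> similar k E {v \<in> V. c' v \<noteq> 0 \<and> c' v \<noteq> \<rho> b} b y"
      if b: "b \<in> B" and y: "y \<in> V" "y \<notin> B" "c y = \<rho> b" for b y
    proof (cases "y = h b")
      case True
      let ?W = "S \<union> (B - {b})"
      have "S \<inter> (B - {b}) = {}" using less.prems(1,2) by blast
      then have "card ?W = card S + card (B - {b})" using finS finB by (simp add: card_Un_disjoint)
      then have "Suc (card ?W) = k" using less.prems(3) card_Suc_Diff1[OF finB b] by simp
      moreover have "v \<in> V \<and> c' v \<noteq> 0 \<and> c' v \<noteq> \<rho> b" if v: "v \<in> ?W" for v
      proof (cases "v \<in> S")
        case True
        then show ?thesis using less.prems(1) less.prems(6)[OF b True] c'col[of v]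
          by (auto simp: colored_def)
      next
        case False
        then have "v \<in> B" "v \<noteq> b" using v by auto
        then show ?thesis using less.prems(2) hb(3)[of v] inj_onD[OF less.prems(4), of v b] b
          by (auto simp: c'_def)
      qed
      then have "?W \<subseteq> {v \<in> V. c' v \<noteq> 0 \<and> c' v \<noteq> \<rho> b}" by blast
      ultimately show ?thesis using separated[OF b] True unfolding similar_def by blast
    next
      case False
      have "\<not> similar k E {v \<in> V. c v \<noteq> 0 \<and> c v \<noteq> \<rho> b} (h b) y"
        using separating_coloringD[OF sep hb(4)[OF b] y(1)] False y hb(2,3)[OF b] by auto
      moreover have "similar k E {v \<in> V. c v \<noteq> 0 \<and> c v \<noteq> \<rho> b} b (h b)"
        using less.prems(7)[OF b] by (simp add: attached_def)
      ultimately show ?thesis using sub similar_mono similar_sym similar_trans by meson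
    qed
    have "separating_coloring k V E c'"
      unfolding separating_coloring_def
    proof (intro conjI ballI impI)
      fix v assume "v \<in> V"
      then show "c' v \<le> k" using sep less.prems(5) by (auto simp: c'_def separating_coloring_def)
    next
      fix x y assume xy: "x \<in> V" "y \<in> V" "x \<noteq> y \<and> c' x = c' y \<and> c' x \<noteq> 0"
      consider "x \<in> B" "y \<in> B" | "x \<in> B" "y \<notin> B" | "x \<notin> B" "y \<in> B" | "x \<notin> B" "y \<notin> B" by blast
      then show "\<not> similar k E {v \<in> V. c' v \<noteq> 0 \<and> c' v \<noteq> c' x} x y"
      proof cases
        case 1 then show ?thesis using xy less.prems(4) by (auto simp: c'_def dest: inj_onD)
      next
        case 2 then show ?thesis using mixed[of x y] xy by (auto simp: c'_def)
      next
        case 3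
        then have "\<not> similar k E {v \<in> V. c' v \<noteq> 0 \<and> c' v \<noteq> c' x} y x"
          using mixed[of y x] xy by (auto simp: c'_def)
        then show ?thesis by (auto dest: similar_sym)
      next
        case 4
        then have "\<not> similar k E {v \<in> V. c v \<noteq> 0 \<and> c v \<noteq> c' x} x y"
          using sep xy by (auto simp: c'_def separating_coloring_def)
        then show ?thesis using sub by (rule not_similar_mono)
      qed
    qed
    then have le: "card (colored V c') \<le> card (colored V c)" using max by (simp add: max_coloring_def)
    have "colored V c' = colored V c \<union> B"
      using less.prems(2,5) by (auto simp: colored_def c'_def)
    moreover have "B \<noteq> {}" using neq by auto
    ultimately have "card (colored V c') > card (colored V c)"
      using finB less.prems(2) fin
      by (metis Diff_disjoint Int_commute card_Un_disjoint card_gt_0_iff colored_def disjoint_iff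
          finite_Collect_conjI finite_code less_add_same_cancel1 subset_eq Collect_mem_eq)
    then show False using le by simp
  qed
qed

text \<open>\<open>S\<close> and \<open>j\<close> block at most \<open>card S + 1\<close> colors, so
  enough remain for an injective choice of colors on \<open>B\<close>. Replacing all of
  \<open>insert b B\<close>, or all of \<open>B\<close> after \<open>a\<close> has joined
  \<open>S\<close>, leads to the same set, and \<open>max_coloring_replace_all\<close> covers
  both.\<close>

lemma max_coloring_swap:
  assumes max: "max_coloring k V E c" and fin: "finite V"
    and S: "S \<subseteq> colored V c" and B: "B \<subseteq> V - colored V c"
    and b: "b \<in> V - colored V c" "b \<notin> B" and card: "Suc (card S + card B) = k"
    and j: "1 \<le> j" "j \<le> k" "\<And>s. s \<in> S \<Longrightarrow> c s \<noteq> j" and a: "attached k V E c j b a"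
  shows "insert b (S \<union> B) \<in> E \<longleftrightarrow> insert a (S \<union> B) \<in> E"
proof -
  have finB: "finite B" using B fin finite_subset by blast
  have finS: "finite S" using S fin by (auto simp: colored_def intro: finite_subset)
  define M where "M = {1..k} - c ` S - {j}"
  have "card M \<ge> card ({1..k} - c ` S) - 1"
    unfolding M_def by (simp add: card_Diff_singleton_if)
  moreover have "card ({1..k} - c ` S) \<ge> k - card S"
    using diff_card_le_card_Diff[of "c ` S" "{1..k}"] card_image_le[OF finS, of c] finS by simp
  ultimately have "card B \<le> card M" using card by linarith
  moreover have "finite M" by (simp add: M_def)
  ultimately obtain \<rho> where \<rho>: "\<rho> ` B \<subseteq> M" "inj_on \<rho> B" using card_le_inj[OF finB] by blast
  have "\<exists>h. \<forall>b' \<in> B. attached k V E c (\<rho> b') b' (h b')"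
  proof (rule bchoice, rule ballI)
    fix b' assume "b' \<in> B"
    then have "\<rho> b' \<in> M" "b' \<in> V" "c b' = 0" using \<rho> B by (auto simp: colored_def)
    then show "\<exists>a. attached k V E c (\<rho> b') b' a"
      using max_coloring_attached[OF max fin] by (simp add: M_def)
  qed
  then obtain h where h: "\<And>b'. b' \<in> B \<Longrightarrow> attached k V E c (\<rho> b') b' (h b')" by blast
  have acol: "a \<in> colored V c" "c a = j" using a j by (auto simp: attached_def colored_def)
  have "S \<union> insert b B \<in> E \<longleftrightarrow> S \<union> (h(b := a)) ` insert b B \<in> E"
  proof (rule max_coloring_replace_all[OF max fin, where \<rho> = "\<rho>(b := j)"])
    show "inj_on (\<rho>(b := j)) (insert b B)"
      using \<rho> b by (auto simp: inj_on_def M_def)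
  qed (use S B b card j a \<rho> h finB in \<open>auto simp: M_def\<close>)
  moreover have "insert a S \<union> B \<in> E \<longleftrightarrow> insert a S \<union> h ` B \<in> E"
  proof (rule max_coloring_replace_all[OF max fin, where \<rho> = \<rho>])
    have "a \<notin> S" using acol j by blast
    then show "card (insert a S) + card B = k" using card finS by simp
  qed (use S B b card j a \<rho> h finB acol in \<open>auto simp: M_def\<close>)
  moreover have "S \<union> (h(b := a)) ` insert b B = insert a S \<union> h ` B" using b by auto
  ultimately show ?thesis by (metis Un_insert_left Un_insert_right)
qed

section \<open>Colorings of pairs\<close>

text \<open>Turns around all pairs whose representative is in \<open>F\<close>: \<open>t\<close>
  yields the representative of a vertex and \<open>p\<close> its partner in the pair.\<close>

definition flip :: "('a \<Rightarrow> 'a) \<Rightarrow> ('a \<Rightarrow> 'a) \<Rightarrow> 'a set \<Rightarrow> 'a \<Rightarrow> 'a" where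
  "flip t p F v = (if t v \<in> F then p v else v)"

locale pairing =
  fixes M J :: "'a set" and t p :: "'a \<Rightarrow> 'a"
  assumes finite_J: "finite J"
    and p_in: "\<And>v. v \<in> M \<Longrightarrow> t v \<in> J \<Longrightarrow> p v \<in> M"
    and p_neq: "\<And>v. v \<in> M \<Longrightarrow> t v \<in> J \<Longrightarrow> p v \<noteq> v"
    and p_p: "\<And>v. v \<in> M \<Longrightarrow> t v \<in> J \<Longrightarrow> p (p v) = v"
    and t_p: "\<And>v. v \<in> M \<Longrightarrow> t v \<in> J \<Longrightarrow> t (p v) = t v"
    and pair: "\<And>v w. v \<in> M \<Longrightarrow> w \<in> M \<Longrightarrow> t v \<in> J \<Longrightarrow> t w = t v \<Longrightarrow> w = v \<or> w = p v"
    and J_in: "J \<subseteq> M"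
    and t_J: "\<And>a. a \<in> J \<Longrightarrow> t a = a"
begin

lemma flip_in: "F \<subseteq> J \<Longrightarrow> v \<in> M \<Longrightarrow> flip t p F v \<in> M"
  using p_in by (auto simp: flip_def)

lemma t_flip: "F \<subseteq> J \<Longrightarrow> v \<in> M \<Longrightarrow> t (flip t p F v) = t v"
  using t_p by (auto simp: flip_def)

lemma flip_flip: "F \<subseteq> J \<Longrightarrow> F' \<subseteq> J \<Longrightarrow> v \<in> M \<Longrightarrow>
    flip t p F (flip t p F' v) = flip t p ((F - F') \<union> (F' - F)) v"
  using t_p p_p by (auto simp: flip_def)

lemma flip_self: "F \<subseteq> J \<Longrightarrow> v \<in> M \<Longrightarrow> flip t p F (flip t p F v) = v"
  using t_p p_p by (auto simp: flip_def)

lemma flip_image_in: "F \<subseteq> J \<Longrightarrow> e \<subseteq> M \<Longrightarrow> flip t p F ` e \<subseteq> M"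
  using flip_in by blast

lemma flip_flip_image: "F \<subseteq> J \<Longrightarrow> F' \<subseteq> J \<Longrightarrow> e \<subseteq> M \<Longrightarrow>
    flip t p F ` flip t p F' ` e = flip t p ((F - F') \<union> (F' - F)) ` e"
  unfolding image_image by (rule image_cong) (auto simp: flip_flip)

lemma flip_inj: "F \<subseteq> J \<Longrightarrow> inj_on (flip t p F) M"
  by (metis flip_self inj_onI)

lemma card_flip: "F \<subseteq> J \<Longrightarrow> e \<subseteq> M \<Longrightarrow> card (flip t p F ` e) = card e"
  using flip_inj card_image inj_on_subset by metis

lemma flip_image_cong: "(\<And>v. v \<in> e \<Longrightarrow> t v \<in> F \<longleftrightarrow> t v \<in> F') \<Longrightarrow> flip t p F ` e = flip t p F' ` e"
  by (rule image_cong) (auto simp: flip_def)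

lemma flip_image_trivial: "(\<And>v. v \<in> e \<Longrightarrow> t v \<notin> F) \<Longrightarrow> flip t p F ` e = e"
  by (auto simp: flip_def image_def)

text \<open>The pairs that stay unresolved when both vertices of every pair colored other than \<open>0\<close>
  and \<open>i\<close> are known. A resolving set of \<open>a\<close> must give an answer that does not depend on which
  vertex of such a pair it contains, hence the invariance required in \<open>resolves\<close>.\<close>

definition hidden :: "('a \<Rightarrow> nat) \<Rightarrow> nat \<Rightarrow> 'a set" where
  "hidden d i = {a \<in> J. d a = 0 \<or> d a = i}"

definition resolves :: "nat \<Rightarrow> 'a set set \<Rightarrow> ('a \<Rightarrow> nat) \<Rightarrow> 'a \<Rightarrow> 'a set \<Rightarrow> bool" where
  "resolves k E d a W \<longleftrightarrow> W \<subseteq> M \<and> Suc (card W) = k \<and> (\<forall>w \<in> W. t w \<noteq> a) \<and>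
     (insert a W \<in> E \<longleftrightarrow> insert (p a) W \<notin> E) \<and>
     (\<forall>F \<subseteq> hidden d (d a) - {a}.
        (insert a (flip t p F ` W) \<in> E \<longleftrightarrow> insert a W \<in> E) \<and>
        (insert (p a) (flip t p F ` W) \<in> E \<longleftrightarrow> insert (p a) W \<in> E))"

definition pair_coloring :: "nat \<Rightarrow> 'a set set \<Rightarrow> ('a \<Rightarrow> nat) \<Rightarrow> bool" where
  "pair_coloring k E d \<longleftrightarrow> (\<forall>a \<in> J. d a \<le> k \<and> (d a \<noteq> 0 \<longrightarrow> (\<exists>W. resolves k E d a W)))"

lemma resolves_mono:
  assumes "resolves k E d a W" "d' a = d a" "hidden d' (d a) \<subseteq> hidden d (d a)"
  shows "resolves k E d' a W"
proof -
  have "hidden d' (d' a) - {a} \<subseteq> hidden d (d a) - {a}" using assms by auto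
  then show ?thesis using assms(1) unfolding resolves_def by (meson subset_trans)
qed

text \<open>The pairs to be colored are those in \<open>D\<close>, whose turn changes the status of
  some flipped copy of \<open>e\<close>. They all meet \<open>e\<close>, and so do the pairs whose
  colors \<open>\<Gamma>\<close> have to be avoided; since \<open>e\<close> has k vertices,
  \<open>D\<close> can receive distinct colors outside \<open>\<Gamma>\<close>. A copy of
  \<open>e\<close> without its vertex in the pair \<open>a\<close> then resolves
  \<open>a\<close>.\<close>

lemma flip_dependent_colorable:
  assumes d: "pair_coloring k E d" and k: "0 < k"
    and F0: "F0 \<subseteq> {a \<in> J. d a = 0}" and e: "e \<subseteq> M" "card e = k"
    and neq: "flip t p F0 ` e \<in> E \<longleftrightarrow> e \<notin> E"
  shows "\<exists>d'. pair_coloring k E d' \<and> {a \<in> J. d a \<noteq> 0} \<subset> {a \<in> J. d' a \<noteq> 0}"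
proof -
  define C where "C = {a \<in> J. d a = 0}"
  define toggles where
    "toggles a F \<longleftrightarrow> (flip t p {a} ` flip t p F ` e \<in> E \<longleftrightarrow> flip t p F ` e \<notin> E)" for a F
  define D where "D = {a \<in> C. \<exists>F \<subseteq> C. toggles a F}"
  have CJ: "C \<subseteq> J" and DC: "D \<subseteq> C" by (auto simp: C_def D_def)
  have fine: "finite e" using e k card_ge_0_finite by blast
  \<comment> \<open>A single turn of a pair in \<open>C - D\<close> never matters, whatever copy of
    \<open>e\<close> it is applied to; induction extends this to several turns.\<close>
  have inert: "flip t p F' ` flip t p F ` e \<in> E \<longleftrightarrow> flip t p F ` e \<in> E"
    if F: "F \<subseteq> C" and F': "F' \<subseteq> C - D" for F F'
  proof -
    have "finite F'" using F' CJ finite_J by (meson Diff_subset finite_subset subset_trans)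
    then show ?thesis using F'
    proof (induction F')
      case empty
      have "flip t p {} ` flip t p F ` e = flip t p F ` e" by (rule flip_image_trivial) simp
      then show ?case by simp
    next
      case (insert c F')
      let ?G = "(F' - F) \<union> (F - F')"
      have c: "c \<in> C" "c \<notin> D" "{c} \<subseteq> J" "F' \<subseteq> J" "F \<subseteq> J" using insert.prems F CJ by auto
      have e1: "flip t p F' ` flip t p F ` e = flip t p ?G ` e" by (rule flip_flip_image[OF c(4,5) e(1)])
      have "flip t p {c} ` flip t p F' ` flip t p F ` e = flip t p (insert c F') ` flip t p F ` e"
        using flip_flip_image[OF c(3,4) flip_image_in[OF c(5) e(1)]] insert.hyps
        by (simp add: insert_Diff_if)
      moreover have "flip t p {c} ` flip t p ?G ` e \<in> E \<longleftrightarrow> flip t p ?G ` e \<in> E"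
      proof -
        have "?G \<subseteq> C" using insert.prems F by blast
        then show ?thesis using c(1,2) unfolding D_def toggles_def[symmetric]
          by (metis (mono_tags, lifting) mem_Collect_eq toggles_def)
      qed
      ultimately show ?case using insert.IH insert.prems e1 by simp
    qed
  qed
  have e0: "flip t p {} ` e = e" by (rule flip_image_trivial) simp
  have Dne: "D \<noteq> {}" using inert[of "{}" F0] neq F0 e0 by (auto simp: C_def)
  have D_meets: "a \<in> t ` e" if aD: "a \<in> D" for a
  proof (rule ccontr)
    assume a: "a \<notin> t ` e"
    obtain F where F: "F \<subseteq> C" "toggles a F" using aD by (auto simp: D_def)
    have "flip t p {a} ` flip t p F ` e = flip t p F ` e"
      by (rule flip_image_trivial) (use a t_flip F CJ e in \<open>auto simp: subset_iff\<close>)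
    then show False using F by (simp add: toggles_def)
  qed
  define \<Gamma> where "\<Gamma> = d ` (t ` e \<inter> (J - C))"
  \<comment> \<open>Pairs in \<open>D\<close> and old colored pairs met by \<open>e\<close> have
    distinct representatives, and \<open>e\<close> meets at most k pairs altogether.\<close>
  have "card D + card \<Gamma> \<le> k"
  proof -
    have "card \<Gamma> \<le> card (t ` e \<inter> (J - C))" unfolding \<Gamma>_def using fine by (intro card_image_le) simp
    moreover have "card D + card (t ` e \<inter> (J - C)) = card (D \<union> (t ` e \<inter> (J - C)))"
      using DC CJ finite_J fine by (intro card_Un_disjoint[symmetric]) (auto intro: finite_subset)
    moreover have "card (D \<union> (t ` e \<inter> (J - C))) \<le> card (t ` e)"
      using D_meets fine by (intro card_mono) auto
    moreover have "card (t ` e) \<le> k" using card_image_le[OF fine] e by simp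
    ultimately show ?thesis by linarith
  qed
  moreover have "finite \<Gamma>" using fine by (simp add: \<Gamma>_def)
  ultimately have "card D \<le> card ({1..k} - \<Gamma>)"
    using diff_card_le_card_Diff[of \<Gamma> "{1..k}"] by simp
  moreover have finD: "finite D" using DC CJ finite_J by (meson finite_subset)
  ultimately obtain \<iota> where \<iota>: "\<iota> ` D \<subseteq> {1..k} - \<Gamma>" "inj_on \<iota> D"
    using card_le_inj[OF finD] by (metis finite_Diff finite_atLeastAtMost)
  define d' where "d' a = (if a \<in> D then \<iota> a else d a)" for a
  have new0: "d' a \<noteq> 0" if "a \<in> D" for a using that \<iota> by (force simp: d'_def)
  have "pair_coloring k E d'"
    unfolding pair_coloring_def
  proof (intro ballI conjI impI)
    fix a assume "a \<in> J"
    then show "d' a \<le> k" using d \<iota> by (force simp: d'_def pair_coloring_def)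
  next
    fix a assume a: "a \<in> J" "d' a \<noteq> 0"
    show "\<exists>W. resolves k E d' a W"
    proof (cases "a \<in> D")
      case False
      then have "d a \<noteq> 0" "d' a = d a" using a by (auto simp: d'_def)
      moreover have "hidden d' (d a) \<subseteq> hidden d (d a)"
        using DC by (auto simp: hidden_def d'_def C_def split: if_splits)
      ultimately show ?thesis using d a resolves_mono unfolding pair_coloring_def by metis
    next
      case True
      then obtain F where F: "F \<subseteq> C" and "toggles a F" by (auto simp: D_def)
      then have Fneq: "flip t p {a} ` flip t p F ` e \<in> E \<longleftrightarrow> flip t p F ` e \<notin> E"
        by (simp add: toggles_def)
      define f where "f = flip t p F ` e"
      have FJ: "F \<subseteq> J" using F CJ by blast
      have fM: "f \<subseteq> M" "card f = k" "finite f"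
        using flip_image_in[OF FJ e(1)] card_flip[OF FJ e(1)] e fine by (auto simp: f_def)
      have tf: "t ` f = t ` e" using t_flip[OF FJ] e unfolding f_def by (force simp: image_image subset_iff)
      have aM: "a \<in> M" "t a = a" "{a} \<subseteq> J" using a J_in t_J by auto
      have pa: "p a \<in> M" "p a \<noteq> a" "p (p a) = a" "t (p a) = a"
        using p_in[of a] p_neq[of a] p_p[of a] t_p[of a] aM by auto
      have only: "w = a \<or> w = p a" if "w \<in> f" "t w = a" for w
        using pair[of a w] that fM aM by auto
      have ex: "\<exists>w \<in> f. t w = a" using tf D_meets[OF True] by (metis imageE)
      have fl: "flip t p {a} ` f = (if a \<in> f then {p a} else {}) \<union> (if p a \<in> f then {a} else {}) \<union> (f - {a, p a})"
        using only pa aM by (force simp: flip_def image_def)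
      \<comment> \<open>\<open>f\<close> contains exactly one vertex of the pair: with both of them,
        or with none, turning the pair would leave \<open>f\<close> unchanged.\<close>
      have "\<not> (a \<in> f \<and> p a \<in> f)"
      proof
        assume "a \<in> f \<and> p a \<in> f"
        then have "flip t p {a} ` f = f" unfolding fl by auto
        then show False using Fneq f_def by simp
      qed
      moreover have "a \<in> f \<or> p a \<in> f" using ex only by metis
      ultimately consider "a \<in> f" "p a \<notin> f" | "p a \<in> f" "a \<notin> f" by auto
      then obtain W where W: "W = f - {a, p a}" "card W + 1 = k"
          "{insert a W, insert (p a) W} = {f, flip t p {a} ` f}"
      proof cases
        case 1
        then have "f - {a, p a} = f - {a}" "insert a (f - {a}) = f" by auto
        moreover have "flip t p {a} ` f = insert (p a) (f - {a})" using fl 1 by auto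
        ultimately show ?thesis using that[of "f - {a}"] 1 fM card_Suc_Diff1[of f a] by auto
      next
        case 2
        then have "f - {a, p a} = f - {p a}" "insert (p a) (f - {p a}) = f" by auto
        moreover have "flip t p {a} ` f = insert a (f - {p a})" using fl 2 by auto
        ultimately show ?thesis using that[of "f - {p a}"] 2 fM card_Suc_Diff1[of f "p a"] by auto
      qed
      have tW: "\<forall>w \<in> W. t w \<noteq> a" using W only by blast
      have WM: "W \<subseteq> M" using W fM by blast
      have tWe: "t ` W \<subseteq> t ` e" using W tf by blast
      have stable: "insert x (flip t p F' ` W) \<in> E \<longleftrightarrow> insert x W \<in> E"
        if F': "F' \<subseteq> hidden d' (d' a) - {a}" and x: "x = a \<or> x = p a" for F' x
      proof -
        let ?F = "F' \<inter> (C - D)"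
        \<comment> \<open>Only turns of pairs in \<open>C - D\<close> reach
          \<open>insert x W\<close>. Another pair of the color of \<open>a\<close> is not in
          \<open>D\<close>, where colors are distinct, and cannot be an old colored pair met by
          \<open>e\<close>, whose color is in \<open>\<Gamma>\<close>.\<close>
        have red: "t w \<in> F' \<longleftrightarrow> t w \<in> ?F" if w: "w \<in> insert x W" for w
        proof
          assume tw: "t w \<in> F'"
          show "t w \<in> ?F"
          proof (rule ccontr)
            assume "t w \<notin> ?F"
            then have nin: "t w \<notin> C - D" using tw by blast
            have twa: "t w \<noteq> a" "t w \<in> J" "d' (t w) = 0 \<or> d' (t w) = \<iota> a"
              using tw F' True by (auto simp: hidden_def d'_def)
            then have "w \<in> W" using w x aM pa by auto
            then have twe: "t w \<in> t ` e" using tWe by blast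
            show False
            proof (cases "t w \<in> D")
              case d: True
              then show False using twa new0[OF d] \<iota>(2) True by (auto simp: d'_def dest: inj_onD)
            next
              case False
              then have "t w \<notin> C" using nin by blast
              then have "d (t w) \<in> \<Gamma>" "d (t w) \<noteq> 0" using twe twa by (auto simp: \<Gamma>_def C_def)
              then show False using twa False \<iota>(1) True by (auto simp: d'_def)
            qed
          qed
        qed simp
        have xF: "t x \<notin> F'" using F' x aM pa by auto
        have "insert x (flip t p F' ` W) = flip t p F' ` insert x W"
          using xF by (simp add: flip_def)
        also have "\<dots> = flip t p ?F ` insert x W" using red by (rule flip_image_cong)
        finally have 1: "insert x (flip t p F' ` W) = flip t p ?F ` insert x W" .
        have "insert x W \<in> {insert a W, insert (p a) W}" using x by auto
        then have "insert x W \<in> {f, flip t p {a} ` f}" unfolding W(3) .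
        moreover have "flip t p {a} ` f = flip t p (({a} - F) \<union> (F - {a})) ` e"
          unfolding f_def using flip_flip_image[OF aM(3) FJ e(1)] .
        moreover have "({a} - F) \<union> (F - {a}) \<subseteq> C" using F True DC by blast
        ultimately obtain F2 where F2: "F2 \<subseteq> C" "insert x W = flip t p F2 ` e"
          using F f_def by (metis insertE singletonD)
        then show ?thesis using 1 inert[OF F2(1), of ?F] by simp
      qed
      have "resolves k E d' a W"
        unfolding resolves_def
      proof (intro conjI)
        show "insert a W \<in> E \<longleftrightarrow> insert (p a) W \<notin> E"
          using W(3) Fneq unfolding f_def[symmetric] by (metis doubleton_eq_iff)
        show "\<forall>F\<subseteq>hidden d' (d' a) - {a}.
          (insert a (flip t p F ` W) \<in> E \<longleftrightarrow> insert a W \<in> E) \<and>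
          (insert (p a) (flip t p F ` W) \<in> E \<longleftrightarrow> insert (p a) W \<in> E)"
          using stable by blast
      qed (use WM W tW in auto)
      then show ?thesis by blast
    qed
  qed
  moreover have "{a \<in> J. d a \<noteq> 0} \<subset> {a \<in> J. d' a \<noteq> 0}"
  proof -
    obtain a where "a \<in> D" using Dne by blast
    then have "a \<in> J" "d a = 0" "d' a \<noteq> 0" using DC new0 by (auto simp: C_def)
    moreover have "d' x \<noteq> 0" if "d x \<noteq> 0" for x using that new0 by (cases "x \<in> D") (auto simp: d'_def)
    ultimately show ?thesis by blast
  qed
  ultimately show ?thesis by blast
qed

text \<open>Take a pair coloring with as many colored pairs as possible; by
  \<open>flip_dependent_colorable\<close> a flip of uncolored pairs that mattered would allow a
  larger one.\<close>

lemma pair_coloring_exists: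
  assumes k: "0 < k"
  shows "\<exists>d. pair_coloring k E d \<and>
    (\<forall>F \<subseteq> {a \<in> J. d a = 0}. \<forall>e \<subseteq> M. card e = k \<longrightarrow> (flip t p F ` e \<in> E \<longleftrightarrow> e \<in> E))"
proof -
  let ?m = "\<lambda>d. card {a \<in> J. d a \<noteq> 0}"
  have "pair_coloring k E (\<lambda>_. 0)" by (simp add: pair_coloring_def)
  moreover have "\<forall>d. pair_coloring k E d \<longrightarrow> ?m d < Suc (card J)"
    using finite_J by (auto simp: less_Suc_eq_le intro: card_mono)
  ultimately obtain d where d: "pair_coloring k E d" and
    max: "\<And>d'. pair_coloring k E d' \<Longrightarrow> ?m d' \<le> ?m d"
    using ex_has_greatest_nat[of "pair_coloring k E" _ ?m] by blast
  have "flip t p F ` e \<in> E \<longleftrightarrow> e \<in> E" if F: "F \<subseteq> {a \<in> J. d a = 0}" "e \<subseteq> M" "card e = k" for F e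
  proof (rule ccontr)
    assume "\<not> ?thesis"
    then have "flip t p F ` e \<in> E \<longleftrightarrow> e \<notin> E" by blast
    then obtain d' where d': "pair_coloring k E d'" "{a \<in> J. d a \<noteq> 0} \<subset> {a \<in> J. d' a \<noteq> 0}"
      using flip_dependent_colorable[OF d k F] by blast
    then have "?m d < ?m d'" using finite_J by (intro psubset_card_mono) auto
    then show False using max[OF d'(1)] by simp
  qed
  then show ?thesis using d by blast
qed

end

section \<open>Blocks\<close>

locale max_colored =
  fixes k :: nat and V :: "'a set" and E :: "'a set set" and c :: "'a \<Rightarrow> nat" and \<iota> :: nat
  assumes k2: "2 \<le> k" and finV: "finite V"
    and uniform: "\<And>e. e \<in> E \<Longrightarrow> e \<subseteq> V \<and> card e = k"
    and max: "max_coloring k V E c" and \<iota>: "1 \<le> \<iota>" "\<iota> \<le> k"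
begin

definition U where "U = colored V c"
definition A where "A = {v \<in> V. c v = \<iota>}"
definition X where "X = {v \<in> V. c v \<noteq> 0 \<and> c v \<noteq> \<iota>}"
text \<open>The choice is unique, since vertices of \<open>A\<close> are pairwise dissimilar over
  \<open>X\<close>. Vertices of \<open>X\<close> represent themselves, which keeps flips away from
  them.\<close>

definition t where "t v = (if v \<in> V - X then (SOME a. a \<in> A \<and> similar k E X v a) else v)"
definition Q where "Q a = {v \<in> V - X. t v = a}"
definition J where "J = {a \<in> A. card (Q a) = 2}"
definition L where "L = {a \<in> A. 3 \<le> card (Q a)}"
definition mate where "mate v = (if v \<in> V - X \<and> t v \<in> J then (SOME w. w \<in> Q (t v) \<and> w \<noteq> v) else v)"
text \<open>The part on which the isomorphism is found through the game. By \<open>not_M\<close>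
  only vertices of large blocks other than the representative lie outside; they are matched later by
  their types.\<close>

definition M where "M = X \<union> A \<union> (\<Union>a \<in> J. Q a)"

lemma sep: "separating_coloring k V E c"
  using max by (simp add: max_coloring_def)

lemma U_eq: "U = X \<union> A" and X_A: "X \<inter> A = {}" and XV: "X \<subseteq> V" and AV: "A \<subseteq> V"
  using \<iota> by (auto simp: U_def X_def A_def colored_def)

lemma MV: "M \<subseteq> V"
  using XV AV by (auto simp: M_def Q_def)

lemma fin: "finite X" "finite A" "finite U" "finite M" "finite (Q a)" "finite J" "finite L"
  using finite_subset[OF XV finV] finite_subset[OF AV finV] finite_subset[OF MV finV] finV
  by (auto simp: U_eq Q_def J_def L_def)

lemma A_similar_eq: "a \<in> A \<Longrightarrow> a' \<in> A \<Longrightarrow> similar k E X a a' \<Longrightarrow> a = a'"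
  by (rule separating_coloringD[OF sep]) (use \<iota> in \<open>auto simp: A_def X_def\<close>)

lemma t_spec: assumes "v \<in> V - X" shows "t v \<in> A \<and> similar k E X v (t v)"
proof -
  have "\<exists>a. a \<in> A \<and> similar k E X v a"
  proof (cases "c v = 0")
    case True
    then obtain a where "attached k V E c \<iota> v a"
      using max_coloring_attached[OF max finV, of v \<iota>] assms \<iota> by auto
    then show ?thesis by (auto simp: attached_def A_def X_def)
  next
    case False
    then have "v \<in> A" using assms by (auto simp: A_def X_def)
    then show ?thesis by auto
  qed
  from someI_ex[OF this] show ?thesis using assms by (simp add: t_def)
qed

lemma t_eqI: "v \<in> V - X \<Longrightarrow> a \<in> A \<Longrightarrow> similar k E X v a \<Longrightarrow> t v = a"
  using t_spec[of v] A_similar_eq similar_sym similar_trans by meson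

lemma t_A: "a \<in> A \<Longrightarrow> t a = a"
  using t_eqI[of a a] AV X_A by auto

lemma t_X: "v \<in> X \<Longrightarrow> t v = v"
  by (simp add: t_def)

lemma Q_iff: "a \<in> A \<Longrightarrow> v \<in> Q a \<longleftrightarrow> v \<in> V - X \<and> similar k E X v a"
  using t_spec[of v] t_eqI[of v a] by (auto simp: Q_def)

lemma A_in_Q: "a \<in> A \<Longrightarrow> a \<in> Q a"
  using t_A AV X_A by (auto simp: Q_def)

lemma Q_t: "v \<in> V - X \<Longrightarrow> v \<in> Q (t v)"
  by (simp add: Q_def)

lemma t_Q: "v \<in> Q a \<Longrightarrow> t v = a"
  by (simp add: Q_def)

lemma Q_A: "v \<in> Q a \<Longrightarrow> v \<in> A \<Longrightarrow> v = a"
  using t_A by (auto simp: Q_def)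

lemma V_eq: "V = X \<union> (\<Union>a \<in> A. Q a)"
  using t_spec XV by (auto simp: Q_def)

lemma card_Q_pos: "a \<in> A \<Longrightarrow> 1 \<le> card (Q a)"
  using A_in_Q fin(5)[of a] by (metis One_nat_def Suc_leI card_gt_0_iff empty_iff)

lemma Q_J: "a \<in> J \<Longrightarrow> v \<in> Q a \<Longrightarrow> Q a = {v, mate v} \<and> mate v \<noteq> v"
proof -
  assume a: "a \<in> J" and v: "v \<in> Q a"
  have "card (Q a - {v}) = 1" using a v fin(5) by (simp add: J_def)
  then obtain w where w: "Q a - {v} = {w}" by (metis card_1_singletonE)
  have tv: "t v = a" "v \<in> V - X" using v by (auto simp: Q_def)
  have "w \<in> Q a \<and> w \<noteq> v" using w by blast
  then have "(SOME w. w \<in> Q a \<and> w \<noteq> v) \<in> Q a \<and> (SOME w. w \<in> Q a \<and> w \<noteq> v) \<noteq> v"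
    by (rule someI)
  moreover have "mate v = (SOME w. w \<in> Q a \<and> w \<noteq> v)" using tv a by (simp add: mate_def)
  ultimately have "mate v \<in> Q a \<and> mate v \<noteq> v" by simp
  then have "mate v = w" "w \<noteq> v" using w by auto
  moreover have "Q a = {v, w}" using w v by (metis insert_Diff)
  ultimately show ?thesis by simp
qed

lemma J_A: "J \<subseteq> A" and L_A: "L \<subseteq> A"
  by (auto simp: J_def L_def)

lemma M_t: "v \<in> M \<Longrightarrow> v \<in> X \<or> v \<in> A \<or> t v \<in> J \<and> v \<in> Q (t v)"
  by (auto simp: M_def Q_def)

lemma t_J_Q: "v \<in> M \<Longrightarrow> t v \<in> J \<Longrightarrow> v \<in> Q (t v)"
  using M_t[of v] t_X[of v] X_A J_A t_A[of v] A_in_Q[of v] by auto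

sublocale pairing M J t mate
proof
  show "finite J" by (rule fin)
  fix v assume v: "v \<in> M" "t v \<in> J"
  then have vQ: "v \<in> Q (t v)" by (rule t_J_Q)
  note q = Q_J[OF v(2) vQ]
  have mQ: "mate v \<in> Q (t v)" using q by blast
  show "mate v \<in> M" using v(2) mQ by (auto simp: M_def)
  show "mate v \<noteq> v" using q by blast
  show "t (mate v) = t v" using mQ by (rule t_Q)
  show "mate (mate v) = v" using Q_J[OF v(2) mQ] q by auto
  fix w assume "w \<in> M" "t w = t v"
  then have "w \<in> Q (t v)" using t_J_Q v by metis
  then show "w = v \<or> w = mate v" using q by blast
next
  show "J \<subseteq> M" using J_A by (auto simp: M_def)
  show "t a = a" if "a \<in> J" for a using that J_A t_A by blast
qed

lemma U_M: "U \<subseteq> M"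
  by (auto simp: U_eq M_def)

lemma not_M: "v \<in> V - M \<Longrightarrow> t v \<in> L \<and> v \<noteq> t v \<and> v \<notin> U \<and> v \<in> Q (t v)"
proof -
  assume v: "v \<in> V - M"
  then have vX: "v \<in> V - X" by (auto simp: M_def)
  have ta: "t v \<in> A" "v \<in> Q (t v)" using t_spec[OF vX] Q_t[OF vX] by auto
  have "v \<notin> A" "t v \<notin> J" using v ta by (auto simp: M_def)
  have "t v \<in> Q (t v)" using A_in_Q ta by blast
  moreover have ne: "v \<noteq> t v" using \<open>v \<notin> A\<close> ta by auto
  ultimately have "card {v, t v} \<le> card (Q (t v))" using ta fin(5) by (intro card_mono) auto
  then have "3 \<le> card (Q (t v))" using ne \<open>t v \<notin> J\<close> ta by (auto simp: J_def)
  then show ?thesis using ta ne \<open>v \<notin> A\<close> vX by (auto simp: L_def U_eq)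
qed

lemma L_not_M: "a \<in> L \<Longrightarrow> v \<in> Q a \<Longrightarrow> v \<noteq> a \<Longrightarrow> v \<in> V - M"
proof -
  assume a: "a \<in> L" and v: "v \<in> Q a" "v \<noteq> a"
  have "t v = a" "v \<in> V - X" using v by (auto simp: Q_def)
  moreover have "v \<notin> A" using Q_A v by blast
  moreover have "a \<notin> J" using a by (auto simp: L_def J_def)
  ultimately show ?thesis using M_t[of v] by auto
qed

lemma card_V: "card V = card X + (\<Sum>a \<in> A. card (Q a))"
proof -
  have "card (\<Union>a \<in> A. Q a) = (\<Sum>a \<in> A. card (Q a))"
    by (rule card_UN_disjoint) (use fin in \<open>auto simp: Q_def\<close>)
  moreover have "X \<inter> (\<Union>a \<in> A. Q a) = {}" by (auto simp: Q_def)
  ultimately show ?thesis using V_eq fin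
    by (metis card_Un_disjoint finite_UN)
qed

text \<open>Block \<open>a\<close> of \<open>card (Q a)\<close> vertices may use \<open>(1 - 1/k) (card (Q a) - 1)\<close> pebbles but uses
  a single one; \<open>surplus a\<close> is \<open>k\<close> times what is left over.\<close>

definition surplus where "surplus a = (k - 1) * (card (Q a) - 1) - k"

lemma surplus: "a \<in> L \<Longrightarrow> surplus a + k = (k - 1) * (card (Q a) - 1)"
proof -
  assume "a \<in> L"
  then have "(k - 1) * 2 \<le> (k - 1) * (card (Q a) - 1)" by (intro mult_le_mono2) (auto simp: L_def)
  moreover have "k \<le> (k - 1) * 2" using k2 by simp
  ultimately show ?thesis unfolding surplus_def by linarith
qed

text \<open>\<open>X\<close> is paid for by \<open>X\<close> and \<open>A\<close> together, as
  \<open>A\<close> is at least a k-th part of \<open>U\<close>. The second vertices of the pairs pay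
  for \<open>D\<close>. In a large block the vertices other than \<open>a\<close> pay k for the
  pebble on \<open>a\<close> and leave the surplus.\<close>

lemma budget:
  assumes big: "card U \<le> k * card A" and D: "D \<subseteq> J" "k * card D \<le> (k - 1) * card J"
    and N: "N = X \<union> L \<union> D"
  shows "k * card N + (\<Sum>a \<in> L. surplus a) \<le> (k - 1) * card V"
proof -
  obtain K where K: "k = Suc K" using k2 by (cases k) auto
  have finD: "finite D" using D fin finite_subset by blast
  have JL: "J \<inter> L = {}" by (auto simp: J_def L_def)
  have cU: "card U = card X + card A" unfolding U_eq using fin X_A by (intro card_Un_disjoint)
  have cN: "card N \<le> card X + card L + card D"
    unfolding N by (meson add_le_mono card_Un_le le_refl le_trans)
  define Z where "Z = A - J - L"
  have A: "A = Z \<union> (J \<union> L)" "Z \<inter> (J \<union> L) = {}" using J_A L_A by (auto simp: Z_def)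
  have finZ: "finite Z" using fin by (simp add: Z_def)
  have cA: "card A = card Z + card J + card L"
    using card_Un_disjoint[OF finZ _ A(2)] card_Un_disjoint[OF fin(6,7) JL] A(1) fin by simp
  have sumA: "(\<Sum>a \<in> A. f a) = (\<Sum>a \<in> Z. f a) + (\<Sum>a \<in> J. f a) + (\<Sum>a \<in> L. f a)" for f :: "'a \<Rightarrow> nat"
    using sum.union_disjoint[OF finZ _ A(2), of f] sum.union_disjoint[OF fin(6,7) JL, of f] A(1) fin by simp
  have "(\<Sum>a \<in> Z. card (Q a)) \<ge> (\<Sum>a \<in> Z. 1)" by (rule sum_mono) (use card_Q_pos A in auto)
  moreover have "(\<Sum>a \<in> J. card (Q a)) = 2 * card J" by (simp add: J_def)
  moreover have "(\<Sum>a \<in> L. card (Q a)) = (\<Sum>a \<in> L. (card (Q a) - 1) + 1)"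
    by (rule sum.cong) (auto simp: L_def)
  ultimately have cV: "card V \<ge> card X + card Z + 2 * card J + ((\<Sum>a \<in> L. card (Q a) - 1) + card L)"
    unfolding card_V sumA sum.distrib by simp
  have sur: "(\<Sum>a \<in> L. surplus a) + k * card L = (k - 1) * (\<Sum>a \<in> L. card (Q a) - 1)"
  proof -
    have "(\<Sum>a \<in> L. surplus a + k) = (\<Sum>a \<in> L. (k - 1) * (card (Q a) - 1))"
      by (rule sum.cong) (auto simp: surplus)
    then show ?thesis by (simp add: sum.distrib sum_distrib_left mult.commute)
  qed
  have kX: "k * card X \<le> K * (card X + card A)" using big cU K by (simp add: distrib_left)
  have kN: "k * card N \<le> k * card X + k * card L + k * card D"
    using mult_le_mono2[OF cN, of k] by (simp add: algebra_simps)
  have kV: "K * card V \<ge> K * (card X + card Z + 2 * card J + ((\<Sum>a \<in> L. card (Q a) - 1) + card L))"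
    using cV by (rule mult_le_mono2)
  show ?thesis
    using kX kN kV sur D(2) cA K by (simp add: algebra_simps)
qed

end

section \<open>Positions of the game\<close>

lemma partial_iso_edges:
  assumes "partial_iso E E' R" "\<And>x. x \<in> e \<Longrightarrow> (g x, h x) \<in> R"
  shows "g ` e \<in> E \<longleftrightarrow> h ` e \<in> E'"
proof -
  have "(\<lambda>x. (g x, h x)) ` e \<subseteq> R" using assms(2) by blast
  then have "fst ` (\<lambda>x. (g x, h x)) ` e \<in> E \<longleftrightarrow> snd ` (\<lambda>x. (g x, h x)) ` e \<in> E'"
    using assms(1) by (simp only: partial_iso_def)
  then show ?thesis by (simp add: image_image)
qed

lemma partial_iso_eq:
  "partial_iso E E' R \<Longrightarrow> (x, y) \<in> R \<Longrightarrow> (x', y') \<in> R \<Longrightarrow> x = x' \<longleftrightarrow> y = y'"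
  unfolding partial_iso_def by (metis fst_conv snd_conv)

text \<open>The situation to be excluded for non-isomorphic graphs: Duplicator has answered the
  pebbles and survives both plays. The assumption on \<open>r\<close> makes available every number
  of moves within the total budget, and \<open>max'\<close> says that no separating coloring of
  \<open>G'\<close> beats \<open>c\<close>.\<close>

locale game_state = max_colored k "verts G" "edges G" c \<iota>
  for k :: nat and G :: "'a hypergraph" and c :: "'a \<Rightarrow> nat" and \<iota> :: nat +
  fixes d :: "'a \<Rightarrow> nat" and i0 :: nat and G' :: "'b hypergraph" and R0 :: "('a \<times> 'b) set" and r :: nat
  assumes k_graph': "k_graph k G'" and card_V': "card (verts G') = card (verts G)" and V_ne: "verts G \<noteq> {}"
    and d: "pair_coloring k (edges G) d"
    and flip_invariant: "\<And>F e. F \<subseteq> {a \<in> J. d a = 0} \<Longrightarrow> e \<subseteq> M \<Longrightarrow> card e = k \<Longrightarrow>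
       flip t mate F ` e \<in> edges G \<longleftrightarrow> e \<in> edges G"
    and i0: "1 \<le> i0"
    and R0: "fst ` R0 = X \<union> L \<union> (J - hidden d i0)" "R0 \<subseteq> verts G \<times> verts G'"
    and ex: "ex_game G G' r R0" and all: "all_game G G' r R0"
    and r: "\<And>m. k * (card (fst ` R0) + m) \<le> (k - 1) * card (verts G) + k * (2 * k - 1) \<Longrightarrow> m \<le> r"
    and budget_N: "k * card (fst ` R0) + (\<Sum>a \<in> L. surplus a) \<le> (k - 1) * card (verts G)"
    and max': "\<And>c'. separating_coloring k (verts G') (edges G') c' \<Longrightarrow>
       card (colored (verts G') c') \<le> card U"
begin

abbreviation "V \<equiv> verts G"
abbreviation "V' \<equiv> verts G'"
abbreviation "E \<equiv> edges G"
abbreviation "E' \<equiv> edges G'"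
abbreviation "\<Delta> \<equiv> hidden d i0"

definition N where "N = X \<union> L \<union> (J - \<Delta>)"
definition \<phi>0 where "\<phi>0 x = (SOME y. (x, y) \<in> R0)"
text \<open>The counterpart of the block of \<open>a\<close> in \<open>G'\<close>. It refers to the
  pebbled images of \<open>X\<close> only, because \<open>a\<close> need not be pebbled.\<close>

definition Q' where "Q' a = {v' \<in> V' - \<phi>0 ` X. \<forall>W \<subseteq> X. Suc (card W) = k \<longrightarrow>
   (insert v' (\<phi>0 ` W) \<in> E' \<longleftrightarrow> insert a W \<in> E)}"

text \<open>An extension of the position \<open>R0\<close> in which Duplicator has not lost yet.\<close>

definition position where
  "position R \<longleftrightarrow> R0 \<subseteq> R \<and> R \<subseteq> V \<times> V' \<and> partial_iso E E' R"

lemma fin': "finite V'" using k_graph' by (simp add: k_graph_def)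

lemma V'_ne: "V' \<noteq> {}" using card_V' V_ne finV fin' by (metis card_0_eq card.empty)

text \<open>By \<open>budget_N\<close> the pebbles leave \<open>2 * k - 1\<close> moves and, in
  addition, a k-th of the surplus of any set of large blocks.\<close>

lemma r_surplus: "k * m \<le> (\<Sum>a \<in> T. surplus a) + k * (2 * k - 1) \<Longrightarrow> T \<subseteq> L \<Longrightarrow> m \<le> r"
proof (rule r)
  assume m: "k * m \<le> (\<Sum>a \<in> T. surplus a) + k * (2 * k - 1)" and T: "T \<subseteq> L"
  have "(\<Sum>a \<in> T. surplus a) \<le> (\<Sum>a \<in> L. surplus a)" using T fin by (intro sum_mono2) auto
  then show "k * (card (fst ` R0) + m) \<le> (k - 1) * card V + k * (2 * k - 1)"
    using m budget_N by (simp add: distrib_left)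
qed

lemma r_ge: "2 * k - 1 \<le> r"
  using r_surplus[of "2 * k - 1" "{}"] by simp

lemma position_R0: "position R0"
  using ex_game_partial_iso[OF ex V_ne] R0 by (simp add: position_def)

lemma N_R0: "fst ` R0 = N" using R0 by (simp add: N_def)

lemma N_sub: "N \<subseteq> M" and XN: "X \<subseteq> N" and N_A: "N - X \<subseteq> A"
  using J_A L_A by (auto simp: N_def M_def)

lemma \<phi>0_R0: "x \<in> N \<Longrightarrow> (x, \<phi>0 x) \<in> R0"
  unfolding \<phi>0_def N_R0[symmetric] by (metis (mono_tags, lifting) imageE prod.collapse someI_ex)

lemma \<phi>0_in: "position R \<Longrightarrow> x \<in> N \<Longrightarrow> (x, \<phi>0 x) \<in> R"
  using \<phi>0_R0 by (auto simp: position_def)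

lemma position_eq: "position R \<Longrightarrow> (x, y) \<in> R \<Longrightarrow> (x', y') \<in> R \<Longrightarrow> x = x' \<longleftrightarrow> y = y'"
  unfolding position_def using partial_iso_eq by metis

lemma position_edges: "position R \<Longrightarrow> (\<And>x. x \<in> e \<Longrightarrow> (g x, h x) \<in> R) \<Longrightarrow> g ` e \<in> E \<longleftrightarrow> h ` e \<in> E'"
  unfolding position_def using partial_iso_edges by metis

lemma position_N: "position R \<Longrightarrow> (x, y) \<in> R \<Longrightarrow> x' \<in> N \<Longrightarrow> x = x' \<longleftrightarrow> y = \<phi>0 x'"
  using position_eq \<phi>0_in by metis

lemma \<phi>0_inj: "inj_on \<phi>0 N"
  using position_eq[OF position_R0] \<phi>0_R0 by (metis inj_onI)

lemma \<phi>0_V': "x \<in> N \<Longrightarrow> \<phi>0 x \<in> V'"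
  using \<phi>0_R0 R0 by blast

lemma ex_position:
  assumes "finite D" "D \<subseteq> V" "card D + s \<le> r"
  shows "\<exists>R. position R \<and> D \<subseteq> fst ` R \<and> ex_game G G' s R"
proof -
  obtain R where R: "R0 \<subseteq> R" "R \<subseteq> R0 \<union> V \<times> V'" "D \<subseteq> fst ` R" "ex_game G G' s R"
    using ex_game_extend[OF ex V_ne assms] by blast
  then have "position R" using ex_game_partial_iso[OF R(4) V_ne] R0(2) by (auto simp: position_def)
  then show ?thesis using R by blast
qed

lemma all_position:
  assumes "finite D" "D \<subseteq> V'" "card D + s \<le> r"
  shows "\<exists>R. position R \<and> D \<subseteq> snd ` R \<and> all_game G G' s R"
proof -
  obtain R where R: "R0 \<subseteq> R" "R \<subseteq> R0 \<union> V \<times> V'" "D \<subseteq> snd ` R" "all_game G G' s R"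
    using all_game_extend[OF all V'_ne assms] by blast
  have "partial_iso E' E (prod.swap ` R)"
    using ex_game_partial_iso[of G' G s "prod.swap ` R"] V'_ne R(4) by (simp add: all_game_iff)
  then have "partial_iso E E' (prod.swap ` prod.swap ` R)" by (rule partial_iso_converse)
  then have "partial_iso E E' R" by (simp add: image_image)
  then have "position R" using R R0(2) by (auto simp: position_def)
  then show ?thesis using R by blast
qed

text \<open>All of \<open>X\<close> is pebbled in every position, so an answer has to be given in
  the corresponding block.\<close>

lemma block_iff:
  assumes "position R" "(v, v') \<in> R" "a \<in> A"
  shows "v \<in> Q a \<longleftrightarrow> v' \<in> Q' a"
proof -
  have "v \<in> X \<longleftrightarrow> v' \<in> \<phi>0 ` X"
    using position_N[OF assms(1,2)] XN by blast
  moreover have "v \<in> V" "v' \<in> V'" using assms by (auto simp: position_def)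
  moreover have "insert v W \<in> E \<longleftrightarrow> insert v' (\<phi>0 ` W) \<in> E'" if "W \<subseteq> X" "v \<notin> X" for W
  proof -
    have "(\<lambda>x. x) ` insert v W \<in> E \<longleftrightarrow> (\<lambda>x. if x = v then v' else \<phi>0 x) ` insert v W \<in> E'"
      by (rule position_edges[OF assms(1)]) (use that assms XN \<phi>0_in in auto)
    moreover have "(\<lambda>x. if x = v then v' else \<phi>0 x) ` insert v W = insert v' (\<phi>0 ` W)"
      using that by auto
    ultimately show ?thesis by simp
  qed
  ultimately show ?thesis unfolding Q_iff[OF assms(3)] Q'_def similar_def by auto
qed

lemma Q'_disjoint: "a \<in> A \<Longrightarrow> b \<in> A \<Longrightarrow> v' \<in> Q' a \<Longrightarrow> v' \<in> Q' b \<Longrightarrow> a = b"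
  by (rule A_similar_eq) (auto simp: Q'_def similar_def)

lemma Q'_V': "Q' a \<subseteq> V'" and Q'_X: "v' \<in> Q' a \<Longrightarrow> v' \<notin> \<phi>0 ` X"
  by (auto simp: Q'_def)

lemma finQ': "finite (Q' a)" using Q'_V' fin' finite_subset by blast

text \<open>Spoiler pebbles an arbitrary vertex of \<open>G'\<close>; Duplicator answers in
  \<open>X\<close> or in some block, which places the vertex itself.\<close>

lemma V'_eq: "V' = \<phi>0 ` X \<union> (\<Union>a \<in> A. Q' a)"
proof
  show "V' \<subseteq> \<phi>0 ` X \<union> (\<Union>a \<in> A. Q' a)"
  proof
    fix v' assume v': "v' \<in> V'"
    obtain R where R: "position R" "{v'} \<subseteq> snd ` R"
    proof -
      have "card {v'} + 0 \<le> r" using r_ge k2 by simp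
      then show ?thesis using all_position[of "{v'}" 0] v' that by blast
    qed
    then obtain v where v: "(v, v') \<in> R" by auto
    then have "v \<in> V" using R by (auto simp: position_def)
    then consider "v \<in> X" | a where "a \<in> A" "v \<in> Q a" using V_eq by auto
    then show "v' \<in> \<phi>0 ` X \<union> (\<Union>a \<in> A. Q' a)"
    proof cases
      case 1
      then show ?thesis using position_N[OF R(1) v, of v] XN by blast
    next
      case 2
      then show ?thesis using block_iff[OF R(1) v] by blast
    qed
  qed
  show "\<phi>0 ` X \<union> (\<Union>a \<in> A. Q' a) \<subseteq> V'" using \<phi>0_V' XN Q'_V' by auto
qed

lemma \<phi>0_Q': "a \<in> N \<Longrightarrow> a \<in> A \<Longrightarrow> \<phi>0 a \<in> Q' a"
  using block_iff[OF position_R0 \<phi>0_R0] A_in_Q by blast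

text \<open>Spoiler exhibits \<open>m\<close> vertices of the block. If its representative carries a
  pebble already, this saves one move, hence \<open>Suc r\<close>.\<close>

lemma block_card_le:
  assumes a: "a \<in> A" and m: "m \<le> card (Q a)" "m \<le> (if a \<in> N then Suc r else r)"
  shows "m \<le> card (Q' a)"
proof -
  obtain D where D: "D \<subseteq> Q a" "m \<le> card D" "card (D - N) \<le> r"
  proof (cases "a \<in> N")
    case True
    show ?thesis
    proof (cases m)
      case 0 then show ?thesis using that[of "{}"] by simp
    next
      case (Suc m')
      have "m' \<le> card (Q a - {a})" using m(1) Suc A_in_Q[OF a] fin by simp
      then obtain D where D: "D \<subseteq> Q a - {a}" "card D = m'" by (meson obtain_subset_with_card_n)
      have "finite D" using D fin finite_subset by (metis finite_Diff)
      then have "m \<le> card (insert a D)" "card (insert a D - N) \<le> r"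
        using D Suc m(2) True card_mono[of D "insert a D - N"] by (auto simp: card_insert_if)
      then show ?thesis using that[of "insert a D"] D A_in_Q[OF a] by auto
    qed
  next
    case False
    obtain D where D: "D \<subseteq> Q a" "card D = m" using m(1) by (meson obtain_subset_with_card_n)
    moreover have "card (D - N) \<le> card D"
      using D fin by (intro card_mono) (auto intro: finite_subset)
    ultimately show ?thesis using that[of D] m(2) False by simp
  qed
  have finD: "finite D" using D fin finite_subset by blast
  have DV: "D \<subseteq> V" using D by (auto simp: Q_def)
  obtain R where R: "position R" "D - N \<subseteq> fst ` R"
    using ex_position[of "D - N" 0] D(3) finD DV by auto
  have "\<exists>y. (x, y) \<in> R" if "x \<in> D" for x
    using that R \<phi>0_in[OF R(1), of x] by (cases "x \<in> N") force+
  then obtain h where h: "\<And>x. x \<in> D \<Longrightarrow> (x, h x) \<in> R" by metis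
  have "inj_on h D" using h position_eq[OF R(1)] by (metis inj_onI)
  moreover have "h ` D \<subseteq> Q' a" using h block_iff[OF R(1) _ a] D by blast
  ultimately have "card D \<le> card (Q' a)" using finQ' by (rule card_inj_on_le)
  then show ?thesis using D by simp
qed

lemma block_card_ge:
  assumes a: "a \<in> A" and m: "m \<le> card (Q' a)" "m \<le> (if a \<in> N then Suc r else r)"
  shows "m \<le> card (Q a)"
proof -
  obtain D where D: "D \<subseteq> Q' a" "m \<le> card D" "card (D - \<phi>0 ` N) \<le> r"
  proof (cases "a \<in> N")
    case True
    note aQ = \<phi>0_Q'[OF True a]
    show ?thesis
    proof (cases m)
      case 0 then show ?thesis using that[of "{}"] by simp
    next
      case (Suc m')
      have "m' \<le> card (Q' a - {\<phi>0 a})" using m(1) Suc aQ finQ' by simp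
      then obtain D where D: "D \<subseteq> Q' a - {\<phi>0 a}" "card D = m'" by (meson obtain_subset_with_card_n)
      have "finite D" using D finQ' finite_subset by (metis finite_Diff)
      then have "m \<le> card (insert (\<phi>0 a) D)" "card (insert (\<phi>0 a) D - \<phi>0 ` N) \<le> r"
        using D Suc m(2) True card_mono[of D "insert (\<phi>0 a) D - \<phi>0 ` N"] by (auto simp: card_insert_if)
      then show ?thesis using that[of "insert (\<phi>0 a) D"] D aQ by auto
    qed
  next
    case False
    obtain D where D: "D \<subseteq> Q' a" "card D = m" using m(1) by (meson obtain_subset_with_card_n)
    moreover have "card (D - \<phi>0 ` N) \<le> card D"
      using D finQ' by (intro card_mono) (auto intro: finite_subset)
    ultimately show ?thesis using that[of D] m(2) False by simp
  qed
  have finD: "finite D" using D finQ' finite_subset by blast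
  have DV: "D \<subseteq> V'" using D Q'_V' by blast
  obtain R where R: "position R" "D - \<phi>0 ` N \<subseteq> snd ` R"
  proof -
    have "finite (D - \<phi>0 ` N)" "D - \<phi>0 ` N \<subseteq> V'" "card (D - \<phi>0 ` N) + 0 \<le> r"
      using D(3) finD DV by auto
    then show ?thesis using all_position that by blast
  qed
  have "\<exists>x. (x, y) \<in> R" if "y \<in> D" for y
  proof (cases "y \<in> \<phi>0 ` N")
    case True
    then show ?thesis using \<phi>0_in[OF R(1)] by blast
  next
    case False
    then show ?thesis using that R by force
  qed
  then obtain h where h: "\<And>y. y \<in> D \<Longrightarrow> (h y, y) \<in> R" by metis
  have "inj_on h D" using h position_eq[OF R(1)] by (metis inj_onI)
  moreover have "h ` D \<subseteq> Q a" using h block_iff[OF R(1) _ a] D by blast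
  ultimately have "card D \<le> card (Q a)" using fin(5) by (rule card_inj_on_le)
  then show ?thesis using D by simp
qed

text \<open>A block keeps its size if Spoiler can exhibit one vertex more than the other graph has.
  Otherwise, the orders being equal, one block is larger in \<open>G'\<close> and another is larger
  in \<open>G\<close>, and both have more than \<open>r\<close> vertices; but two such blocks have
  enough surplus to make \<open>r\<close> larger.\<close>

lemma block_card_eq:
  assumes a: "a \<in> A"
  shows "card (Q' a) = card (Q a)"
proof -
  have small_or_eq: "card (Q a) = card (Q' a)"
    if "a \<in> A" "min (card (Q a)) (card (Q' a)) < (if a \<in> N then Suc r else r)" for a
  proof (rule ccontr)
    assume ne: "card (Q a) \<noteq> card (Q' a)"
    show False
      using ne block_card_le[of a "Suc (card (Q' a))"] block_card_ge[of a "Suc (card (Q a))"] that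
      by (cases "card (Q a) < card (Q' a)") (auto split: if_splits)
  qed
  have small: "card (Q a) = card (Q' a)" if "a \<in> A" "min (card (Q a)) (card (Q' a)) \<le> 2" for a
    by (rule small_or_eq) (use that r_ge k2 in \<open>auto split: if_splits\<close>)
  have sums: "(\<Sum>a \<in> A. card (Q' a)) = (\<Sum>a \<in> A. card (Q a))"
  proof -
    have "card (\<Union>a \<in> A. Q' a) = (\<Sum>a \<in> A. card (Q' a))"
      by (rule card_UN_disjoint) (use fin finQ' Q'_disjoint in blast)+
    moreover have "\<phi>0 ` X \<inter> (\<Union>a \<in> A. Q' a) = {}" using Q'_X by blast
    ultimately have "card V' = card (\<phi>0 ` X) + (\<Sum>a \<in> A. card (Q' a))"
      using card_Un_disjoint[of "\<phi>0 ` X" "\<Union>a \<in> A. Q' a"] V'_eq fin finQ' by simp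
    moreover have "card (\<phi>0 ` X) = card X" using \<phi>0_inj XN by (meson card_image inj_on_subset)
    ultimately show ?thesis using card_V card_V' by simp
  qed
  show ?thesis
  proof (rule ccontr)
    assume "card (Q' a) \<noteq> card (Q a)"
    then obtain x y where xy: "x \<in> A" "y \<in> A" "card (Q x) < card (Q' x)" "card (Q' y) < card (Q y)"
    proof -
      have "\<exists>x \<in> A. card (Q x) < card (Q' x)"
      proof (rule ccontr)
        assume "\<not> ?thesis"
        then have "\<forall>x \<in> A. card (Q' x) \<le> card (Q x)" by auto
        moreover have "card (Q' a) < card (Q a)" using calculation a \<open>card (Q' a) \<noteq> card (Q a)\<close> by fastforce
        ultimately show False using sum_strict_mono_ex1[of A "\<lambda>a. card (Q' a)" "\<lambda>a. card (Q a)"] fin a sums by fastforce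
      qed
      moreover have "\<exists>x \<in> A. card (Q' x) < card (Q x)"
      proof (rule ccontr)
        assume "\<not> ?thesis"
        then have "\<forall>x \<in> A. card (Q x) \<le> card (Q' x)" by auto
        moreover have "card (Q a) < card (Q' a)" using calculation a \<open>card (Q' a) \<noteq> card (Q a)\<close> by fastforce
        ultimately show False using sum_strict_mono_ex1[of A "\<lambda>a. card (Q a)" "\<lambda>a. card (Q' a)"] fin a sums by fastforce
      qed
      ultimately show ?thesis using that by blast
    qed
    have sx: "3 \<le> card (Q x)" and sy: "3 \<le> card (Q' y)" using small[OF xy(1)] small[OF xy(2)] xy by linarith+
    then have L: "x \<in> L" "y \<in> L" "x \<noteq> y" using xy by (auto simp: L_def)
    then have "x \<in> N" "y \<in> N" by (auto simp: N_def)
    then have "\<not> card (Q x) < Suc r" "\<not> card (Q' y) < Suc r"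
      using small_or_eq[OF xy(1)] small_or_eq[OF xy(2)] xy by auto
    then have big: "r < card (Q x)" "r < card (Q' y)" by simp_all
    \<comment> \<open>The surplus of one block grows like (k - 1) m and falls short of the cost k m.
      Two blocks give about 2 (k - 1) m, which suffices because k is at least 2.\<close>
    define m where "m = min (card (Q x)) (card (Q' y))"
    have m: "m \<le> card (Q x)" "m + 1 \<le> card (Q y)" "3 \<le> m" using xy sx sy by (auto simp: m_def)
    have "m \<le> r"
    proof (rule r_surplus)
      obtain j where j: "k = j + 2" using k2 by (metis add.commute le_Suc_ex)
      obtain i where i: "m = i + 3" using m(3) by (metis add.commute le_Suc_ex)
      have "(k - 1) * (m - 1) \<le> (k - 1) * (card (Q x) - 1)" "(k - 1) * m \<le> (k - 1) * (card (Q y) - 1)"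
        using m by (intro mult_le_mono2; simp)+
      then have "(k - 1) * (m - 1) + (k - 1) * m \<le> surplus x + k + (surplus y + k)"
        using surplus[OF L(1)] surplus[OF L(2)] by linarith
      moreover have "k * m + k + k \<le> (k - 1) * (m - 1) + (k - 1) * m + k * (2 * k - 1)"
        unfolding i j by (simp add: algebra_simps)
      ultimately show "k * m \<le> (\<Sum>a \<in> {x, y}. surplus a) + k * (2 * k - 1)"
        using L(3) by simp
    qed (use L in auto)
    then show False using big by (auto simp: m_def)
  qed
qed

end

section \<open>Choice of a map on \<open>M\<close>\<close>

context game_state
begin

definition W where "W a = (SOME W. resolves k E d a W)"

lemma W_resolves: "a \<in> J \<Longrightarrow> d a = i0 \<Longrightarrow> resolves k E d a (W a)"
proof -
  assume "a \<in> J" "d a = i0"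
  then have "\<exists>W. resolves k E d a W" using d i0 by (auto simp: pair_coloring_def)
  then show ?thesis unfolding W_def by (rule someI_ex)
qed

lemma W_props:
  assumes "a \<in> J" "d a = i0"
  shows "W a \<subseteq> M" "Suc (card (W a)) = k" "finite (W a)" "\<And>w. w \<in> W a \<Longrightarrow> t w \<noteq> a"
    "insert a (W a) \<in> E \<longleftrightarrow> insert (mate a) (W a) \<notin> E"
proof -
  note W = W_resolves[OF assms, unfolded resolves_def]
  show "W a \<subseteq> M" "Suc (card (W a)) = k" "\<And>w. w \<in> W a \<Longrightarrow> t w \<noteq> a"
    "insert a (W a) \<in> E \<longleftrightarrow> insert (mate a) (W a) \<notin> E" using W by blast+
  then show "finite (W a)" using fin finite_subset by blast
qed

lemma \<Delta>_J: "\<Delta> \<subseteq> J" by (auto simp: hidden_def)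

text \<open>\<open>W a\<close> does not meet the pair \<open>a\<close>, so the invariance required
  by \<open>resolves\<close> extends to flips that turn \<open>a\<close> as well.\<close>

lemma W_stable:
  assumes "a \<in> J" "d a = i0" "F \<subseteq> \<Delta>"
  shows "insert a (flip t mate F ` W a) \<in> E \<longleftrightarrow> insert a (W a) \<in> E"
    "insert (mate a) (flip t mate F ` W a) \<in> E \<longleftrightarrow> insert (mate a) (W a) \<in> E"
proof -
  have "flip t mate F ` W a = flip t mate (F - {a}) ` W a"
    by (rule flip_image_cong) (use W_props(4)[OF assms(1,2)] in auto)
  moreover have "F - {a} \<subseteq> hidden d (d a) - {a}" using assms by auto
  ultimately show "insert a (flip t mate F ` W a) \<in> E \<longleftrightarrow> insert a (W a) \<in> E"
    "insert (mate a) (flip t mate F ` W a) \<in> E \<longleftrightarrow> insert (mate a) (W a) \<in> E"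
    using W_resolves[OF assms(1,2)] by (simp_all add: resolves_def)
qed

lemma Q_cases:
  assumes "a \<in> A" "a \<notin> L"
  shows "Q a = {a} \<or> a \<in> J \<and> Q a = {a, mate a} \<and> mate a \<noteq> a \<and> mate a \<notin> A"
proof (cases "a \<in> J")
  case True
  note q = Q_J[OF True A_in_Q[OF assms(1)]]
  then have "mate a \<notin> A" using Q_A[of "mate a" a] by auto
  then show ?thesis using True q by blast
next
  case False
  then have "card (Q a) = 1" using assms card_Q_pos[OF assms(1)] by (auto simp: J_def L_def)
  then show ?thesis using A_in_Q[OF assms(1)] by (metis card_1_singletonE singletonD)
qed

lemma Q_sub_M: "a \<in> A \<Longrightarrow> a \<notin> L \<Longrightarrow> Q a \<subseteq> M"
  using Q_cases[of a] by (auto simp: M_def)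

lemma M_Q: "v \<in> M - X \<Longrightarrow> t v \<in> A \<and> v \<in> Q (t v) \<and> (t v \<in> L \<longrightarrow> v = t v)"
  using MV t_spec[of v] Q_t[of v] L_not_M[of "t v" v] by blast

text \<open>In a pair of color \<open>i0\<close> neither vertex is pebbled, so the play has to
  decide the orientation: \<open>\<phi> a\<close> is Duplicator's answer when Spoiler pebbles
  \<open>a\<close> together with \<open>W a\<close>, and this position is kept as evidence. For
  uncolored pairs any orientation will do.\<close>

lemma matching_exists:
  "\<exists>\<phi>. (\<forall>x \<in> N. \<phi> x = \<phi>0 x) \<and> inj_on \<phi> M \<and> (\<forall>a \<in> A - L. \<phi> ` Q a = Q' a) \<and>
    (\<forall>v \<in> M - X. \<phi> v \<in> Q' (t v)) \<and>
    (\<forall>a \<in> J. d a = i0 \<longrightarrow> (\<exists>R. position R \<and> W a \<subseteq> fst ` R \<and> (a, \<phi> a) \<in> R))"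
proof -
  have "\<exists>y. y \<in> Q' a \<and> (a \<in> N \<longrightarrow> y = \<phi>0 a) \<and>
      (a \<in> J \<and> d a = i0 \<longrightarrow> (\<exists>R. position R \<and> W a \<subseteq> fst ` R \<and> (a, y) \<in> R))" if a: "a \<in> A" for a
  proof (cases "a \<in> J \<and> d a = i0")
    case True
    then have "a \<in> \<Delta>" by (simp add: hidden_def)
    moreover have "a \<notin> L" using True by (auto simp: J_def L_def)
    ultimately have "a \<in> \<Delta>" "a \<notin> L" by auto
    then have nN: "a \<notin> N" using X_A a by (auto simp: N_def)
    have "card (insert a (W a)) + 0 \<le> r"
      using W_props(2)[of a] True r_ge k2 card_insert_le_m1[of k "W a" a] by linarith
    moreover have "insert a (W a) \<subseteq> V" "finite (insert a (W a))"
      using W_props(1,3)[of a] True MV a AV by auto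
    ultimately obtain R where R: "position R" "insert a (W a) \<subseteq> fst ` R"
      using ex_position by metis
    then obtain y where "(a, y) \<in> R" by auto
    moreover from this have "y \<in> Q' a" using block_iff[OF R(1)] a A_in_Q by blast
    ultimately show ?thesis using R nN by blast
  next
    case False
    have "card (Q' a) \<noteq> 0" using block_card_eq[OF a] card_Q_pos[OF a] by simp
    then have "Q' a \<noteq> {}" by auto
    then show ?thesis using False \<phi>0_Q'[OF _ a] by blast
  qed
  then obtain y where y: "\<And>a. a \<in> A \<Longrightarrow> y a \<in> Q' a" "\<And>a. a \<in> A \<Longrightarrow> a \<in> N \<Longrightarrow> y a = \<phi>0 a"
    "\<And>a. a \<in> A \<Longrightarrow> a \<in> J \<Longrightarrow> d a = i0 \<Longrightarrow> \<exists>R. position R \<and> W a \<subseteq> fst ` R \<and> (a, y a) \<in> R"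
    by metis
  have "\<exists>z. Q' a = {y a, z} \<and> z \<noteq> y a" if a: "a \<in> J" for a
  proof -
    have "a \<in> A" using a J_A by blast
    then have "card (Q' a - {y a}) = 1" using y(1) block_card_eq a finQ' by (simp add: J_def)
    then obtain z where "Q' a - {y a} = {z}" by (metis card_1_singletonE)
    then show ?thesis using y(1)[OF \<open>a \<in> A\<close>] by (intro exI[of _ z]) auto
  qed
  then obtain z where z: "\<And>a. a \<in> J \<Longrightarrow> Q' a = {y a, z a} \<and> z a \<noteq> y a" by metis
  define \<phi> where "\<phi> v = (if v \<in> X then \<phi>0 v else if v \<in> A then y v else z (t v))" for v
  have \<phi>A: "\<phi> a = y a" if "a \<in> A" for a using that X_A by (auto simp: \<phi>_def)
  have \<phi>X: "\<phi> x = \<phi>0 x" if "x \<in> X" for x using that by (simp add: \<phi>_def)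
  have \<phi>mate: "\<phi> (mate a) = z a" if "a \<in> J" for a
  proof -
    have "a \<in> A" "a \<notin> L" using that J_A by (auto simp: J_def L_def)
    then have "mate a \<in> Q a" "mate a \<notin> A" using Q_cases[of a] that Q_J A_in_Q Q_A by blast+
    then show ?thesis by (auto simp: \<phi>_def Q_def)
  qed
  have img: "\<phi> ` Q a = Q' a" if a: "a \<in> A" "a \<notin> L" for a
  proof (cases "a \<in> J")
    case True
    then have "Q a = {a, mate a}" using Q_J A_in_Q a by blast
    then show ?thesis using \<phi>A[OF a(1)] \<phi>mate[OF True] z[OF True] by simp
  next
    case False
    then have "Q a = {a}" using Q_cases[OF a] by blast
    moreover from this have "card (Q' a) = 1" using block_card_eq a by simp
    then have "Q' a = {y a}" using y(1)[OF a(1)] by (metis card_1_singletonE singletonD)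
    ultimately show ?thesis using \<phi>A[OF a(1)] by simp
  qed
  have inQ': "\<phi> v \<in> Q' (t v)" if v: "v \<in> M - X" for v
  proof (cases "t v \<in> L")
    case True
    then have "v = t v" "v \<in> A" using M_Q[OF v] L_A by auto
    then show ?thesis using \<phi>A y(1) by metis
  next
    case False
    then show ?thesis using M_Q[OF v] img by blast
  qed
  have inj: "inj_on \<phi> M"
  proof (rule inj_onI)
    fix v w assume vw: "v \<in> M" "w \<in> M" "\<phi> v = \<phi> w"
    have XnX: False if "v \<in> X" "w \<in> M - X" "\<phi> v = \<phi> w" for v w
    proof -
      have "\<phi> w \<in> \<phi>0 ` X" using \<phi>X[OF that(1)] that by force
      then show False using inQ'[OF that(2)] Q'_X by blast
    qed
    consider "v \<in> X" "w \<in> X" | "v \<notin> X" "w \<notin> X" using XnX[of v w] XnX[of w v] vw by auto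
    then show "v = w"
    proof cases
      case 1
      then show ?thesis using \<phi>X vw XN \<phi>0_inj by (metis inj_onD subsetD)
    next
      case 2
      then have v: "v \<in> M - X" and w: "w \<in> M - X" using vw by auto
      have t: "t v = t w" using Q'_disjoint[of "t v" "t w" "\<phi> v"] M_Q[OF v] M_Q[OF w] inQ'[OF v] inQ'[OF w] vw
        by simp
      show ?thesis
      proof (cases "t v \<in> L")
        case True
        then show ?thesis using M_Q[OF v] M_Q[OF w] t by simp
      next
        case False
        have a: "t v \<in> A" "v \<in> Q (t v)" "w \<in> Q (t v)" using M_Q[OF v] M_Q[OF w] t by auto
        show ?thesis
          using Q_cases[OF a(1) False]
        proof
          assume "Q (t v) = {t v}"
          then show "v = w" using a by auto
        next
          assume J: "t v \<in> J \<and> Q (t v) = {t v, mate (t v)} \<and> mate (t v) \<noteq> t v \<and> mate (t v) \<notin> A"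
          then have "\<phi> (t v) \<noteq> \<phi> (mate (t v))" using \<phi>A[OF a(1)] \<phi>mate z by metis
          moreover have "v \<in> {t v, mate (t v)}" "w \<in> {t v, mate (t v)}" using a J by metis+
          ultimately show "v = w" using vw(3) by auto
        qed
      qed
    qed
  qed
  have "\<phi> x = \<phi>0 x" if "x \<in> N" for x
    using that \<phi>X \<phi>A y(2) N_A by (metis DiffI subsetD)
  moreover have "\<exists>R. position R \<and> W a \<subseteq> fst ` R \<and> (a, \<phi> a) \<in> R" if "a \<in> J" "d a = i0" for a
    using y(3)[of a] that J_A \<phi>A[of a] by auto
  ultimately show ?thesis using inj img inQ' by (intro exI[of _ \<phi>]) blast
qed

end

section \<open>Orientation of the pairs in a position\<close>

locale matched = game_state +
  fixes \<phi>
  assumes \<phi>_N: "\<And>x. x \<in> N \<Longrightarrow> \<phi> x = \<phi>0 x"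
    and \<phi>_inj: "inj_on \<phi> M"
    and \<phi>_Q: "\<And>a. a \<in> A \<Longrightarrow> a \<notin> L \<Longrightarrow> \<phi> ` Q a = Q' a"
    and \<phi>_t: "\<And>v. v \<in> M \<Longrightarrow> v \<notin> X \<Longrightarrow> \<phi> v \<in> Q' (t v)"
    and reply: "\<And>a. a \<in> J \<Longrightarrow> d a = i0 \<Longrightarrow> \<exists>R. position R \<and> W a \<subseteq> fst ` R \<and> (a, \<phi> a) \<in> R"
begin

abbreviation "fl \<equiv> flip t mate"

text \<open>On \<open>M\<close> the answers are \<open>\<phi>\<close> after a turn of the pairs in
  \<open>F\<close>. The condition is imposed from either side, because vertices are pebbled in
  \<open>G\<close> in one play and in \<open>G'\<close> in the other.\<close>

definition consistent where
  "consistent R F \<longleftrightarrow> (\<forall>v v'. (v, v') \<in> R \<and> (v \<in> M \<or> v' \<in> \<phi> ` M) \<longrightarrow> v \<in> M \<and> v' = \<phi> (fl F v))"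

lemma \<phi>_X: "x \<in> X \<Longrightarrow> \<phi> x = \<phi>0 x" using \<phi>_N XN by blast

lemma \<phi>_V': "\<phi> ` M \<subseteq> V'"
proof
  fix y assume "y \<in> \<phi> ` M"
  then obtain v where v: "v \<in> M" "y = \<phi> v" by blast
  show "y \<in> V'"
  proof (cases "v \<in> X")
    case True
    then show ?thesis using v \<phi>_X \<phi>0_V' XN by auto
  next
    case False
    then show ?thesis using v \<phi>_t Q'_V' by blast
  qed
qed

text \<open>Answers stay in the block, which leaves at most the two vertices of a pair. In a pebbled
  pair the image of one vertex is fixed, and with it the other; only pairs in
  \<open>\<Delta>\<close> can be turned.\<close>

lemma position_image_cases:
  assumes R: "position R" "(v, v') \<in> R" and v: "v \<in> M"
  shows "v' = \<phi> v \<or> t v \<in> \<Delta> \<and> v' = \<phi> (mate v)"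
proof (cases "v \<in> N")
  case True
  then show ?thesis using position_N[OF R] \<phi>_N by metis
next
  case False
  then have vX: "v \<in> M - X" using v XN by blast
  note q = M_Q[OF vX]
  have nL: "t v \<notin> L" using q False by (auto simp: N_def)
  have v': "v' \<in> \<phi> ` Q (t v)" using block_iff[OF R] q \<phi>_Q nL by metis
  show ?thesis
  proof (cases "t v \<in> J")
    case nJ: False
    then have "Q (t v) = {t v}" using Q_cases[of "t v"] q nL by blast
    then have "Q (t v) = {v}" using q by auto
    then show ?thesis using v' by auto
  next
    case J: True
    have Q: "Q (t v) = {v, mate v}" using Q_J[OF J] q by blast
    show ?thesis
    proof (cases "v' = \<phi> v")
      case ne: False
      then have vm: "v' = \<phi> (mate v)" using v' Q by auto
      have "t v \<in> \<Delta>"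
      proof (rule ccontr)
        assume "t v \<notin> \<Delta>"
        then have tN: "t v \<in> N" using J by (simp add: N_def)
        then have "t v = mate v" using Q A_in_Q[of "t v"] q False by auto
        then have "v' = \<phi>0 (t v)" using vm \<phi>_N tN by simp
        then have "v = t v" using position_N[OF R tN] by blast
        then show False using tN False by simp
      qed
      then show ?thesis using vm by blast
    qed simp
  qed
qed

lemma position_domain:
  assumes R: "position R" "(v, \<phi> u) \<in> R" and u: "u \<in> M"
  shows "v \<in> M"
proof (cases "u \<in> N")
  case True
  then have "v = u" using position_N[OF R True] \<phi>_N by simp
  then show ?thesis using u by simp
next
  case False
  then have uX: "u \<in> M - X" using u XN by blast
  note q = M_Q[OF uX]
  have nL: "t u \<notin> L" using q False by (auto simp: N_def)
  have "v \<in> Q (t u)" using block_iff[OF R] q \<phi>_t uX by blast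
  then show ?thesis using Q_sub_M nL q by blast
qed

lemma fl_cong_iff: "v \<in> M \<Longrightarrow> F \<subseteq> J \<Longrightarrow> F' \<subseteq> J \<Longrightarrow> \<phi> (fl F v) = \<phi> (fl F' v) \<Longrightarrow> t v \<in> F \<longleftrightarrow> t v \<in> F'"
proof -
  assume a: "v \<in> M" "F \<subseteq> J" "F' \<subseteq> J" "\<phi> (fl F v) = \<phi> (fl F' v)"
  then have "fl F v = fl F' v" using \<phi>_inj flip_in by (meson inj_onD)
  then show ?thesis using a p_neq[of v] by (auto simp: flip_def split: if_splits)
qed

text \<open>Positions are one-to-one, so if one vertex of a pair is answered by the wrong image, the
  other one is too. Thus the set of turned pairs describes all answers on \<open>M\<close>.\<close>

lemma consistent_exists:
  assumes R: "position R"
  shows "\<exists>F \<subseteq> \<Delta>. consistent R F"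
proof -
  define F where "F = {a \<in> \<Delta>. \<exists>v v'. (v, v') \<in> R \<and> v \<in> M \<and> t v = a \<and> v' = \<phi> (mate v)}"
  have F: "F \<subseteq> \<Delta>" by (auto simp: F_def)
  have val: "v' = \<phi> (fl F v)" if v: "(v, v') \<in> R" "v \<in> M" for v v'
  proof (cases "t v \<in> F")
    case True
    then obtain w w' where w: "(w, w') \<in> R" "w \<in> M" "t w = t v" "w' = \<phi> (mate w)"
      by (auto simp: F_def)
    have J: "t v \<in> J" using True F \<Delta>_J by blast
    have "v' = \<phi> (mate v)"
    proof (cases "w = v")
      case True
      then show ?thesis using w v position_eq[OF R] by metis
    next
      case False
      then have wm: "w = mate v" using pair[OF v(2) w(2) J w(3)] by blast
      then have "w' = \<phi> v" using w p_p[OF v(2) J] by simp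
      then have "v' \<noteq> \<phi> v" using False position_eq[OF R v(1) w(1)] by metis
      then show ?thesis using position_image_cases[OF R v] by blast
    qed
    then show ?thesis using True by (simp add: flip_def)
  next
    case False
    then have "v' = \<phi> v" using position_image_cases[OF R v] v unfolding F_def by blast
    then show ?thesis using False by (simp add: flip_def)
  qed
  have "consistent R F"
    unfolding consistent_def
  proof (intro allI impI)
    fix v v' assume a: "(v, v') \<in> R \<and> (v \<in> M \<or> v' \<in> \<phi> ` M)"
    then have "v \<in> M" using position_domain[OF R] by blast
    then show "v \<in> M \<and> v' = \<phi> (fl F v)" using val a by blast
  qed
  then show ?thesis using F by blast
qed

lemma consistent_edges:
  assumes "position R" "consistent R F" "e \<subseteq> M" "e \<subseteq> fst ` R"
  shows "e \<in> E \<longleftrightarrow> \<phi> ` fl F ` e \<in> E'"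
proof -
  have "(\<lambda>x. x) ` e \<in> E \<longleftrightarrow> (\<lambda>x. \<phi> (fl F x)) ` e \<in> E'"
    by (rule position_edges[OF assms(1)]) (use assms(2-) in \<open>force simp: consistent_def\<close>)
  then show ?thesis by (simp add: image_image)
qed

lemma consistent_inverse:
  assumes "position R" "consistent R F" "F \<subseteq> J" "u \<in> M" "\<phi> u \<in> snd ` R"
  shows "(fl F u, \<phi> u) \<in> R"
proof -
  obtain v where v: "(v, \<phi> u) \<in> R" using assms(5) by auto
  then have "v \<in> M" "\<phi> u = \<phi> (fl F v)" using assms(2,4) by (auto simp: consistent_def)
  then have "u = fl F v" using \<phi>_inj flip_in assms by (meson inj_onD)
  then show ?thesis using v flip_self \<open>v \<in> M\<close> assms(3) by simp
qed

lemma consistent_edges':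
  assumes "position R" "consistent R F" "F \<subseteq> J" "e \<subseteq> M" "\<phi> ` e \<subseteq> snd ` R"
  shows "fl F ` e \<in> E \<longleftrightarrow> \<phi> ` e \<in> E'"
  by (rule position_edges[OF assms(1)]) (use consistent_inverse[OF assms(1-3)] assms(4,5) in blast)

lemma ex_position_extend:
  assumes "position R" "ex_game G G' s R" "finite D" "D \<subseteq> V" "card D + s' \<le> s"
  shows "\<exists>R'. R \<subseteq> R' \<and> position R' \<and> D \<subseteq> fst ` R' \<and> ex_game G G' s' R'"
proof -
  obtain R' where R': "R \<subseteq> R'" "R' \<subseteq> R \<union> V \<times> V'" "D \<subseteq> fst ` R'" "ex_game G G' s' R'"
    using ex_game_extend[OF assms(2) V_ne assms(3-5)] by blast
  then have "position R'" using ex_game_partial_iso[OF R'(4) V_ne] assms(1)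
    unfolding position_def by blast
  then show ?thesis using R' by blast
qed

lemma all_position_extend:
  assumes "position R" "all_game G G' s R" "finite D" "D \<subseteq> V'" "card D + s' \<le> s"
  shows "\<exists>R'. R \<subseteq> R' \<and> position R' \<and> D \<subseteq> snd ` R' \<and> all_game G G' s' R'"
proof -
  obtain R' where R': "R \<subseteq> R'" "R' \<subseteq> R \<union> V \<times> V'" "D \<subseteq> snd ` R'" "all_game G G' s' R'"
    using all_game_extend[OF assms(2) V'_ne assms(3-5)] by blast
  have "partial_iso E' E (prod.swap ` R')"
    using ex_game_partial_iso[of G' G s' "prod.swap ` R'"] V'_ne R'(4) by (simp add: all_game_iff)
  then have "partial_iso E E' (prod.swap ` prod.swap ` R')" by (rule partial_iso_converse)
  then have "partial_iso E E' R'" by (simp add: image_image)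
  then have "position R'" using R' assms(1) unfolding position_def by blast
  then show ?thesis using R' by blast
qed

lemma card_\<phi>_flip: "F \<subseteq> J \<Longrightarrow> e \<subseteq> M \<Longrightarrow> card (\<phi> ` fl F ` e) = card e"
  using card_flip[of F e] card_image[OF inj_on_subset[OF \<phi>_inj flip_image_in[of F e]]] by simp

context
  fixes a assumes a: "a \<in> J" "d a = i0"
begin

lemma a_M: "a \<in> M" "t a = a" "a \<in> \<Delta>" "mate a \<in> M" "mate a \<noteq> a" "mate (mate a) = a" "t (mate a) = a"
  using a J_in t_J p_in[of a] p_neq[of a] p_p[of a] t_p[of a] by (auto simp: hidden_def)

lemma flip_a: "fl F a = (if a \<in> F then mate a else a)" "fl F (mate a) = (if a \<in> F then a else mate a)"
  using a_M by (auto simp: flip_def)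

lemma W_flip_flip:
  assumes "F \<subseteq> \<Delta>" "F' \<subseteq> \<Delta>"
  shows "insert a (fl F ` fl F' ` W a) \<in> E \<longleftrightarrow> insert a (W a) \<in> E"
    "insert (mate a) (fl F ` fl F' ` W a) \<in> E \<longleftrightarrow> insert (mate a) (W a) \<in> E"
proof -
  have "fl F ` fl F' ` W a = fl ((F - F') \<union> (F' - F)) ` W a"
    using assms \<Delta>_J W_props(1)[OF a] by (intro flip_flip_image) auto
  moreover have "(F - F') \<union> (F' - F) \<subseteq> \<Delta>" using assms by blast
  ultimately show "insert a (fl F ` fl F' ` W a) \<in> E \<longleftrightarrow> insert a (W a) \<in> E"
    "insert (mate a) (fl F ` fl F' ` W a) \<in> E \<longleftrightarrow> insert (mate a) (W a) \<in> E"
    using W_stable[OF a] by simp_all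
qed

lemma W_image:
  assumes "F \<subseteq> \<Delta>"
  shows "fl F ` W a \<subseteq> M" "\<phi> ` fl F ` W a \<subseteq> V'" "Suc (card (\<phi> ` fl F ` W a)) = k"
    "finite (\<phi> ` fl F ` W a)"
proof -
  have F: "F \<subseteq> J" using assms \<Delta>_J by blast
  note W = W_props[OF a]
  show M: "fl F ` W a \<subseteq> M" using flip_image_in[OF F W(1)] .
  show "\<phi> ` fl F ` W a \<subseteq> V'" using M \<phi>_V' by blast
  show "Suc (card (\<phi> ` fl F ` W a)) = k" using card_\<phi>_flip[OF F W(1)] W(2) by simp
  show "finite (\<phi> ` fl F ` W a)" using W(3) by simp
qed

text \<open>Read off from the position in which \<open>\<phi> a\<close> was chosen. There
  \<open>a\<close> is not turned, but other hidden pairs met by \<open>W a\<close> may be, whence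
  the unknown \<open>F\<close>.\<close>

lemma reply_W: "\<exists>F \<subseteq> \<Delta>. insert (\<phi> a) (\<phi> ` fl F ` W a) \<in> E' \<longleftrightarrow> insert a (W a) \<in> E"
proof -
  obtain R where R: "position R" "W a \<subseteq> fst ` R" "(a, \<phi> a) \<in> R" using reply[OF a] by blast
  obtain F where F: "F \<subseteq> \<Delta>" "consistent R F" using consistent_exists[OF R(1)] by blast
  have "\<phi> a = \<phi> (fl F a)" using F(2) R(3) a_M(1) unfolding consistent_def by blast
  then have "\<phi> (fl {} a) = \<phi> (fl F a)" by (simp add: flip_def)
  then have "a \<notin> F" using fl_cong_iff[of a "{}" F] F \<Delta>_J a_M by auto
  moreover have "insert a (W a) \<in> E \<longleftrightarrow> \<phi> ` fl F ` insert a (W a) \<in> E'"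
  proof (rule consistent_edges[OF R(1) F(2)])
    show "insert a (W a) \<subseteq> M" using a_M W_props[OF a] by auto
    show "insert a (W a) \<subseteq> fst ` R" using R(2,3) by force
  qed
  ultimately show ?thesis using F(1) flip_a by auto
qed

text \<open>If \<open>\<phi> a\<close> came from \<open>mate a\<close>, Spoiler would pebble the set
  supplied by \<open>reply_W\<close>. With \<open>\<phi> a\<close> it has the status of
  \<open>a\<close> with \<open>W a\<close>, while its preimage, a flip of \<open>W a\<close>, is
  seen together with \<open>mate a\<close> and has the opposite status.\<close>

lemma all_game_not_flipped:
  assumes R: "position R" "all_game G G' (k - 1) R" "consistent R F" "F \<subseteq> \<Delta>" "\<phi> a \<in> snd ` R"
  shows "a \<notin> F"
proof
  assume aF: "a \<in> F"
  have J: "F \<subseteq> J" using R(4) \<Delta>_J by blast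
  obtain Fa where Fa: "Fa \<subseteq> \<Delta>" "insert (\<phi> a) (\<phi> ` fl Fa ` W a) \<in> E' \<longleftrightarrow> insert a (W a) \<in> E"
    using reply_W by blast
  note WI = W_image[OF Fa(1)]
  obtain R' where R': "R \<subseteq> R'" "position R'" "\<phi> ` fl Fa ` W a \<subseteq> snd ` R'"
  proof -
    have "card (\<phi> ` fl Fa ` W a) + 0 \<le> k - 1" using WI(3) by simp
    from all_position_extend[OF R(1,2) WI(4,2) this] show ?thesis using that by blast
  qed
  obtain F' where F': "F' \<subseteq> \<Delta>" "consistent R' F'" using consistent_exists[OF R'(2)] by blast
  have J': "F' \<subseteq> J" using F' \<Delta>_J by blast
  have "(mate a, \<phi> a) \<in> R" using consistent_inverse[OF R(1,3) J a_M(1) R(5)] aF flip_a by simp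
  then have "(mate a, \<phi> a) \<in> R'" "\<phi> a \<in> snd ` R'" using R' by force+
  moreover from this have "(fl F' a, \<phi> a) \<in> R'" using consistent_inverse[OF R'(2) F'(2) J' a_M(1)] by blast
  ultimately have "fl F' a = mate a" using position_eq[OF R'(2)] by metis
  then have aF': "a \<in> F'" using flip_a a_M by (metis)
  let ?e = "insert a (fl Fa ` W a)"
  have "fl F' ` ?e \<in> E \<longleftrightarrow> \<phi> ` ?e \<in> E'"
    by (rule consistent_edges'[OF R'(2) F'(2) J']) (use a_M WI R' \<open>\<phi> a \<in> snd ` R'\<close> in auto)
  moreover have "fl F' ` ?e = insert (mate a) (fl F' ` fl Fa ` W a)" using aF' flip_a by simp
  ultimately show False using W_flip_flip(2)[OF F'(1) Fa(1)] Fa(2) W_props(5)[OF a] by simp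
qed

text \<open>Frees the evidence of \<open>reply_W\<close> from its particular flip: every flipped
  image of \<open>W a\<close> tells \<open>\<phi> a\<close> and \<open>\<phi> (mate a)\<close> apart
  in the right direction.\<close>

lemma W_transfer:
  assumes F: "F \<subseteq> \<Delta>"
  shows "insert (\<phi> a) (\<phi> ` fl F ` W a) \<in> E' \<longleftrightarrow> insert a (W a) \<in> E"
    "insert (\<phi> (mate a)) (\<phi> ` fl F ` W a) \<in> E' \<longleftrightarrow> insert (mate a) (W a) \<in> E"
proof -
  note WI = W_image[OF F]
  have \<phi>a: "\<phi> a \<in> V'" "\<phi> (mate a) \<in> V'" using \<phi>_V' a_M by blast+
  let ?D = "insert (\<phi> a) (\<phi> ` fl F ` W a)"
  have cD: "card ?D \<le> k" using WI(3,4) by (simp add: card_insert_if)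
  \<comment> \<open>k moves exhibit the possible edge, and k - 1 are kept for
    \<open>all_game_not_flipped\<close>; this exhausts the \<open>2 * k - 1\<close> guaranteed
    rounds.\<close>
  then have card: "card ?D + (k - 1) \<le> r" using r_ge k2 by linarith
  have "finite ?D" "?D \<subseteq> V'" using WI \<phi>a by auto
  from all_position[OF this card]
  obtain R where R: "position R" "?D \<subseteq> snd ` R" "all_game G G' (k - 1) R" by blast
  obtain F' where F': "F' \<subseteq> \<Delta>" "consistent R F'" using consistent_exists[OF R(1)] by blast
  have J': "F' \<subseteq> J" using F' \<Delta>_J by blast
  have aF': "a \<notin> F'" using all_game_not_flipped[OF R(1,3) F'(2,1)] R(2) by simp
  have "fl F' ` insert a (fl F ` W a) \<in> E \<longleftrightarrow> \<phi> ` insert a (fl F ` W a) \<in> E'"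
    by (rule consistent_edges'[OF R(1) F'(2) J']) (use a_M WI R in auto)
  then show 1: "insert (\<phi> a) (\<phi> ` fl F ` W a) \<in> E' \<longleftrightarrow> insert a (W a) \<in> E"
    using aF' flip_a W_flip_flip(1)[OF F'(1) F] by simp
  \<comment> \<open>Here no rounds are reserved. Should the pair be turned, the set at
    \<open>\<phi> a\<close> would reveal the status of \<open>mate a\<close>, which is the opposite
    of the one already established.\<close>
  let ?D2 = "insert (\<phi> (mate a)) ?D"
  have "card ?D2 \<le> k + 1" using cD WI(4) by (simp add: card_insert_if)
  then have card2: "card ?D2 + 0 \<le> r" using r_ge k2 by linarith
  have "finite ?D2" "?D2 \<subseteq> V'" using WI \<phi>a by auto
  from all_position[OF this card2]
  obtain R2 where R2: "position R2" "?D2 \<subseteq> snd ` R2" by blast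
  obtain F2 where F2: "F2 \<subseteq> \<Delta>" "consistent R2 F2" using consistent_exists[OF R2(1)] by blast
  have J2: "F2 \<subseteq> J" using F2 \<Delta>_J by blast
  have e1: "fl F2 ` insert a (fl F ` W a) \<in> E \<longleftrightarrow> \<phi> ` insert a (fl F ` W a) \<in> E'"
    by (rule consistent_edges'[OF R2(1) F2(2) J2]) (use a_M WI R2 in auto)
  have e2: "fl F2 ` insert (mate a) (fl F ` W a) \<in> E \<longleftrightarrow> \<phi> ` insert (mate a) (fl F ` W a) \<in> E'"
    by (rule consistent_edges'[OF R2(1) F2(2) J2]) (use a_M WI R2 in auto)
  show "insert (\<phi> (mate a)) (\<phi> ` fl F ` W a) \<in> E' \<longleftrightarrow> insert (mate a) (W a) \<in> E"
  proof (cases "a \<in> F2")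
    case True
    then show ?thesis using e1 1 flip_a W_flip_flip(2)[OF F2(1) F] W_props(5)[OF a] by simp
  next
    case False
    then show ?thesis using e2 flip_a W_flip_flip(2)[OF F2(1) F] by simp
  qed
qed

text \<open>The version for both plays and for either vertex of the pair. Spoiler spends the k - 1
  rounds on \<open>W a\<close> or on its image; a turned pair would equate the statuses of
  \<open>v\<close> and \<open>mate v\<close>, by \<open>W_transfer\<close>.\<close>

lemma not_flipped:
  assumes R: "position R" "ex_game G G' (k - 1) R \<or> all_game G G' (k - 1) R" "consistent R F" "F \<subseteq> \<Delta>"
    and v: "v \<in> M" "v \<in> fst ` R" "t v = a"
  shows "a \<notin> F"
proof
  assume aF: "a \<in> F"
  have "W a \<subseteq> V" "\<phi> ` W a \<subseteq> V'" "finite (\<phi> ` W a)" "Suc (card (\<phi> ` W a)) = k"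
    using W_image[of "{}"] W_props[OF a] MV by (auto simp: flip_def)
  then have "\<exists>R'. R \<subseteq> R' \<and> position R' \<and> (W a \<subseteq> fst ` R' \<or> \<phi> ` W a \<subseteq> snd ` R')"
  proof (cases "ex_game G G' (k - 1) R")
    case True
    have "card (W a) + 0 \<le> k - 1" using W_props(2)[OF a] by simp
    then show ?thesis
      using ex_position_extend[OF R(1) True W_props(3)[OF a] \<open>W a \<subseteq> V\<close>] by metis
  next
    case False
    then have all: "all_game G G' (k - 1) R" using R(2) by blast
    have "card (\<phi> ` W a) + 0 \<le> k - 1" using \<open>Suc (card (\<phi> ` W a)) = k\<close> by simp
    then show ?thesis
      using all_position_extend[OF R(1) all \<open>finite (\<phi> ` W a)\<close> \<open>\<phi> ` W a \<subseteq> V'\<close>] by metis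
  qed
  then obtain R' where R': "R \<subseteq> R'" "position R'" "W a \<subseteq> fst ` R' \<or> \<phi> ` W a \<subseteq> snd ` R'" by blast
  obtain F' where F': "F' \<subseteq> \<Delta>" "consistent R' F'" using consistent_exists[OF R'(2)] by blast
  have J: "F \<subseteq> J" "F' \<subseteq> J" using R(4) F' \<Delta>_J by auto
  obtain v' where v': "(v, v') \<in> R" "(v, v') \<in> R'" using v R'(1) by auto
  have eqs: "v' = \<phi> (fl F v)" "v' = \<phi> (fl F' v)" using v' R(3) F'(2) v(1) by (auto simp: consistent_def)
  then have aF': "a \<in> F'" using fl_cong_iff[OF v(1) J] aF v(3) by auto
  have vc: "v = a \<or> v = mate a" using pair[of a v] a_M v a by auto
  then have flv: "fl F' v = mate v" "fl F' (mate v) = v" "mate v \<in> M" "mate (mate v) = v"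
    using aF' flip_a a_M by auto
  have WM: "W a \<subseteq> M" using W_props[OF a] by blast
  have neq: "insert v (W a) \<in> E \<longleftrightarrow> insert (mate v) (W a) \<notin> E"
    using vc W_props(5)[OF a] a_M by auto
  have tr: "insert (\<phi> (mate v)) (\<phi> ` fl F'' ` W a) \<in> E' \<longleftrightarrow> insert (mate v) (W a) \<in> E" if "F'' \<subseteq> \<Delta>" for F''
    using vc W_transfer[OF that] a_M by auto
  show False
    using R'(3)
  proof
    assume W: "W a \<subseteq> fst ` R'"
    have "insert v (W a) \<in> E \<longleftrightarrow> \<phi> ` fl F' ` insert v (W a) \<in> E'"
    proof (rule consistent_edges[OF R'(2) F'(2)])
      show "insert v (W a) \<subseteq> fst ` R'" using W v'(2) by force
    qed (use WM v in auto)
    then show False using neq tr[OF F'(1)] flv by simp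
  next
    assume W: "\<phi> ` W a \<subseteq> snd ` R'"
    have "fl F' ` insert (mate v) (W a) \<in> E \<longleftrightarrow> \<phi> ` insert (mate v) (W a) \<in> E'"
    proof (rule consistent_edges'[OF R'(2) F'(2) J(2)])
      have "\<phi> (mate v) \<in> snd ` R'" using v'(2) eqs(2) flv(1) by force
      then show "\<phi> ` insert (mate v) (W a) \<subseteq> snd ` R'" using W by simp
    qed (use WM flv in auto)
    moreover have "fl {} ` W a = W a" by (rule flip_image_trivial) simp
    moreover have "insert v (fl F' ` W a) \<in> E \<longleftrightarrow> insert v (W a) \<in> E"
      using vc W_stable[OF a F'(1)] by auto
    ultimately show False using neq tr[of "{}"] flv by simp
  qed
qed

end

definition C where "C = {a \<in> J. d a = 0}"

lemma C_sub: "C \<subseteq> J" "C \<subseteq> \<Delta>" by (auto simp: C_def hidden_def)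

lemma consistent_C:
  assumes R: "position R" "ex_game G G' (k - 1) R \<or> all_game G G' (k - 1) R"
  shows "\<exists>F \<subseteq> C. consistent R F"
proof -
  obtain F where F: "F \<subseteq> \<Delta>" "consistent R F" using consistent_exists[OF R(1)] by blast
  have "t v \<in> F \<longleftrightarrow> t v \<in> F \<inter> C" if v: "(v, v') \<in> R" "v \<in> M" for v v'
  proof -
    have "t v \<notin> F" if "t v \<in> J" "d (t v) = i0"
      using not_flipped[OF that R F(2,1) v(2) _ refl] v(1) by force
    then show ?thesis using F(1) by (auto simp: C_def hidden_def)
  qed
  then have "fl F v = fl (F \<inter> C) v" if "(v, v') \<in> R" "v \<in> M" for v v'
    using that unfolding flip_def by metis
  then have "consistent R (F \<inter> C)" using F(2) unfolding consistent_def by metis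
  then show ?thesis by blast
qed

text \<open>Spoiler pebbles the image of \<open>e\<close> and keeps k - 1 rounds. By
  \<open>consistent_C\<close> the preimage is \<open>e\<close> up to turns of uncolored pairs, which
  do not affect edges inside \<open>M\<close>.\<close>

lemma \<phi>_edges:
  assumes e: "e \<subseteq> M" "card e = k"
  shows "\<phi> ` e \<in> E' \<longleftrightarrow> e \<in> E"
proof -
  have "finite e" using e fin finite_subset by blast
  have card: "card (\<phi> ` e) + (k - 1) \<le> r"
    using card_image_le[OF \<open>finite e\<close>, of \<phi>] e r_ge k2 by linarith
  have "\<phi> ` e \<subseteq> V'" "finite (\<phi> ` e)" using e \<phi>_V' \<open>finite e\<close> by auto
  then obtain R where R: "position R" "\<phi> ` e \<subseteq> snd ` R" "all_game G G' (k - 1) R"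
    using all_position[OF _ _ card] by blast
  obtain F where F: "F \<subseteq> C" "consistent R F" using consistent_C[OF R(1)] R(3) by blast
  then have "F \<subseteq> J" using C_sub by blast
  from consistent_edges'[OF R(1) F(2) this e(1) R(2)] show ?thesis
    using flip_invariant[of F e] F(1) e by (simp add: C_def)
qed

end

section \<open>Types of uncolored vertices\<close>

text \<open>One value is rarer in \<open>B'\<close> and another is rarer in \<open>B\<close>. As
  their fibers in \<open>B\<close> are disjoint, the smaller of the two deficient counts is below
  half of \<open>card B\<close>, which keeps it cheap to exhibit one element more.\<close>

lemma fiber_counts_differ:
  assumes fin: "finite B" "finite B'" and card: "card B = card B'"
    and ne: "card {x \<in> B. f x = \<rho>} \<noteq> card {y \<in> B'. g y = \<rho>}"
  obtains \<sigma> \<tau> where "card {y \<in> B'. g y = \<tau>} < card {x \<in> B. f x = \<tau>}"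
    "card {x \<in> B. f x = \<sigma>} < card {y \<in> B'. g y = \<sigma>}"
    "card {y \<in> B'. g y = \<tau>} + card {x \<in> B. f x = \<sigma>} < card B"
proof -
  define n where "n \<tau> = card {x \<in> B. f x = \<tau>}" for \<tau>
  define n' where "n' \<tau> = card {y \<in> B'. g y = \<tau>}" for \<tau>
  define T where "T = f ` B \<union> g ` B' \<union> {\<rho>}"
  have finT: "finite T" using fin by (simp add: T_def)
  have sum: "(\<Sum>\<tau> \<in> T. n \<tau>) = card B"
    unfolding n_def using finT fin
    by (subst card_UN_disjoint[symmetric]) (auto simp: T_def intro!: arg_cong[of _ _ card])
  have sum': "(\<Sum>\<tau> \<in> T. n' \<tau>) = card B'"
    unfolding n'_def using finT fin
    by (subst card_UN_disjoint[symmetric]) (auto simp: T_def intro!: arg_cong[of _ _ card])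
  have \<rho>: "n \<rho> \<noteq> n' \<rho>" "\<rho> \<in> T" using ne by (auto simp: n_def n'_def T_def)
  have "\<exists>\<tau> \<in> T. n' \<tau> < n \<tau>"
  proof (rule ccontr)
    assume "\<not> ?thesis"
    then have le: "\<forall>\<tau> \<in> T. n \<tau> \<le> n' \<tau>" by auto
    moreover from this have "n \<rho> < n' \<rho>" using \<rho> by (simp add: order_less_le)
    ultimately have "sum n T < sum n' T" using sum_strict_mono_ex1[OF finT] \<rho>(2) by blast
    then show False using sum sum' card by simp
  qed
  moreover have "\<exists>\<tau> \<in> T. n \<tau> < n' \<tau>"
  proof (rule ccontr)
    assume "\<not> ?thesis"
    then have le: "\<forall>\<tau> \<in> T. n' \<tau> \<le> n \<tau>" by auto
    moreover from this have "n' \<rho> < n \<rho>" using \<rho> by (simp add: order_less_le)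
    ultimately have "sum n' T < sum n T" using sum_strict_mono_ex1[OF finT] \<rho>(2) by blast
    then show False using sum sum' card by simp
  qed
  ultimately obtain \<tau> \<sigma> where ts: "n' \<tau> < n \<tau>" "n \<sigma> < n' \<sigma>" by blast
  then have "\<tau> \<noteq> \<sigma>" by auto
  then have "{x \<in> B. f x = \<tau>} \<inter> {x \<in> B. f x = \<sigma>} = {}" by auto
  then have "n \<tau> + n \<sigma> = card ({x \<in> B. f x = \<tau>} \<union> {x \<in> B. f x = \<sigma>})"
    unfolding n_def using fin by (intro card_Un_disjoint[symmetric]) auto
  also have "\<dots> \<le> card B" using fin by (intro card_mono) auto
  finally show ?thesis using that[of \<tau> \<sigma>] ts unfolding n_def n'_def by linarith
qed

lemma bij_betw_fibers:
  assumes fin: "finite B" "finite B'"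
    and card: "\<And>\<tau>. card {x \<in> B. f x = \<tau>} = card {y \<in> B'. g y = \<tau>}"
  shows "\<exists>h. bij_betw h B B' \<and> (\<forall>x \<in> B. g (h x) = f x)"
proof -
  have "\<exists>h. bij_betw h {x \<in> B. f x = \<tau>} {y \<in> B'. g y = \<tau>}" for \<tau>
    by (rule finite_same_card_bij) (use fin card in auto)
  then obtain h where h: "\<And>\<tau>. bij_betw (h \<tau>) {x \<in> B. f x = \<tau>} {y \<in> B'. g y = \<tau>}" by metis
  define H where "H x = h (f x) x" for x
  have H: "H x \<in> B'" "g (H x) = f x" if "x \<in> B" for x
    using that bij_betwE[OF h[of "f x"]] by (auto simp: H_def)
  have "inj_on H B"
  proof (rule inj_onI)
    fix x y assume xy: "x \<in> B" "y \<in> B" "H x = H y"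
    then have "f x = f y" using H by metis
    then show "x = y" using xy bij_betw_imp_inj_on[OF h[of "f x"]] by (auto simp: H_def dest: inj_onD)
  qed
  moreover have "B' \<subseteq> H ` B"
  proof
    fix y assume y: "y \<in> B'"
    then have "y \<in> h (g y) ` {x \<in> B. f x = g y}" using h[of "g y"] by (auto simp: bij_betw_def)
    then obtain x where "x \<in> B" "f x = g y" "y = h (g y) x" by blast
    then show "y \<in> H ` B" by (intro image_eqI[of y H x]) (simp_all add: H_def)
  qed
  ultimately show ?thesis using H by (intro exI[of _ H]) (auto simp: bij_betw_def)
qed

context matched
begin

lemma free_color: "S \<subseteq> U \<Longrightarrow> card S < k \<Longrightarrow> \<exists>j. 1 \<le> j \<and> j \<le> k \<and> (\<forall>s \<in> S. c s \<noteq> j)"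
proof -
  assume S: "S \<subseteq> U" "card S < k"
  have "finite S" using S fin finite_subset by blast
  then have "card (c ` S) < card {1..k}" using card_image_le[of S c] S by simp
  then have "\<not> {1..k} \<subseteq> c ` S" using \<open>finite S\<close> by (meson card_mono finite_imageI leD)
  then show ?thesis by auto
qed

text \<open>If the flip moves a vertex of \<open>S\<close>, then \<open>S\<close> uses color
  \<open>\<iota>\<close>, and a color \<open>j\<close> missed by \<open>S\<close> has its class in
  \<open>X\<close>, which no flip moves. Exchanging \<open>b\<close> for a vertex of color
  \<open>j\<close> puts both sets into the image of \<open>M\<close>, where flips of uncolored pairs
  are harmless. The map \<open>\<theta>\<close> lets the lemma serve both graphs, with the identity
  and with \<open>\<phi>\<close>.\<close>

lemma flipped_swap:
  fixes \<theta> :: "'a \<Rightarrow> 'c"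
  assumes max: "max_coloring k VH EH cH" and finH: "finite VH"
    and \<theta>: "\<theta> ` U = colored VH cH" "\<theta> ` M \<subseteq> VH" "inj_on \<theta> M" "\<And>u. u \<in> U \<Longrightarrow> cH (\<theta> u) = c u"
    and edges: "\<And>e. e \<subseteq> M \<Longrightarrow> card e = k \<Longrightarrow> \<theta> ` e \<in> EH \<longleftrightarrow> e \<in> E"
    and b: "b \<in> VH" "b \<notin> \<theta> ` M" and S: "S \<subseteq> U" "Suc (card S) = k" and F: "F \<subseteq> C"
  shows "insert b (\<theta> ` fl F ` S) \<in> EH \<longleftrightarrow> insert b (\<theta> ` S) \<in> EH"
proof (cases "\<exists>s \<in> S. t s \<in> F")
  case False
  then have "fl F ` S = S" by (intro flip_image_trivial) auto
  then show ?thesis by simp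
next
  case True
  then obtain s where s: "s \<in> S" "t s \<in> F" by blast
  have FJ: "F \<subseteq> J" using F C_sub by blast
  have SM: "S \<subseteq> M" using S U_M by blast
  have finS: "finite S" using SM fin finite_subset by blast
  have sA: "s \<in> A"
  proof (rule ccontr)
    assume "s \<notin> A"
    then have "s \<in> X" using s(1) S(1) U_eq by blast
    then show False using t_X s(2) FJ J_A \<open>s \<notin> A\<close> by auto
  qed
  obtain j where j: "1 \<le> j" "j \<le> k" "\<forall>s \<in> S. c s \<noteq> j" using free_color[OF S(1)] S(2) by auto
  have j\<iota>: "j \<noteq> \<iota>" using j(3) s sA by (auto simp: A_def)
  have b0: "b \<notin> colored VH cH" using b \<theta>(1) U_M by blast
  then have "cH b = 0" using b by (simp add: colored_def)
  then obtain a' where a': "attached k VH EH cH j b a'"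
    using max_coloring_attached[OF max finH b(1) _ j(1,2)] by blast
  then have "a' \<in> colored VH cH" using j by (auto simp: attached_def colored_def)
  then obtain x where x: "x \<in> U" "a' = \<theta> x" using \<theta>(1) by blast
  have cx: "c x = j" using a' x \<theta>(4) by (auto simp: attached_def)
  then have xX: "x \<in> X" using x j\<iota> U_eq by (auto simp: A_def)
  have xS: "x \<notin> S" using cx j by blast
  have xF: "fl F x = x" using t_X[OF xX] xX FJ J_A X_A by (auto simp: flip_def)
  define P where "P = fl F ` S"
  have PM: "P \<subseteq> M" using flip_image_in[OF FJ SM] by (simp add: P_def)
  have cP: "card P = card S" "finite P" using card_flip[OF FJ SM] finS by (auto simp: P_def)
  have split: "\<theta> ` P = \<theta> ` (P \<inter> U) \<union> \<theta> ` (P - U)" by blast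
  have inj: "inj_on \<theta> P" using \<theta>(3) PM inj_on_subset by blast
  have swap: "insert b (\<theta> ` (P \<inter> U) \<union> \<theta> ` (P - U)) \<in> EH \<longleftrightarrow> insert a' (\<theta> ` (P \<inter> U) \<union> \<theta> ` (P - U)) \<in> EH"
  proof (rule max_coloring_swap[OF max finH])
    show "\<theta> ` (P \<inter> U) \<subseteq> colored VH cH" using \<theta>(1) by blast
    show "\<theta> ` (P - U) \<subseteq> VH - colored VH cH"
    proof
      fix y assume "y \<in> \<theta> ` (P - U)"
      then obtain v where v: "v \<in> M" "v \<notin> U" "y = \<theta> v" using PM by blast
      have "y \<notin> \<theta> ` U" using v U_M inj_onD[OF \<theta>(3)] by blast
      then show "y \<in> VH - colored VH cH" using v \<theta>(1,2) by blast
    qed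
    show "b \<in> VH - colored VH cH" using b b0 by blast
    show "b \<notin> \<theta> ` (P - U)" using b PM by blast
    have "card (\<theta> ` (P \<inter> U)) + card (\<theta> ` (P - U)) = card (P \<inter> U) + card (P - U)"
      using inj by (simp add: card_image inj_on_subset)
    also have "\<dots> = card P" using cP card_Int_Diff[of P U] by simp
    finally show "Suc (card (\<theta> ` (P \<inter> U)) + card (\<theta> ` (P - U))) = k" using cP S by simp
    show "cH s' \<noteq> j" if s': "s' \<in> \<theta> ` (P \<inter> U)" for s'
    proof -
      obtain v where v: "v \<in> P" "v \<in> U" "s' = \<theta> v" using s' by blast
      have "c v \<noteq> j"
      proof (cases "v \<in> A")
        case True
        then show ?thesis using j\<iota> by (auto simp: A_def)
      next
        case False
        then have vX: "v \<in> X" using v U_eq by blast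
        obtain u where u: "u \<in> S" "v = fl F u" using v P_def by blast
        have "t u = t v" using t_flip[OF FJ] u SM by auto
        then have "t u \<notin> F" using t_X[OF vX] vX FJ J_A X_A by auto
        then have "v = u" using u by (simp add: flip_def)
        then show ?thesis using u j by blast
      qed
      then show ?thesis using v \<theta>(4) by simp
    qed
  qed (use j a' in auto)
  have swap0: "insert b (\<theta> ` S \<union> {}) \<in> EH \<longleftrightarrow> insert a' (\<theta> ` S \<union> {}) \<in> EH"
  proof (rule max_coloring_swap[OF max finH])
    show "\<theta> ` S \<subseteq> colored VH cH" using \<theta>(1) S by blast
    have "card (\<theta> ` S) = card S" using \<theta>(3) SM by (meson card_image inj_on_subset)
    then show "Suc (card (\<theta> ` S) + card {}) = k" using S by simp
    show "cH s' \<noteq> j" if s': "s' \<in> \<theta> ` S" for s'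
    proof -
      obtain v where v: "v \<in> S" "s' = \<theta> v" using s' by blast
      then have "cH s' = c v" using \<theta>(4) S(1) by blast
      then show ?thesis using v j(3) by simp
    qed
  qed (use j a' b b0 in auto)
  have "card (insert x S) = k" "insert x S \<subseteq> M" using xS finS S x U_M by auto
  note xS' = this
  have "insert a' (\<theta> ` P) = \<theta> ` fl F ` insert x S" using x xF by (simp add: P_def)
  also have "\<dots> \<in> EH \<longleftrightarrow> fl F ` insert x S \<in> E"
    by (rule edges) (use flip_image_in[OF FJ xS'(2)] card_flip[OF FJ xS'(2)] xS' in auto)
  also have "\<dots> \<longleftrightarrow> insert x S \<in> E" by (rule flip_invariant) (use F xS' in \<open>auto simp: C_def\<close>)
  also have "\<dots> \<longleftrightarrow> \<theta> ` insert x S \<in> EH" using edges[OF xS'(2,1)] by simp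
  finally have "insert a' (\<theta> ` P) \<in> EH \<longleftrightarrow> insert a' (\<theta> ` S) \<in> EH" using x by simp
  then show ?thesis using swap swap0 split by (simp add: P_def)
qed

text \<open>Exchange \<open>mate z\<close> for \<open>z\<close> next to \<open>b\<close>, and
  \<open>b\<close> for \<open>a\<close> next to \<open>mate z\<close>. So for k = 2 the adjacency of
  \<open>b\<close> to a vertex \<open>z\<close> of \<open>J\<close> is visible inside
  \<open>M\<close>, and no rounds need to be reserved for an orientation.\<close>

lemma mate_swap:
  fixes \<theta> :: "'a \<Rightarrow> 'c"
  assumes max: "max_coloring k VH EH cH" and finH: "finite VH"
    and \<theta>: "\<theta> ` U = colored VH cH" "\<theta> ` M \<subseteq> VH" "inj_on \<theta> M"
    and edges: "\<And>e. e \<subseteq> M \<Longrightarrow> card e = k \<Longrightarrow> \<theta> ` e \<in> EH \<longleftrightarrow> e \<in> E"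
    and b: "b \<in> VH" "b \<notin> \<theta> ` M" and k: "k = 2" and z: "z \<in> J" and a: "a \<in> A"
    and att: "attached k VH EH cH \<iota> (\<theta> (mate z)) (\<theta> z)" "attached k VH EH cH \<iota> b (\<theta> a)"
  shows "insert b {\<theta> z} \<in> EH \<longleftrightarrow> {a, mate z} \<in> E"
proof -
  have zM: "z \<in> M" "mate z \<in> M" "mate z \<noteq> z" "t (mate z) = z"
    using z J_in p_in[of z] p_neq[of z] t_p[of z] t_J by auto
  have "mate z \<in> Q z" "mate z \<notin> A" using Q_J[OF z A_in_Q] z J_A Q_A[of "mate z" z] by auto
  then have "mate z \<notin> U" using U_eq by (auto simp: Q_def)
  then have m: "\<theta> (mate z) \<in> VH - colored VH cH" using \<theta> zM U_M by (auto dest: inj_onD)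
  have b0: "b \<in> VH - colored VH cH" using b \<theta>(1) U_M by blast
  have bm: "b \<noteq> \<theta> (mate z)" using b zM by blast
  have "insert (\<theta> (mate z)) ({} \<union> {b}) \<in> EH \<longleftrightarrow> insert (\<theta> z) ({} \<union> {b}) \<in> EH"
    by (rule max_coloring_swap[OF max finH]) (use m b0 bm k \<iota> att in auto)
  moreover have "insert b ({} \<union> {\<theta> (mate z)}) \<in> EH \<longleftrightarrow> insert (\<theta> a) ({} \<union> {\<theta> (mate z)}) \<in> EH"
    by (rule max_coloring_swap[OF max finH]) (use m b0 bm k \<iota> att in auto)
  moreover have "a \<noteq> mate z" "a \<in> M" using \<open>mate z \<notin> A\<close> a by (auto simp: M_def)
  then have "\<theta> ` {a, mate z} \<in> EH \<longleftrightarrow> {a, mate z} \<in> E"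
    by (intro edges) (use zM k in auto)
  ultimately show ?thesis by (simp add: insert_commute)
qed

definition c' where "c' v' = (if v' \<in> \<phi> ` U then c (inv_into U \<phi> v') else 0)"

lemma \<phi>_inj_U: "inj_on \<phi> U" using \<phi>_inj U_M inj_on_subset by blast

lemma c'_\<phi>: "u \<in> U \<Longrightarrow> c' (\<phi> u) = c u"
  using \<phi>_inj_U by (auto simp: c'_def)

lemma c_U: "u \<in> U \<longleftrightarrow> u \<in> V \<and> c u \<noteq> 0" by (auto simp: U_def colored_def)

lemma colored_c': "colored V' c' = \<phi> ` U"
proof
  show "\<phi> ` U \<subseteq> colored V' c'"
  proof
    fix y assume "y \<in> \<phi> ` U"
    then obtain u where u: "u \<in> U" "y = \<phi> u" by blast
    then have "y \<in> V'" using \<phi>_V' U_M by blast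
    then show "y \<in> colored V' c'" using u c'_\<phi>[of u] c_U[of u] by (simp add: colored_def)
  qed
qed (auto simp: colored_def c'_def split: if_splits)

lemma other_colors: "{v \<in> V'. c' v \<noteq> 0 \<and> c' v \<noteq> j} = \<phi> ` {v \<in> V. c v \<noteq> 0 \<and> c v \<noteq> j}"
proof -
  have "{v \<in> V'. c' v \<noteq> 0 \<and> c' v \<noteq> j} = {v \<in> \<phi> ` U. c' v \<noteq> j}"
    unfolding colored_c'[symmetric] by (auto simp: colored_def)
  also have "\<dots> = \<phi> ` {v \<in> U. c v \<noteq> j}" using c'_\<phi> by auto
  finally show ?thesis by (simp add: c_U conj_assoc)
qed

text \<open>Edges are preserved on \<open>U\<close>, so separating sets carry over along
  \<open>\<phi>\<close>. The coloring \<open>c'\<close> has \<open>card U\<close> colored vertices,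
  and by \<open>max'\<close> no other does better.\<close>

lemma max_c': "max_coloring k V' E' c'"
  unfolding max_coloring_def
proof (intro conjI allI impI)
  show "separating_coloring k V' E' c'"
    unfolding separating_coloring_def
  proof (intro conjI ballI impI)
    fix v assume "v \<in> V'"
    show "c' v \<le> k"
      using sep c'_\<phi> c_U by (cases "v \<in> \<phi> ` U") (auto simp: separating_coloring_def c'_def)
  next
    fix x y assume xy: "x \<in> V'" "y \<in> V'" "x \<noteq> y \<and> c' x = c' y \<and> c' x \<noteq> 0"
    then have "x \<in> \<phi> ` U" "y \<in> \<phi> ` U" by (auto simp: c'_def split: if_splits)
    then obtain u w where uw: "u \<in> U" "x = \<phi> u" "w \<in> U" "y = \<phi> w" by blast
    then have uw': "u \<noteq> w" "c u = c w" "c u \<noteq> 0" "u \<in> V" "w \<in> V" using xy c'_\<phi> c_U by auto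
    then have "\<not> similar k E {v \<in> V. c v \<noteq> 0 \<and> c v \<noteq> c u} u w"
      using sep unfolding separating_coloring_def by blast
    then obtain S where S: "S \<subseteq> {v \<in> V. c v \<noteq> 0 \<and> c v \<noteq> c u}" "Suc (card S) = k"
      "insert u S \<in> E \<longleftrightarrow> insert w S \<notin> E" unfolding similar_def by blast
    have SU: "S \<subseteq> M" "finite S" "u \<notin> S" "w \<notin> S"
      using S(1) U_M c_U uw' finV finite_subset[of S V] by auto
    have im: "\<phi> ` insert u S \<in> E' \<longleftrightarrow> insert u S \<in> E" "\<phi> ` insert w S \<in> E' \<longleftrightarrow> insert w S \<in> E"
      by (rule \<phi>_edges; use SU S uw U_M in auto)+
    have "\<phi> ` S \<subseteq> {v \<in> V'. c' v \<noteq> 0 \<and> c' v \<noteq> c' x}"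
      unfolding other_colors using S(1) uw c'_\<phi> by auto
    moreover have "Suc (card (\<phi> ` S)) = k" using S SU \<phi>_inj by (metis card_image inj_on_subset)
    ultimately show "\<not> similar k E' {v \<in> V'. c' v \<noteq> 0 \<and> c' v \<noteq> c' x} x y"
      using S(3) im uw unfolding similar_def by auto
  qed
  fix c'' assume "separating_coloring k V' E' c''"
  then show "card (colored V' c'') \<le> card (colored V' c')"
    using max' card_image[OF \<phi>_inj_U] by (simp add: colored_c')
qed

lemma \<phi>_A: "a \<in> A \<Longrightarrow> \<phi> a \<in> Q' a"
  using \<phi>_t[of a] t_A[of a] X_A by (auto simp: M_def)

lemma attached_\<iota>: "a \<in> A \<Longrightarrow> v \<in> Q a \<Longrightarrow> attached k V E c \<iota> v a"
  using Q_iff AV by (auto simp: attached_def A_def X_def)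

lemma attached'_\<iota>:
  assumes a: "a \<in> A" and v': "v' \<in> Q' a"
  shows "attached k V' E' c' \<iota> v' (\<phi> a)"
proof -
  have "similar k E' (\<phi> ` X) v' (\<phi> a)"
    unfolding similar_def
  proof (intro allI impI)
    fix S assume S: "S \<subseteq> \<phi> ` X" "Suc (card S) = k"
    then obtain T where T: "T \<subseteq> X" "S = \<phi> ` T" by (meson subset_imageE)
    then have "S = \<phi>0 ` T" using \<phi>_X by (auto simp: subset_iff image_def)
    moreover have "card S = card T" using T \<phi>_inj by (metis card_image inj_on_subset U_M U_eq le_supE)
    ultimately show "insert v' S \<in> E' \<longleftrightarrow> insert (\<phi> a) S \<in> E'"
      using v' \<phi>_A[OF a] T S unfolding Q'_def by auto
  qed
  moreover have "{v \<in> V'. c' v \<noteq> 0 \<and> c' v \<noteq> \<iota>} = \<phi> ` X" unfolding other_colors X_def ..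
  moreover have "c' (\<phi> a) = \<iota>" using c'_\<phi>[of a] a U_eq by (auto simp: A_def)
  moreover have "\<phi> a \<in> V'" using \<phi>_A[OF a] Q'_V' by blast
  ultimately show ?thesis by (simp add: attached_def)
qed

definition tp where "tp b = {S. S \<subseteq> U \<and> Suc (card S) = k \<and> insert b S \<in> E}"
text \<open>Pulled back to subsets of \<open>U\<close> along \<open>\<phi>\<close>, so that types in
  the two graphs can be compared.\<close>

definition tp' where "tp' b' = {S. S \<subseteq> U \<and> Suc (card S) = k \<and> insert b' (\<phi> ` S) \<in> E'}"

text \<open>Spoiler pebbles a set \<open>S\<close> on which the types disagree, or its image. With k
  - 1 more rounds only uncolored pairs can be turned, and by \<open>flipped_swap\<close> neither
  \<open>b\<close> nor \<open>b'\<close> notices this. For k = 2 these rounds are not affordable,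
  and \<open>mate_swap\<close> takes their place.\<close>

lemma type_mismatch:
  assumes R: "position R" "(b, b') \<in> R" and game: "ex_game G G' s R \<or> all_game G G' s R"
    and s: "s \<ge> (k - 1) + (if k = 2 then 0 else k - 1)"
    and a: "a \<in> L" and b: "b \<in> Q a" "b \<noteq> a"
  shows "tp b = tp' b'"
proof (rule ccontr)
  assume "tp b \<noteq> tp' b'"
  then obtain S where S: "S \<subseteq> U" "Suc (card S) = k" "insert b S \<in> E \<longleftrightarrow> insert b' (\<phi> ` S) \<notin> E'"
    by (auto simp: tp_def tp'_def)
  have aA: "a \<in> A" using a L_A by blast
  have SM: "S \<subseteq> M" "finite S" using S U_M fin finite_subset by blast+
  have bM: "b \<in> V - M" using L_not_M a b by blast
  have b'M: "b' \<in> V'" "b' \<notin> \<phi> ` M" using R position_domain bM by (auto simp: position_def)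
  have b'Q: "b' \<in> Q' a" using block_iff[OF R aA] b by blast
  let ?s = "if k = 2 then 0 else k - 1"
  have "\<exists>R'. R \<subseteq> R' \<and> position R' \<and> (S \<subseteq> fst ` R' \<or> \<phi> ` S \<subseteq> snd ` R') \<and>
      (ex_game G G' ?s R' \<or> all_game G G' ?s R')"
  proof (cases "ex_game G G' s R")
    case True
    have "card S + ?s \<le> s" "S \<subseteq> V" using S s SM MV by auto
    then show ?thesis using ex_position_extend[OF R(1) True SM(2)] by metis
  next
    case False
    then have all: "all_game G G' s R" using game by blast
    have "card (\<phi> ` S) + ?s \<le> s" "\<phi> ` S \<subseteq> V'" "finite (\<phi> ` S)"
      using card_image_le[OF SM(2), of \<phi>] S s SM \<phi>_V' by auto
    then show ?thesis using all_position_extend[OF R(1) all] by metis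
  qed
  then obtain R' where R': "R \<subseteq> R'" "position R'" "S \<subseteq> fst ` R' \<or> \<phi> ` S \<subseteq> snd ` R'"
    "ex_game G G' ?s R' \<or> all_game G G' ?s R'" by blast
  have id_inv: "(\<lambda>x. x) ` e \<in> E \<longleftrightarrow> e \<in> E" for e by simp
  have id_U: "(\<lambda>x. x) ` U = colored V c" by (simp add: U_def)
  have "\<exists>F \<subseteq> \<Delta>. consistent R' F \<and> (insert b (fl F ` S) \<in> E \<longleftrightarrow> insert b S \<in> E) \<and>
      (insert b' (\<phi> ` fl F ` S) \<in> E' \<longleftrightarrow> insert b' (\<phi> ` S) \<in> E')"
  proof (cases "k = 2")
    case False
    then obtain F where F: "F \<subseteq> C" "consistent R' F" using consistent_C[OF R'(2)] R'(4) by auto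
    have "insert b ((\<lambda>x. x) ` fl F ` S) \<in> E \<longleftrightarrow> insert b ((\<lambda>x. x) ` S) \<in> E"
      by (rule flipped_swap[OF max finV id_U]) (use MV bM S F in auto)
    moreover have "insert b' (\<phi> ` fl F ` S) \<in> E' \<longleftrightarrow> insert b' (\<phi> ` S) \<in> E'"
      by (rule flipped_swap[OF max_c' fin' colored_c'[symmetric] \<phi>_V' \<phi>_inj c'_\<phi> \<phi>_edges])
        (use b'M S F in auto)
    ultimately show ?thesis using F C_sub by auto
  next
    case True
    then have "card S = 1" using S by simp
    then obtain z where z: "S = {z}" by (metis card_1_singletonE)
    \<comment> \<open>For \<open>z\<close> in \<open>J\<close> both statuses would equal that of
      \<open>{a, mate z}\<close> in \<open>G\<close>. So the disagreement is at a vertex that no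
      flip moves.\<close>
    have "z \<notin> J"
    proof
      assume zJ: "z \<in> J"
      have mQ: "mate z \<in> Q z" "mate z \<in> M" "z \<in> A" "z \<notin> L"
        using Q_J[OF zJ A_in_Q] zJ J_A p_in[of z] J_in t_J by (auto simp: J_def L_def)
      have "insert b {(\<lambda>x. x) z} \<in> E \<longleftrightarrow> {a, mate z} \<in> E"
        by (rule mate_swap[OF max finV id_U])
          (use MV bM True zJ aA attached_\<iota>[OF mQ(3,1)] attached_\<iota>[OF aA b(1)] in auto)
      moreover have "\<phi> (mate z) \<in> Q' z" using \<phi>_Q mQ by blast
      then have "insert b' {\<phi> z} \<in> E' \<longleftrightarrow> {a, mate z} \<in> E"
        by (intro mate_swap[OF max_c' fin' colored_c'[symmetric] \<phi>_V' \<phi>_inj \<phi>_edges])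
          (use b'M True zJ aA attached'_\<iota> mQ b'Q in auto)
      ultimately show False using S(3) z by simp
    qed
    then have triv: "fl F ` S = S" if "F \<subseteq> \<Delta>" for F
      using that \<Delta>_J z S(1) t_X t_A U_eq by (intro flip_image_trivial) auto
    obtain F where "F \<subseteq> \<Delta>" "consistent R' F" using consistent_exists[OF R'(2)] by blast
    then show ?thesis using triv by auto
  qed
  then obtain F where F: "F \<subseteq> \<Delta>" "consistent R' F"
    "insert b (fl F ` S) \<in> E \<longleftrightarrow> insert b S \<in> E"
    "insert b' (\<phi> ` fl F ` S) \<in> E' \<longleftrightarrow> insert b' (\<phi> ` S) \<in> E'" by blast
  have FJ: "F \<subseteq> J" using F \<Delta>_J by blast
  have bR': "(b, b') \<in> R'" using R R' by blast
  show False
    using R'(3)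
  proof
    assume dom: "S \<subseteq> fst ` R'"
    have S': "(x, \<phi> (fl F x)) \<in> R'" if x: "x \<in> S" for x
    proof -
      obtain y where "(x, y) \<in> R'" using x dom by auto
      then show ?thesis using F(2) SM x unfolding consistent_def by blast
    qed
    let ?h = "\<lambda>x. if x = b then b' else \<phi> (fl F x)"
    have "(\<lambda>x. x) ` insert b S \<in> E \<longleftrightarrow> ?h ` insert b S \<in> E'"
      by (rule position_edges[OF R'(2)]) (use S' bR' in auto)
    moreover have "?h ` insert b S = insert b' (\<phi> ` fl F ` S)"
      using bM SM by (auto simp: image_image image_def)
    ultimately show False using S(3) F(4) by simp
  next
    assume ran: "\<phi> ` S \<subseteq> snd ` R'"
    have S': "(fl F x, \<phi> x) \<in> R'" if x: "x \<in> S" for x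
      using consistent_inverse[OF R'(2) F(2) FJ] x SM ran by blast
    let ?g = "\<lambda>x. if x = b then b else fl F x" and ?h = "\<lambda>x. if x = b then b' else \<phi> x"
    have "?g ` insert b S \<in> E \<longleftrightarrow> ?h ` insert b S \<in> E'"
      by (rule position_edges[OF R'(2)]) (use S' bR' in auto)
    moreover have "?g ` insert b S = insert b (fl F ` S)" "?h ` insert b S = insert b' (\<phi> ` S)"
      using bM SM by (auto simp: image_def)
    ultimately show False using S(3) F(3) by simp
  qed
qed

lemma L_N: "a \<in> L \<Longrightarrow> a \<in> N" by (simp add: N_def)

text \<open>Spoiler exhibits one vertex more of some type than the other graph offers, in the graph
  where this is cheaper. By the last bound of \<open>fiber_counts_differ\<close> at most half of
  \<open>card (Q a)\<close> moves are needed, and the surplus of the block pays for them.\<close>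

lemma type_counts:
  assumes a: "a \<in> L"
  shows "card {b \<in> Q a - {a}. tp b = \<rho>} = card {b' \<in> Q' a - {\<phi> a}. tp' b' = \<rho>}"
proof (rule ccontr)
  assume ne0: "\<not> ?thesis"
  define B where "B = Q a - {a}"
  define B' where "B' = Q' a - {\<phi> a}"
  have aA: "a \<in> A" using a L_A by blast
  have finB: "finite B" "finite B'" using fin finQ' by (auto simp: B_def B'_def)
  have cB: "card B = card (Q a) - 1" "card B' = card (Q a) - 1"
    using A_in_Q[OF aA] \<phi>_A[OF aA] block_card_eq[OF aA] fin finQ' by (auto simp: B_def B'_def)
  have ne: "card {x \<in> B. tp x = \<rho>} \<noteq> card {y \<in> B'. tp' y = \<rho>}" using ne0 by (simp add: B_def B'_def)
  have "card B = card B'" using cB by simp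
  from fiber_counts_differ[OF finB this ne]
  obtain \<sigma> \<tau> where ts: "card {y \<in> B'. tp' y = \<tau>} < card {x \<in> B. tp x = \<tau>}"
    "card {x \<in> B. tp x = \<sigma>} < card {y \<in> B'. tp' y = \<sigma>}"
    "card {y \<in> B'. tp' y = \<tau>} + card {x \<in> B. tp x = \<sigma>} < card B"
    by blast
  have blocks: "x \<in> B \<longleftrightarrow> y \<in> B'" if "position R" "(x, y) \<in> R" for R x y
    using block_iff[OF that aA] position_N[OF that L_N[OF a]] \<phi>_N[OF L_N[OF a]] by (auto simp: B_def B'_def)
  let ?s = "(k - 1) + (if k = 2 then 0 else k - 1)"
  have mismatch: "tp x = tp' y" if "position R" "(x, y) \<in> R" "ex_game G G' ?s R \<or> all_game G G' ?s R" "x \<in> B" for R x y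
    by (rule type_mismatch[OF that(1-3) order_refl a]) (use that(4) in \<open>auto simp: B_def\<close>)
  \<comment> \<open>\<open>?s\<close> rounds stay reserved for \<open>type_mismatch\<close>. For k =
    2 a second reserved round would exceed the budget when \<open>2 * m = card (Q a)\<close>; this
    forces the special treatment of that case.\<close>
  have moves: "m + ?s \<le> r" if m: "2 * m \<le> card (Q a)" "1 \<le> m" for m
  proof (rule r_surplus[of _ "{a}"])
    have 3: "3 \<le> card (Q a)" using a by (simp add: L_def)
    show "k * (m + ?s) \<le> (\<Sum>a \<in> {a}. surplus a) + k * (2 * k - 1)"
    proof (cases "k = 2")
      case True
      then show ?thesis using surplus[OF a] that 3 by simp
    next
      case False
      then obtain j where j: "k = j + 3" using k2 by (metis Suc_leI add.commute le_Suc_ex le_neq_implies_less numeral_2_eq_2 numeral_3_eq_3)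
      have "k * m \<le> (k - 1) * (card (Q a) - 1)"
      proof (cases "m = 1")
        case True
        have "(k - 1) * 2 \<le> (k - 1) * (card (Q a) - 1)" using 3 by (intro mult_le_mono2) simp
        then show ?thesis using True j by simp
      next
        case False
        then obtain i where i: "m = i + 2" using m(2) by (metis One_nat_def Suc_1 Suc_leI add.commute le_Suc_ex le_neq_implies_less)
        have "(k - 1) * (2 * m - 1) \<le> (k - 1) * (card (Q a) - 1)" using that by (intro mult_le_mono2) simp
        moreover have "k * m \<le> (k - 1) * (2 * m - 1)" unfolding i j by (simp add: algebra_simps)
        ultimately show ?thesis by linarith
      qed
      then have "k * m \<le> surplus a + k" using surplus[OF a] by simp
      moreover have "k * ?s + k = k * (2 * k - 1)" using False by (simp add: j algebra_simps)
      ultimately show ?thesis by (simp add: distrib_left)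
    qed
  qed (use a in auto)
  show False
  proof (cases "card {y \<in> B'. tp' y = \<tau>} \<le> card {x \<in> B. tp x = \<sigma>}")
    case True
    let ?m = "Suc (card {y \<in> B'. tp' y = \<tau>})"
    have "?m \<le> card {x \<in> B. tp x = \<tau>}" using ts by simp
    then obtain D where D: "D \<subseteq> {x \<in> B. tp x = \<tau>}" "card D = ?m" by (meson obtain_subset_with_card_n)
    have finD: "finite D" using D(2) by (metis card.infinite nat.distinct(1))
    have "card D + ?s \<le> r" unfolding D(2) by (rule moves) (use ts True cB in auto)
    moreover have "D \<subseteq> V" using D by (auto simp: B_def Q_def)
    ultimately obtain R where R: "position R" "D \<subseteq> fst ` R" "ex_game G G' ?s R"
      using ex_position[OF finD] by blast
    then have "\<forall>x \<in> D. \<exists>y. (x, y) \<in> R" by force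
    then obtain h where h: "\<And>x. x \<in> D \<Longrightarrow> (x, h x) \<in> R" by metis
    have "h x \<in> {y \<in> B'. tp' y = \<tau>}" if "x \<in> D" for x
      using blocks[OF R(1) h[OF that]] mismatch[OF R(1) h[OF that]] R(3) D(1) that by auto
    moreover have "inj_on h D" using h position_eq[OF R(1)] by (metis inj_onI)
    ultimately have "card D \<le> card {y \<in> B'. tp' y = \<tau>}" using finB by (intro card_inj_on_le[of h]) auto
    then show False using D(2) by simp
  next
    case False
    let ?m = "Suc (card {x \<in> B. tp x = \<sigma>})"
    have "?m \<le> card {y \<in> B'. tp' y = \<sigma>}" using ts by simp
    then obtain D where D: "D \<subseteq> {y \<in> B'. tp' y = \<sigma>}" "card D = ?m" by (meson obtain_subset_with_card_n)
    have finD: "finite D" using D(2) by (metis card.infinite nat.distinct(1))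
    have "card D + ?s \<le> r" unfolding D(2) by (rule moves) (use ts False cB in auto)
    moreover have "D \<subseteq> V'" using D Q'_V' by (auto simp: B'_def)
    ultimately obtain R where R: "position R" "D \<subseteq> snd ` R" "all_game G G' ?s R"
      using all_position[OF finD] by blast
    then have "\<forall>y \<in> D. \<exists>x. (x, y) \<in> R" by force
    then obtain h where h: "\<And>y. y \<in> D \<Longrightarrow> (h y, y) \<in> R" by metis
    have "h y \<in> {x \<in> B. tp x = \<sigma>}" if "y \<in> D" for y
      using blocks[OF R(1) h[OF that]] mismatch[OF R(1) h[OF that]] R(3) D(1) that by auto
    moreover have "inj_on h D" using h position_eq[OF R(1)] by (metis inj_onI)
    ultimately have "card D \<le> card {x \<in> B. tp x = \<sigma>}" using finB by (intro card_inj_on_le[of h]) auto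
    then show False using D(2) by simp
  qed
qed

text \<open>\<open>\<phi>\<close> is extended by type-preserving bijections on the large blocks. For
  edges, a vertex outside \<open>M\<close> is traded for its similar vertex in a color missed by the
  rest of \<open>e\<close>. Equality of types makes the images similar in \<open>G'\<close> too, so
  \<open>max_coloring_swap\<close> applies on both sides and the number of vertices outside
  \<open>M\<close> drops.\<close>

lemma isomorphic_matched: "isomorphic G G'"
proof -
  have "\<exists>h. bij_betw h (Q a - {a}) (Q' a - {\<phi> a}) \<and> (\<forall>b \<in> Q a - {a}. tp' (h b) = tp b)" if "a \<in> L" for a
    by (rule bij_betw_fibers) (use fin finQ' type_counts[OF that] in auto)
  then obtain \<psi> where \<psi>: "\<And>a. a \<in> L \<Longrightarrow> bij_betw (\<psi> a) (Q a - {a}) (Q' a - {\<phi> a})"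
    "\<And>a b. a \<in> L \<Longrightarrow> b \<in> Q a - {a} \<Longrightarrow> tp' (\<psi> a b) = tp b" by metis
  define \<Phi> where "\<Phi> v = (if v \<in> M then \<phi> v else \<psi> (t v) v)" for v
  have \<Phi>M: "\<Phi> v = \<phi> v" if "v \<in> M" for v using that by (simp add: \<Phi>_def)
  have \<Phi>B: "t v \<in> L" "v \<in> Q (t v) - {t v}" "\<Phi> v \<in> Q' (t v)" "\<Phi> v \<noteq> \<phi> (t v)" "tp' (\<Phi> v) = tp v"
    if v: "v \<in> V - M" for v
  proof -
    show 1: "t v \<in> L" and 2: "v \<in> Q (t v) - {t v}" using not_M[OF v] by auto
    have "\<Phi> v = \<psi> (t v) v" using v by (simp add: \<Phi>_def)
    then show "\<Phi> v \<in> Q' (t v)" "\<Phi> v \<noteq> \<phi> (t v)" "tp' (\<Phi> v) = tp v"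
      using bij_betwE[OF \<psi>(1)[OF 1]] \<psi>(2)[OF 1 2] 2 by auto
  qed
  have \<Phi>B_M: "\<Phi> v \<notin> \<phi> ` M" if v: "v \<in> V - M" for v
  proof
    assume "\<Phi> v \<in> \<phi> ` M"
    then obtain u where u: "u \<in> M" "\<Phi> v = \<phi> u" by blast
    have "u \<notin> X" using u \<phi>_X \<Phi>B(3)[OF v] Q'_X by auto
    then have uX: "u \<in> M - X" using u by blast
    then have "t u = t v" using Q'_disjoint[of "t u" "t v" "\<phi> u"] M_Q \<phi>_t u \<Phi>B(1,3)[OF v] L_A by auto
    then have "u = t v" using M_Q[OF uX] \<Phi>B(1)[OF v] by auto
    then show False using u \<Phi>B(4)[OF v] by simp
  qed
  have inj: "inj_on \<Phi> V"
  proof (rule inj_onI)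
    fix v w assume vw: "v \<in> V" "w \<in> V" "\<Phi> v = \<Phi> w"
    consider "v \<in> M" "w \<in> M" | "v \<in> M" "w \<notin> M" | "v \<notin> M" "w \<in> M" | "v \<notin> M" "w \<notin> M" by blast
    then show "v = w"
    proof cases
      case 1 then show ?thesis using vw \<phi>_inj \<Phi>M by (metis inj_onD)
    next
      case 2 then show ?thesis using vw \<Phi>B_M[of w] \<Phi>M[of v] by (metis DiffI image_eqI)
    next
      case 3 then show ?thesis using vw \<Phi>B_M[of v] \<Phi>M[of w] by (metis DiffI image_eqI)
    next
      case 4
      then have v: "v \<in> V - M" and w: "w \<in> V - M" using vw by auto
      have tv: "t v = t w"
        using Q'_disjoint[of "t v" "t w" "\<Phi> v"] \<Phi>B(1,3)[OF v] \<Phi>B(1,3)[OF w] vw L_A by auto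
      then have "\<psi> (t v) v = \<psi> (t v) w" using vw 4 by (simp add: \<Phi>_def)
      then show ?thesis
        using bij_betw_imp_inj_on[OF \<psi>(1)[OF \<Phi>B(1)[OF v]]] \<Phi>B(2)[OF v] \<Phi>B(2)[OF w] tv by (metis inj_onD)
    qed
  qed
  have sub: "\<Phi> ` V \<subseteq> V'"
  proof
    fix y assume "y \<in> \<Phi> ` V"
    then obtain v where v: "v \<in> V" "y = \<Phi> v" by blast
    show "y \<in> V'"
    proof (cases "v \<in> M")
      case True then show ?thesis using v \<Phi>M \<phi>_V' by auto
    next
      case False then show ?thesis using v \<Phi>B(3)[of v] Q'_V' by blast
    qed
  qed
  have "\<Phi> ` V = V'" by (rule card_subset_eq[OF fin' sub]) (simp add: card_image[OF inj] card_V')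
  then have bij: "bij_betw \<Phi> V V'" using inj by (simp add: bij_betw_def)
  have \<Phi>U: "\<Phi> v \<notin> colored V' c'" if "v \<in> V - U" for v
  proof (cases "v \<in> M")
    case True
    then show ?thesis unfolding colored_c' using that \<Phi>M \<phi>_inj U_M by (auto dest: inj_onD)
  next
    case False
    then show ?thesis unfolding colored_c' using that \<Phi>B_M[of v] U_M by blast
  qed
  have edges: "\<Phi> ` e \<in> E' \<longleftrightarrow> e \<in> E" if "e \<subseteq> V" "card e = k" for e
    using that
  proof (induction "card (e - M)" arbitrary: e rule: less_induct)
    case less
    have fine: "finite e" using less.prems(1) finV finite_subset by blast
    show ?case
    proof (cases "e \<subseteq> M")
      case True
      then have "\<Phi> ` e = \<phi> ` e" using \<Phi>M by (intro image_cong) auto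
      then show ?thesis using \<phi>_edges[OF True less.prems(2)] by simp
    next
      case False
      then obtain b where b: "b \<in> e" "b \<notin> M" by blast
      then have bV: "b \<in> V - M" and bU: "b \<notin> U" using less.prems U_M by auto
      let ?f = "e - {b}"
      have cf: "Suc (card ?f) = k" "finite ?f" using b fine less.prems(2) card_Suc_Diff1[of e b] by auto
      have "card (?f \<inter> U) \<le> card ?f" using cf(2) by (intro card_mono) auto
      then obtain j where j: "1 \<le> j" "j \<le> k" "\<forall>s \<in> ?f \<inter> U. c s \<noteq> j"
        using free_color[of "?f \<inter> U"] cf(1) by auto
      have "c b = 0" using bU bV c_U by auto
      then obtain a where a: "attached k V E c j b a"
        using max_coloring_attached[OF max finV _ _ j(1,2)] bV by blast
      then have aU: "a \<in> U" "c a = j" "a \<in> M" using j c_U U_M by (auto simp: attached_def)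
      have af: "a \<notin> ?f" using aU j by blast
      have split: "card (?f \<inter> U) + card (?f - U) = card ?f" using cf(2) card_Int_Diff by metis
      have 1: "insert b ((?f \<inter> U) \<union> (?f - U)) \<in> E \<longleftrightarrow> insert a ((?f \<inter> U) \<union> (?f - U)) \<in> E"
        by (rule max_coloring_swap[OF max finV])
          (use less.prems bV bU j a cf split in \<open>auto simp: U_def\<close>)
      \<comment> \<open>Similarity concerns (k - 1)-subsets of \<open>U\<close> only. There
        \<open>b\<close> and \<open>\<Phi> b\<close> have the same type, and for \<open>a\<close>,
        which lies in \<open>M\<close>, \<open>\<phi>_edges\<close> applies.\<close>
      have att': "attached k V' E' c' j (\<Phi> b) (\<Phi> a)"
      proof -
        have "similar k E' {v \<in> V'. c' v \<noteq> 0 \<and> c' v \<noteq> j} (\<Phi> b) (\<Phi> a)"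
          unfolding similar_def other_colors
        proof (intro allI impI)
          fix S assume S: "S \<subseteq> \<phi> ` {v \<in> V. c v \<noteq> 0 \<and> c v \<noteq> j}" "Suc (card S) = k"
          then obtain T where T: "T \<subseteq> {v \<in> V. c v \<noteq> 0 \<and> c v \<noteq> j}" "S = \<phi> ` T" by (meson subset_imageE)
          have TU: "T \<subseteq> U" "a \<notin> T" using T c_U aU by auto
          then have TM: "T \<subseteq> M" "finite T" using U_M fin finite_subset by blast+
          have cT: "Suc (card T) = k" using S T TM \<phi>_inj by (metis card_image inj_on_subset)
          have "insert (\<Phi> b) S \<in> E' \<longleftrightarrow> insert b T \<in> E"
          proof -
            have "T \<in> tp b \<longleftrightarrow> T \<in> tp' (\<Phi> b)" using \<Phi>B(5)[OF bV] by simp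
            then show ?thesis using TU(1) cT T(2) by (simp add: tp_def tp'_def)
          qed
          also have "\<dots> \<longleftrightarrow> insert a T \<in> E"
            using a T(1) cT by (intro similarD[of k E "{v \<in> V. c v \<noteq> 0 \<and> c v \<noteq> j}"]) (auto simp: attached_def)
          also have "\<dots> \<longleftrightarrow> \<phi> ` insert a T \<in> E'"
            using \<phi>_edges[of "insert a T"] TM TU(2) cT aU by simp
          finally show "insert (\<Phi> b) S \<in> E' \<longleftrightarrow> insert (\<Phi> a) S \<in> E'" using T \<Phi>M[OF aU(3)] by simp
        qed
        then show ?thesis using aU \<Phi>M c'_\<phi> \<phi>_V' by (auto simp: attached_def)
      qed
      have inj_f: "inj_on \<Phi> ?f" using inj less.prems(1) by (meson Diff_subset inj_on_subset subset_trans)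
      have 2: "insert (\<Phi> b) (\<Phi> ` (?f \<inter> U) \<union> \<Phi> ` (?f - U)) \<in> E' \<longleftrightarrow>
          insert (\<Phi> a) (\<Phi> ` (?f \<inter> U) \<union> \<Phi> ` (?f - U)) \<in> E'"
      proof (rule max_coloring_swap[OF max_c' fin' _ _ _ _ _ j(1,2) _ att'])
        show "\<Phi> ` (?f \<inter> U) \<subseteq> colored V' c'"
          unfolding colored_c' using \<Phi>M U_M by (auto simp: subset_iff)
        show "\<Phi> ` (?f - U) \<subseteq> V' - colored V' c'" using \<Phi>U less.prems(1) sub by blast
        show "\<Phi> b \<in> V' - colored V' c'" using \<Phi>U[of b] bV bU sub by blast
        show "\<Phi> b \<notin> \<Phi> ` (?f - U)" using inj bV less.prems(1) by (auto dest: inj_onD)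
        have "card (\<Phi> ` (?f \<inter> U)) + card (\<Phi> ` (?f - U)) = card (?f \<inter> U) + card (?f - U)"
          using inj_f by (simp add: card_image inj_on_subset)
        then show "Suc (card (\<Phi> ` (?f \<inter> U)) + card (\<Phi> ` (?f - U))) = k" using split cf by simp
        show "c' s \<noteq> j" if s: "s \<in> \<Phi> ` (?f \<inter> U)" for s
        proof -
          obtain u where u: "u \<in> ?f \<inter> U" "s = \<Phi> u" using s by blast
          then have "s = \<phi> u" using \<Phi>M U_M by blast
          then show ?thesis using u j(3) c'_\<phi> by auto
        qed
      qed
      have eq: "(?f \<inter> U) \<union> (?f - U) = ?f" by blast
      have eq': "\<Phi> ` (?f \<inter> U) \<union> \<Phi> ` (?f - U) = \<Phi> ` ?f" by blast
      have "insert b ?f = e" using b by blast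
      then have "e \<in> E \<longleftrightarrow> insert a ?f \<in> E" "\<Phi> ` e \<in> E' \<longleftrightarrow> \<Phi> ` insert a ?f \<in> E'"
        using 1[unfolded eq] 2[unfolded eq'] by (metis image_insert)+
      moreover have "\<Phi> ` insert a ?f \<in> E' \<longleftrightarrow> insert a ?f \<in> E"
      proof (rule less.hyps)
        have "insert a ?f - M = (e - M) - {b}" using aU by blast
        moreover have "b \<in> e - M" using b by blast
        ultimately show "card (insert a ?f - M) < card (e - M)"
          using fine by (metis card_Diff1_less finite_Diff)
        show "insert a ?f \<subseteq> V" using aU MV less.prems(1) by blast
        show "card (insert a ?f) = k" using af cf by simp
      qed
      ultimately show ?thesis by simp
    qed
  qed
  have "\<Phi> ` e \<in> E' \<longleftrightarrow> e \<in> E" if "e \<subseteq> V" for e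
  proof (cases "card e = k")
    case True
    then show ?thesis using edges that by blast
  next
    case False
    then have "card (\<Phi> ` e) \<noteq> k" using inj that by (metis card_image inj_on_subset)
    then have "\<Phi> ` e \<notin> E'" using k_graph' by (auto simp: k_graph_def)
    moreover have "e \<notin> E" using False uniform by auto
    ultimately show ?thesis by simp
  qed
  then show ?thesis using bij unfolding isomorphic_def by blast
qed

end

lemma (in game_state) isomorphic_game_state: "isomorphic G G'"
proof -
  obtain \<phi> where "\<forall>x \<in> N. \<phi> x = \<phi>0 x" "inj_on \<phi> M" "\<forall>a \<in> A - L. \<phi> ` Q a = Q' a"
    "\<forall>v \<in> M - X. \<phi> v \<in> Q' (t v)"
    "\<forall>a \<in> J. d a = i0 \<longrightarrow> (\<exists>R. position R \<and> W a \<subseteq> fst ` R \<and> (a, \<phi> a) \<in> R)"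
    using matching_exists by blast
  then interpret matched k G c \<iota> d i0 G' R0 r \<phi>
    by unfold_locales auto
  show ?thesis by (rule isomorphic_matched)
qed

section \<open>The upper bound\<close>

lemma max_coloring_exists:
  assumes "finite V"
  shows "\<exists>c. max_coloring k V E c"
proof -
  let ?m = "\<lambda>c. card (colored V c)"
  have "separating_coloring k V E (\<lambda>_. 0)" by (simp add: separating_coloring_def)
  moreover have "\<forall>c. separating_coloring k V E c \<longrightarrow> ?m c < Suc (card V)"
    using assms by (auto simp: colored_def less_Suc_eq_le intro: card_mono)
  ultimately show ?thesis
    using ex_has_greatest_nat[of "separating_coloring k V E" _ ?m] unfolding max_coloring_def by blast
qed

lemma largest_fiber:
  assumes "finite S" "f ` S \<subseteq> {1..k}" "0 < k"
  shows "\<exists>i \<in> {1..k}. card S \<le> k * card {x \<in> S. f x = i}"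
proof (rule ccontr)
  assume "\<not> ?thesis"
  then have "\<And>i. i \<in> {1..k} \<Longrightarrow> k * card {x \<in> S. f x = i} < card S"
    by (metis not_le_imp_less)
  then have "(\<Sum>i \<in> {1..k}. k * card {x \<in> S. f x = i}) < (\<Sum>i \<in> {1..k}. card S)"
    using assms(3) by (intro sum_strict_mono) auto
  moreover have "(\<Sum>i \<in> {1..k}. card {x \<in> S. f x = i}) = card (\<Union>i \<in> {1..k}. {x \<in> S. f x = i})"
    using assms(1) by (intro card_UN_disjoint[symmetric]) auto
  moreover have "(\<Union>i \<in> {1..k}. {x \<in> S. f x = i}) = S" using assms(2) by blast
  ultimately show False by (simp add: sum_distrib_left[symmetric])
qed

text \<open>\<open>\<iota>\<close> and \<open>i0\<close> are the most frequent colors of vertices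
  and of colored pairs, left without pebbles. Duplicator's survival would then establish a
  \<open>game_state\<close>, hence an isomorphism.\<close>

lemma pebbling_exists:
  assumes k: "2 \<le> k" and G: "k_graph k G" "k_graph k G'"
    and n: "card (verts G) = n" "card (verts G') = n" and ne: "verts G \<noteq> {}"
    and max: "max_coloring k (verts G) (edges G) c"
    and max': "\<And>c'. separating_coloring k (verts G') (edges G') c' \<Longrightarrow>
       card (colored (verts G') c') \<le> card (colored (verts G) c)"
    and noniso: "\<not> isomorphic G G'"
  obtains p r where "set p \<subseteq> verts G" "0 < length p + r"
    "\<And>p'. length p' = length p \<Longrightarrow> set p' \<subseteq> verts G' \<Longrightarrow>
      ex_game G G' r (set (zip p p')) \<Longrightarrow> all_game G G' r (set (zip p p')) \<Longrightarrow> False"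
    "k * (length p + r) \<le> (k - 1) * n + k * (2 * k - 1)"
proof -
  have finV: "finite (verts G)" using G by (simp add: k_graph_def)
  have "\<exists>\<iota> \<in> {1..k}. card (colored (verts G) c) \<le> k * card {v \<in> colored (verts G) c. c v = \<iota>}"
    using max finV k by (intro largest_fiber) (auto simp: colored_def max_coloring_def separating_coloring_def)
  then obtain \<iota> where \<iota>: "1 \<le> \<iota>" "\<iota> \<le> k"
    "card (colored (verts G) c) \<le> k * card {v \<in> colored (verts G) c. c v = \<iota>}" by auto
  interpret mc: max_colored k "verts G" "edges G" c \<iota>
    by unfold_locales (use k finV max \<iota> G in \<open>auto simp: k_graph_def\<close>)
  have "{v \<in> colored (verts G) c. c v = \<iota>} = mc.A" using \<iota> by (auto simp: mc.A_def colored_def)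
  then have big: "card mc.U \<le> k * card mc.A" using \<iota>(3) by (simp add: mc.U_def)
  obtain d where d: "mc.pair_coloring k (edges G) d"
    "\<And>F e. F \<subseteq> {a \<in> mc.J. d a = 0} \<Longrightarrow> e \<subseteq> mc.M \<Longrightarrow> card e = k \<Longrightarrow>
       flip mc.t mc.mate F ` e \<in> edges G \<longleftrightarrow> e \<in> edges G"
    using mc.pair_coloring_exists[of k "edges G"] k by auto
  define Jc where "Jc = {a \<in> mc.J. d a \<noteq> 0}"
  have finJc: "finite Jc" using mc.fin by (simp add: Jc_def)
  have "\<exists>i0 \<in> {1..k}. card Jc \<le> k * card {a \<in> Jc. d a = i0}"
    using finJc k d(1) by (intro largest_fiber) (auto simp: Jc_def mc.pair_coloring_def)
  then obtain i0 where i0: "1 \<le> i0" "card Jc \<le> k * card {a \<in> Jc. d a = i0}" by auto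
  define D where "D = mc.J - mc.hidden d i0"
  define N where "N = mc.X \<union> mc.L \<union> D"
  have "D = Jc - {a \<in> Jc. d a = i0}" by (auto simp: D_def Jc_def mc.hidden_def)
  then have "card D = card Jc - card {a \<in> Jc. d a = i0}" using finJc by (simp add: card_Diff_subset)
  moreover obtain K where K: "k = Suc K" using k by (cases k) auto
  ultimately have "k * card D \<le> K * card Jc"
    using i0(2) by (simp add: diff_mult_distrib2)
  also have "\<dots> \<le> K * card mc.J" using mc.fin by (intro mult_le_mono2 card_mono) (auto simp: Jc_def)
  finally have D: "k * card D \<le> (k - 1) * card mc.J" by (simp add: K)
  have budget: "k * card N + (\<Sum>a \<in> mc.L. mc.surplus a) \<le> (k - 1) * card (verts G)"
    by (rule mc.budget[OF big _ D]) (auto simp: N_def D_def)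
  define T where "T = (k - 1) * n + k * (2 * k - 1)"
  \<comment> \<open>Everything affordable is spent: \<open>card N + r\<close> is the integer part of
    \<open>T\<close> divided by k, so \<open>r\<close> dominates every admissible number of
    moves.\<close>
  define r where "r = T div k - card N"
  have "k * (card N + (2 * k - 1)) \<le> T" using budget n by (simp add: T_def distrib_left)
  then have N_T: "card N + (2 * k - 1) \<le> T div k"
    using k by (metis div_le_mono nonzero_mult_div_cancel_left not_numeral_le_zero)
  have finN: "finite N" "N \<subseteq> verts G"
    using mc.fin mc.XV mc.L_A mc.J_A mc.AV by (auto simp: N_def D_def)
  obtain p where p: "set p = N" "distinct p" using finite_distinct_list[OF finN(1)] by blast
  have len: "length p = card N" using p distinct_card by fastforce
  show ?thesis
  proof (rule that[of p r])
    show "set p \<subseteq> verts G" using p finN by simp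
    show "0 < length p + r" using N_T k by (simp add: r_def len)
    have "card N + r = T div k" using N_T by (simp add: r_def)
    then show "k * (length p + r) \<le> (k - 1) * n + k * (2 * k - 1)"
      by (simp add: len T_def)
    fix p' assume p': "length p' = length p" "set p' \<subseteq> verts G'"
      "ex_game G G' r (set (zip p p'))" "all_game G G' r (set (zip p p'))"
    have dom: "fst ` set (zip p p') = N"
      using p'(1) p(1) by (metis list.set_map map_fst_zip)
    have "game_state k G c \<iota> d i0 G' (set (zip p p')) r"
    proof unfold_locales
      show "set (zip p p') \<subseteq> verts G \<times> verts G'"
        using p finN p'(2) by (auto dest: set_zip_leftD set_zip_rightD)
      show "m \<le> r" if m: "k * (card (fst ` set (zip p p')) + m) \<le> (k - 1) * card (verts G) + k * (2 * k - 1)" for m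
      proof -
        have "k * (card N + m) \<le> T" using m n dom by (simp add: T_def)
        then have "card N + m \<le> T div k"
          using k by (metis div_le_mono nonzero_mult_div_cancel_left not_numeral_le_zero)
        then show ?thesis by (simp add: r_def)
      qed
    qed (use G n ne d i0 dom p' budget max' in \<open>auto simp: N_def D_def mc.U_def\<close>)
    then show False using game_state.isomorphic_game_state noniso by blast
  qed
qed

lemma isomorphic_sym:
  assumes "isomorphic G G'"
  shows "isomorphic G' G"
proof -
  obtain f where f: "bij_betw f (verts G) (verts G')"
    "\<And>e. e \<subseteq> verts G \<Longrightarrow> f ` e \<in> edges G' \<longleftrightarrow> e \<in> edges G"
    using assms by (auto simp: isomorphic_def)
  let ?g = "inv_into (verts G) f"
  have "?g ` e \<in> edges G \<longleftrightarrow> e \<in> edges G'" if "e \<subseteq> verts G'" for e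
  proof -
    have "f ` ?g ` e = e" using f(1) that by (simp add: bij_betw_def image_inv_into_cancel)
    moreover have "?g ` e \<subseteq> verts G" using bij_betw_inv_into[OF f(1)] that by (auto simp: bij_betw_def)
    ultimately show ?thesis using f(2) by metis
  qed
  then show ?thesis using bij_betw_inv_into[OF f(1)] by (auto simp: isomorphic_def)
qed

theorem theorem9p1:
  fixes G :: "'a hypergraph" and G' :: "'b hypergraph" and k n :: nat
  assumes "k \<ge> 2"
    and "k_graph k G" and "card (verts G) = n"
    and "k_graph k G'" and "card (verts G') = n"
    and "\<not> isomorphic G G'"
  shows "ereal_of_enat (D_alt 1 k G G') \<le> ereal ((1 - 1 / real k) * real n + 2 * real k - 1)"
proof -
  have fin: "finite (verts G)" "finite (verts G')" using assms by (auto simp: k_graph_def)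
  \<comment> \<open>Two k-graphs without vertices are isomorphic, since a positive k rules out the
    empty edge.\<close>
  have ne: "verts G \<noteq> {}"
  proof
    assume "verts G = {}"
    moreover from this have "verts G' = {}" using assms(3,5) fin by auto
    ultimately have "{} \<notin> edges G" "{} \<notin> edges G'" using assms(1,2,4) by (auto simp: k_graph_def)
    moreover have "bij_betw f {} {}" for f :: "'a \<Rightarrow> 'b" by (simp add: bij_betw_def)
    ultimately show False using assms(6) \<open>verts G = {}\<close> \<open>verts G' = {}\<close> by (auto simp: isomorphic_def)
  qed
  then have ne': "verts G' \<noteq> {}" using assms(3,5) fin by auto
  obtain c c' where c: "max_coloring k (verts G) (edges G) c" and c': "max_coloring k (verts G') (edges G') c'"
    using max_coloring_exists fin by metis
  \<comment> \<open>The graph whose maximal coloring covers more vertices is pebbled. If this is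
    \<open>G'\<close>, the bound for the reverse order, obtained from the negated formula, is
    used.\<close>
  have "\<exists>m. D_alt 1 k G G' \<le> enat m \<and> k * m \<le> (k - 1) * n + k * (2 * k - 1)"
  proof (cases "card (colored (verts G') c') \<le> card (colored (verts G) c)")
    case True
    then have "card (colored (verts G') c'') \<le> card (colored (verts G) c)"
      if "separating_coloring k (verts G') (edges G') c''" for c''
      using c' that unfolding max_coloring_def by (meson le_trans)
    from pebbling_exists[OF assms(1,2,4,3,5) ne c this assms(6)]
    obtain p r where pr: "set p \<subseteq> verts G" "0 < length p + r"
      "\<And>p'. length p' = length p \<Longrightarrow> set p' \<subseteq> verts G' \<Longrightarrow>
        ex_game G G' r (set (zip p p')) \<Longrightarrow> all_game G G' r (set (zip p p')) \<Longrightarrow> False"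
      "k * (length p + r) \<le> (k - 1) * n + k * (2 * k - 1)"
      by blast
    then show ?thesis using D_alt_le_game(1)[OF assms(2,4) ne pr(2,1,3)] by blast
  next
    case False
    then have "card (colored (verts G) c'') \<le> card (colored (verts G') c')"
      if "separating_coloring k (verts G) (edges G) c''" for c''
      using c that unfolding max_coloring_def by (meson le_trans nat_le_linear)
    moreover have "\<not> isomorphic G' G" using assms(6) isomorphic_sym by blast
    ultimately obtain p r where pr: "set p \<subseteq> verts G'" "0 < length p + r"
      "\<And>p'. length p' = length p \<Longrightarrow> set p' \<subseteq> verts G \<Longrightarrow>
        ex_game G' G r (set (zip p p')) \<Longrightarrow> all_game G' G r (set (zip p p')) \<Longrightarrow> False"
      "k * (length p + r) \<le> (k - 1) * n + k * (2 * k - 1)"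
      using pebbling_exists[OF assms(1,4,2,5,3) ne' c'] by blast
    then show ?thesis using D_alt_le_game(2)[OF assms(4,2) ne' pr(2,1,3)] by blast
  qed
  then obtain m where m: "D_alt 1 k G G' \<le> enat m" "k * m \<le> (k - 1) * n + k * (2 * k - 1)" by blast
  have "real (k * m) \<le> real ((k - 1) * n + k * (2 * k - 1))" using m(2) by linarith
  then have "real k * real m \<le> (real k - 1) * real n + real k * (2 * real k - 1)"
    using assms(1) by (simp add: of_nat_diff)
  then have "real m \<le> (1 - 1 / real k) * real n + 2 * real k - 1"
    using assms(1) by (simp add: field_simps)
  moreover have "ereal_of_enat (D_alt 1 k G G') \<le> ereal (real m)"
    using m(1) ereal_of_enat_le_iff[of "D_alt 1 k G G'" "enat m"] by simp
  ultimately show ?thesis by (meson ereal_less_eq(3) order_trans)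
qed

end
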